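(* Let $\{m_n\}_{n=1}^\infty\subset\mathbb{Z}_+$ be a sequence of positive integers, $\theta_n:=m_n/n$, $\Theta_+=\{\theta_n\}_{n=1}^\infty$, $\Theta=\Theta_+\cup(-\Theta_+)\cup\{0\}$. Then there is $W\in C^\infty(\mathbb{R};\mathbb{R})$ of the form $W(x)=\sum_{\theta\in\Theta}e^{i\theta x}w_\theta(x)$, where for all $k,N\ge0$ there is $C_{k,N}>0$ with $$|\partial_x^kw_\theta(x)|\le C_{k,N}\langle x\rangle^{-k}\langle\theta\rangle^{-N}\quad(\theta\in\Theta),\qquad|\partial_x^kw_{\theta_n}(x)|\le C_{k,N}\langle x\rangle^{-k}\langle n\rangle^{-N}\quad(n\ge1),$$ such that for all $n$, $\frac{m_n^2}{4n^2}$ is contained in the point spectrum of $-\Delta+W$. In particular, if $\mathbb{Q}\cap\mathbb{R}_+=\{\frac{m_n}{n}\}_{n=1}^\infty$, then this operator has dense pure point spectrum.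
   Context: $\Delta=\partial_x^2$, the operator $-\Delta+W$ acts on $L^2(\mathbb{R})$, $\mathbb{R}_+=(0,\infty)$, and $\langle x\rangle=(1+|x|^2)^{1/2}$. A number is in the point spectrum if it is an eigenvalue with an eigenfunction in $L^2(\mathbb{R})$.
   Formalization: If a value θ_n occurs for infinitely many n, the second bound is required only at its first index (read for every n it forces w_{θ_n}=0 and the claim can fail). "Dense pure point spectrum" means that the eigenvalues are dense in [0,∞); absence of continuous spectrum is not asserted. *)

theory Defs
  imports "HOL-Analysis.Analysis"
begin

definition vderiv :: "(real \<Rightarrow> 'a::real_normed_vector) \<Rightarrow> real \<Rightarrow> 'a" where
  "vderiv f = (\<lambda>x. vector_derivative f (at x))"

definition smooth :: "(real \<Rightarrow> 'a::real_normed_vector) \<Rightarrow> bool" where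
  "smooth f \<longleftrightarrow> (\<forall>k x. (vderiv ^^ k) f differentiable (at x))"

definition japanese :: "real \<Rightarrow> real" where
  "japanese x = sqrt (1 + x\<^sup>2)"

text \<open>Elements of \<open>L\<^sup>2(\<real>)\<close> are represented by Borel functions; equality in \<open>L\<^sup>2(\<real>)\<close> is
  equality almost everywhere.\<close>

definition L2 :: "(real \<Rightarrow> complex) \<Rightarrow> bool" where
  "L2 u \<longleftrightarrow> u \<in> borel_measurable lborel \<and> integrable lborel (\<lambda>x. (cmod (u x))\<^sup>2)"

definition test_function :: "(real \<Rightarrow> real) \<Rightarrow> bool" where
  "test_function \<phi> \<longleftrightarrow> smooth \<phi> \<and> compact (closure {x. \<phi> x \<noteq> 0})"

text \<open>Only used for square-integrable \<open>u\<close> and \<open>v\<close>, for which both integrands are integrable.\<close>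

definition weak_deriv :: "(real \<Rightarrow> complex) \<Rightarrow> (real \<Rightarrow> complex) \<Rightarrow> bool" where
  "weak_deriv u v \<longleftrightarrow>
     (\<forall>\<phi>. test_function \<phi> \<longrightarrow>
        (LINT x|lborel. vderiv \<phi> x *\<^sub>R u x) = - (LINT x|lborel. \<phi> x *\<^sub>R v x))"

text \<open>The graph of \<open>-\<Delta> + W\<close> in \<open>L\<^sup>2(\<real>)\<close>, with domain all \<open>u \<in> H\<^sup>2(\<real>)\<close> such that
  \<open>-u'' + W u \<in> L\<^sup>2(\<real>)\<close>; for bounded \<open>W\<close> this domain is \<open>H\<^sup>2(\<real>)\<close>.\<close>

definition schroedinger :: "(real \<Rightarrow> real) \<Rightarrow> ((real \<Rightarrow> complex) \<times> (real \<Rightarrow> complex)) set" where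
  "schroedinger W =
     {(u, f). L2 u \<and> L2 f \<and>
        (\<exists>u1 u2. L2 u1 \<and> L2 u2 \<and> weak_deriv u u1 \<and> weak_deriv u1 u2 \<and>
           (AE x in lborel. f x = - u2 x + complex_of_real (W x) * u x))}"

definition point_spectrum ::
    "((real \<Rightarrow> complex) \<times> (real \<Rightarrow> complex)) set \<Rightarrow> complex set" where
  "point_spectrum A =
     {z. \<exists>u. (u, \<lambda>x. z * u x) \<in> A \<and> \<not> (AE x in lborel. u x = 0)}"

text \<open>The pure point spectrum is understood as the set of eigenvalues, and dense as dense in
  the half-line \<open>[0,\<infinity>)\<close>. No absence of continuous spectrum is asserted.\<close>

definition dense_pure_point_spectrum ::
    "((real \<Rightarrow> complex) \<times> (real \<Rightarrow> complex)) set \<Rightarrow> bool" where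
  "dense_pure_point_spectrum A \<longleftrightarrow> complex_of_real ` {0..} \<subseteq> closure (point_spectrum A)"

definition theta :: "(nat \<Rightarrow> nat) \<Rightarrow> nat \<Rightarrow> real" where
  "theta m n = real (m n) / real n"

definition Theta_pos :: "(nat \<Rightarrow> nat) \<Rightarrow> real set" where
  "Theta_pos m = theta m ` {1..}"

definition Theta :: "(nat \<Rightarrow> nat) \<Rightarrow> real set" where
  "Theta m = Theta_pos m \<union> uminus ` Theta_pos m \<union> {0}"

text \<open>The indices \<open>n\<close> at which the amplitude with frequency \<open>theta m n\<close> is estimated by powers
  of \<open>n\<close>. These are all \<open>n \<ge> 1\<close> when every frequency is attained finitely often, in
  particular when \<open>theta m\<close> is injective. A bound by \<open>C n\<^sup>-\<^sup>N\<close> at infinitely many \<open>n\<close> with the same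
  frequency would force its amplitude to vanish, so for a frequency attained infinitely often
  only its first index is used.\<close>

definition decay_index :: "(nat \<Rightarrow> nat) \<Rightarrow> nat \<Rightarrow> bool" where
  "decay_index m n \<longleftrightarrow> n \<ge> 1 \<and>
     (finite {j. j \<ge> 1 \<and> theta m j = theta m n} \<or>
      (\<forall>j. 1 \<le> j \<and> j < n \<longrightarrow> theta m j \<noteq> theta m n))"

end

theory Submission
  imports Defs "HOL-Probability.Sinc_Integral" "HOL-Real_Asymp.Real_Asymp"
begin

text \<open>
The potential \<open>W\<close> is even and is a sum of blocks. The \<open>i\<close>-th block lives on \<open>2\<^sup>i \<le> \<bar>x\<bar> \<le> 2 \<cdot> 2\<^sup>i\<close> and
  equals \<open>(i / 2\<^sup>i) \<chi>(x / 2\<^sup>i) cos (\<theta> x + \<psi>\<^sub>i)\<close> for \<open>x > 0\<close>, with a fixed smooth bump \<open>\<chi>\<close> on \<open>[1, 2]\<close>, one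
  frequency \<open>\<theta> = \<theta>\<^sub>n\<close>, \<open>n = n(i)\<close>, and a constant phase \<open>\<psi>\<^sub>i\<close>. A rescaled bump is a symbol of order
  zero, uniformly in \<open>i\<close>, and at each point at most one block is nonzero, so all interaction
  between different frequencies happens through the solutions and not inside the potential. This
  is a block version of the Wigner--von Neumann construction.

  A real solution of \<open>- u'' + W u = \<kappa>\<^sup>2 u\<close> is written as \<open>u = 2 Re (A exp (i \<kappa> x))\<close>, where
  \<open>A' = W / (2 i \<kappa>) (A + exp (- 2 i \<kappa> x) cnj A)\<close>. On a block of frequency \<open>\<theta> \<noteq> 2 \<kappa>\<close> the right-hand side only
  oscillates; one integration by parts (\<open>normal_form_derivative\<close>) shows that \<open>\<bar>A\<bar>\<close> at most doubles if
  \<open>i\<close> is large (\<open>nonresonant_block\<close>). On a block with \<open>\<theta> = 2 \<kappa>\<close> a mean part survives: \<open>A\<close> shrinks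
  along one axis and grows along the orthogonal one, at a rate proportional to \<open>\<chi>(x / 2\<^sup>i) i / 2\<^sup>i\<close>, that is by factors
  \<open>exp (- c i)\<close> and \<open>exp (c i)\<close> across the block. If the growing component of \<open>A\<close> vanishes at the right end of the
  block, the estimate \<open>resonant_block\<close>, which runs backwards from there, gives the decay \<open>exp (- c i)\<close>.

  The phase makes the growing component vanish: raising \<open>\<psi>\<^sub>i\<close> by \<open>2 \<pi>\<close> leaves the potential unchanged
  but reverses the axis, so that component changes its sign, and the intermediate value theorem
  gives a zero (\<open>tuned_exists\<close>). The condition on \<open>\<psi>\<^sub>i\<close> involves only the blocks before \<open>i\<close>, so the
  phases are chosen recursively (\<open>tuned_phases\<close>).

  With \<open>n(i)\<close> the 2-adic valuation of \<open>i\<close>, every \<open>n \<ge> 1\<close> returns periodically. Between two visits the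
  amplitude grows by a factor that depends only on \<open>n\<close>, while each visit shrinks it by \<open>exp (- c i)\<close>, so
  \<open>\<bar>A(2\<^sup>i)\<bar> = O(2\<^sup>-\<^sup>i)\<close> (\<open>recurrent_decay\<close>), \<open>u(x) = O(1 / x)\<close>, and the even extension of \<open>u\<close> is
  an eigenfunction (\<open>decaying_amplitude_eigenvalue\<close>). Each frequency is used only from a late block on:
  late enough for the averaging estimates that concern the eigenvalues of smaller index, and so late
  that \<open>i / 2\<^sup>i\<close> is bounded by a constant times \<open>(n + \<theta>\<^sub>n)\<^sup>-\<^sup>N\<close> for every \<open>N\<close> (\<open>symbol_theta_bound\<close>).
\<close>

section \<open>Smooth functions and a bump function\<close>

text \<open>Differentiability up to order \<open>n\<close>, a finite truncation of \<open>smooth\<close> on which closure properties can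
  be proved by induction: the derivative of a product is a sum of products of lower order.\<close>

definition ck :: "nat \<Rightarrow> (real \<Rightarrow> 'a::real_normed_vector) \<Rightarrow> bool" where
  "ck n f \<longleftrightarrow> (\<forall>k<n. \<forall>x. (vderiv ^^ k) f differentiable (at x))"

lemma smooth_iff_ck: "smooth f \<longleftrightarrow> (\<forall>n. ck n f)"
  unfolding smooth_def ck_def by blast

lemma smooth_imp_continuous_on:
  assumes "smooth f"
  shows "continuous_on S f"
proof -
  have "f differentiable (at x)" for x
    using assms[unfolded smooth_def, rule_format, of 0] by simp
  then show ?thesis
    by (intro continuous_at_imp_continuous_on ballI) (rule differentiable_imp_continuous_within)
qed

lemma ck_0 [simp]: "ck 0 f"
  by (simp add: ck_def)

lemma vderivI: "(\<And>x. (f has_vector_derivative f' x) (at x)) \<Longrightarrow> vderiv f = f'"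
  by (auto simp: vderiv_def vector_derivative_at)

lemma has_vector_derivative_vderiv:
  "f differentiable (at x) \<Longrightarrow> (f has_vector_derivative vderiv f x) (at x)"
  by (simp add: vderiv_def vector_derivative_works)

lemma ck_Suc: "ck (Suc n) f \<longleftrightarrow> (\<forall>x. f differentiable (at x)) \<and> ck n (vderiv f)"
proof -
  have "(\<forall>k<Suc n. P k) \<longleftrightarrow> P 0 \<and> (\<forall>k<n. P (Suc k))" for P
    using less_Suc_eq_0_disj by auto
  then show ?thesis
    unfolding ck_def by (simp only: funpow_Suc_right) simp
qed

lemma ck_SucI:
  assumes "\<And>x. (f has_vector_derivative f' x) (at x)" "ck n f'"
  shows "ck (Suc n) f"
  using assms vderivI[of f f'] by (auto simp: ck_Suc intro: differentiableI_vector)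

lemma ck_SucD:
  assumes "ck (Suc n) f"
  shows "(f has_vector_derivative vderiv f x) (at x)" "ck n (vderiv f)" "ck n f"
  using assms by (auto simp: ck_Suc has_vector_derivative_vderiv) (use assms in \<open>auto simp: ck_def\<close>)

lemma ck_const: "ck n (\<lambda>x. c)"
proof (induction n arbitrary: c)
  case (Suc n)
  show ?case by (rule ck_SucI[where f' = "\<lambda>x. 0"]) (auto intro: Suc)
qed simp

lemma ck_add: "ck n f \<Longrightarrow> ck n g \<Longrightarrow> ck n (\<lambda>x. f x + g x)"
proof (induction n arbitrary: f g)
  case (Suc n)
  note d = ck_SucD[OF Suc.prems(1)] ck_SucD[OF Suc.prems(2)]
  show ?case
    by (rule ck_SucI[OF has_vector_derivative_add[OF d(1) d(4)]]) (intro Suc.IH d)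
qed simp

lemma ck_linear:
  assumes "bounded_linear h"
  shows "ck n f \<Longrightarrow> ck n (\<lambda>x. h (f x))"
proof (induction n arbitrary: f)
  case (Suc n)
  note d = ck_SucD[OF Suc.prems]
  show ?case
    by (rule ck_SucI[OF bounded_linear.has_vector_derivative[OF assms d(1)]]) (intro Suc.IH d)
qed simp

lemma ck_mult:
  fixes f g :: "real \<Rightarrow> 'a::real_normed_algebra"
  shows "ck n f \<Longrightarrow> ck n g \<Longrightarrow> ck n (\<lambda>x. f x * g x)"
proof (induction n arbitrary: f g)
  case (Suc n)
  note d = ck_SucD[OF Suc.prems(1)] ck_SucD[OF Suc.prems(2)]
  show ?case
    by (rule ck_SucI[OF has_vector_derivative_mult[OF d(1) d(4)]]) (intro ck_add Suc.IH d)
qed simp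

lemma ck_affine:
  "ck n f \<Longrightarrow> ck n (\<lambda>x. f (s * x + t))"
proof (induction n arbitrary: f)
  case (Suc n)
  note d = ck_SucD[OF Suc.prems]
  have "((\<lambda>x. f (s * x + t)) has_vector_derivative s *\<^sub>R vderiv f (s * x + t)) (at x)" for x
    by (rule vector_diff_chain_at[where g = f and f = "\<lambda>x. s * x + t", unfolded o_def])
      (auto intro!: derivative_eq_intros d simp: has_real_derivative_iff_has_vector_derivative[symmetric])
  then show ?case
    by (rule ck_SucI) (intro ck_linear[OF bounded_linear_scaleR_right] Suc.IH d)
qed simp

lemma ck_sum: "(\<And>i. i \<in> I \<Longrightarrow> ck n (f i)) \<Longrightarrow> ck n (\<lambda>x. \<Sum>i\<in>I. f i x)"
  by (induction I rule: infinite_finite_induct) (auto intro: ck_const ck_add)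

lemma ck_cos_sin: "ck n (\<lambda>x::real. cos x) \<and> ck n (\<lambda>x::real. sin x)"
proof (induction n)
  case (Suc n)
  have "ck (Suc n) (\<lambda>x::real. cos x)"
    by (rule ck_SucI[where f' = "\<lambda>x. - sin x"])
      (use Suc ck_linear[OF bounded_linear_minus[OF bounded_linear_ident], of n sin] in
        \<open>auto intro!: derivative_eq_intros simp: has_real_derivative_iff_has_vector_derivative[symmetric]\<close>)
  moreover have "ck (Suc n) (\<lambda>x::real. sin x)"
    by (rule ck_SucI[where f' = "\<lambda>x. cos x"])
      (use Suc in \<open>auto intro!: derivative_eq_intros simp: has_real_derivative_iff_has_vector_derivative[symmetric]\<close>)
  ultimately show ?case ..
qed simp

text \<open>Differentiation is local, so a locally finite sum is differentiated term by term.\<close>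

lemma vderiv_funpow_cong_open:
  assumes "open S" "\<And>x. x \<in> S \<Longrightarrow> f x = g x"
  shows "x \<in> S \<Longrightarrow> (vderiv ^^ k) f x = (vderiv ^^ k) g x"
proof (induction k arbitrary: x)
  case (Suc k)
  have "eventually (\<lambda>y. y \<in> UNIV \<longrightarrow> (vderiv ^^ k) f y = (vderiv ^^ k) g y) (nhds x)"
    using Suc assms(1) eventually_nhds by blast
  from vector_derivative_cong_eq[OF this refl refl UNIV_I]
  show ?case by (simp add: vderiv_def[of "_ f"] vderiv_def[of "_ g"])
qed (use assms in auto)

lemma smooth_local:
  assumes "\<And>x. \<exists>S g. open S \<and> x \<in> S \<and> (\<forall>y\<in>S. f y = g y) \<and> smooth g"
  shows "smooth f"
  unfolding smooth_def
proof (intro allI)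
  fix k x
  obtain S g where S: "open S" "x \<in> S" "\<And>y. y \<in> S \<Longrightarrow> f y = g y" "smooth g"
    using assms by metis
  have "(vderiv ^^ k) g differentiable (at x)"
    using S(4) by (auto simp: smooth_def)
  then obtain D where D: "((vderiv ^^ k) g has_derivative D) (at x)"
    by (auto simp: differentiable_def)
  have "((vderiv ^^ k) f has_derivative D) (at x)"
    by (rule has_derivative_transform_within_open[OF D S(1,2)])
      (simp add: vderiv_funpow_cong_open[OF S(1,3)])
  then show "(vderiv ^^ k) f differentiable (at x)"
    by (auto simp: differentiable_def)
qed

lemma vderiv_funpow_add:
  assumes "smooth f" "smooth g"
  shows "(vderiv ^^ k) (\<lambda>x. f x + g x) = (\<lambda>x. (vderiv ^^ k) f x + (vderiv ^^ k) g x)"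
proof (induction k)
  case (Suc k)
  then show ?case
    using assms by (auto simp: smooth_def intro!: vderivI has_vector_derivative_add has_vector_derivative_vderiv)
qed simp

lemma vderiv_funpow_const0: "(vderiv ^^ k) (\<lambda>x. 0) = (\<lambda>x. 0)"
  by (induction k) (auto intro!: vderivI)

lemma smooth_sum: "(\<And>i. i \<in> I \<Longrightarrow> smooth (f i)) \<Longrightarrow> smooth (\<lambda>x. \<Sum>i\<in>I. f i x)"
  by (auto simp: smooth_iff_ck intro: ck_sum)

lemma vderiv_funpow_sum:
  assumes "finite I" "\<And>i. i \<in> I \<Longrightarrow> smooth (f i)"
  shows "(vderiv ^^ k) (\<lambda>x. \<Sum>i\<in>I. f i x) = (\<lambda>x. \<Sum>i\<in>I. (vderiv ^^ k) (f i) x)"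
  using assms
proof (induction I rule: finite_induct)
  case (insert i I)
  then show ?case
    using vderiv_funpow_add[of "f i" "\<lambda>x. \<Sum>i\<in>I. f i x"] by (simp add: smooth_sum)
qed (simp add: vderiv_funpow_const0)

lemma vderiv_funpow_scale:
  fixes f :: "real \<Rightarrow> real"
  assumes "smooth f"
  shows "(vderiv ^^ k) (\<lambda>x. f (s * x) *\<^sub>R c) = (\<lambda>x. (s ^ k * (vderiv ^^ k) f (s * x)) *\<^sub>R c)"
proof (induction k)
  case (Suc k)
  have d: "((vderiv ^^ k) f has_vector_derivative (vderiv ^^ Suc k) f x) (at x)" for x
    using assms by (auto simp: smooth_def intro: has_vector_derivative_vderiv)
  have "((\<lambda>x. (vderiv ^^ k) f (s * x)) has_vector_derivative s *\<^sub>R (vderiv ^^ Suc k) f (s * x)) (at x)" for x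
    by (rule vector_diff_chain_at[where g = "(vderiv ^^ k) f" and f = "\<lambda>x. s * x", unfolded o_def])
      (auto intro!: derivative_eq_intros d[simplified, unfolded has_real_derivative_iff_has_vector_derivative[symmetric]] simp: has_real_derivative_iff_has_vector_derivative[symmetric])
  then have "((\<lambda>x. (s ^ k * (vderiv ^^ k) f (s * x)) *\<^sub>R c) has_vector_derivative
      (s ^ k * (s *\<^sub>R (vderiv ^^ Suc k) f (s * x))) *\<^sub>R c) (at x)" for x
    by (auto intro!: derivative_eq_intros simp: has_real_derivative_iff_has_vector_derivative[symmetric])
  then show ?case
    using Suc by (auto intro!: vderivI simp: ac_simps)
qed simp

lemma smooth_scale:
  fixes f :: "real \<Rightarrow> real"
  assumes "smooth f"
  shows "smooth (\<lambda>x. f (s * x) *\<^sub>R c)"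
  using assms ck_affine[of _ f s 0] ck_linear[OF bounded_linear_scaleR_left[of c]]
  by (fastforce simp: smooth_iff_ck)

definition flat :: "real \<Rightarrow> real" where
  "flat x = (if x > 0 then exp (- (1 / x)) else 0)"

text \<open>Every derivative of \<open>flat\<close> is of the form \<open>p (1 / x) flat x\<close> with a polynomial \<open>p\<close>, and
  these functions vanish to all orders at \<open>0\<close>.\<close>

lemma flat_poly_tendsto: "((\<lambda>x. poly p (1 / x) * flat x) \<longlongrightarrow> 0) (at 0)"
proof -
  have 1: "((\<lambda>y::real. y ^ k * exp (- y)) \<longlongrightarrow> 0) at_top" for k
    using tendsto_power_div_exp_0[of k] by (simp add: exp_minus field_simps)
  have "((\<lambda>y. \<Sum>i\<le>degree p. coeff p i * (y ^ i * exp (- y))) \<longlongrightarrow> (\<Sum>i\<le>degree p. coeff p i * 0)) at_top"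
    by (intro tendsto_sum tendsto_mult tendsto_const 1)
  then have "((\<lambda>y. poly p y * exp (- y)) \<longlongrightarrow> 0) at_top"
    by (simp add: poly_altdef sum_distrib_right mult.assoc)
  from filterlim_compose[OF this filterlim_inverse_at_top_right]
  have "((\<lambda>x. poly p (inverse x) * exp (- inverse x)) \<longlongrightarrow> 0) (at_right 0)" .
  then have r: "((\<lambda>x. poly p (1 / x) * flat x) \<longlongrightarrow> 0) (at_right 0)"
    by (rule Lim_transform_eventually)
      (auto simp: flat_def eventually_at_right_less inverse_eq_divide
        intro: eventually_mono[OF eventually_at_right_less])
  have l: "((\<lambda>x. poly p (1 / x) * flat x) \<longlongrightarrow> 0) (at_left 0)"
    by (rule Lim_transform_eventually[OF tendsto_const])
      (auto simp: flat_def eventually_at_filter)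
  show ?thesis
    using l r by (simp add: filterlim_split_at)
qed

text \<open>At \<open>0\<close> the difference quotient is again of the form covered by \<open>flat_poly_tendsto\<close>, with the
  polynomial multiplied by its variable.\<close>

lemma flat_poly_deriv:
  "((\<lambda>x. poly p (1 / x) * flat x) has_real_derivative
      poly ([:0, 0, 1:] * (p - pderiv p)) (1 / x) * flat x) (at x)"
proof (cases "x = 0")
  case True
  have "((\<lambda>h. poly (pCons 0 p) (1 / h) * flat h) \<longlongrightarrow> 0) (at 0)"
    by (rule flat_poly_tendsto)
  then show ?thesis
    using True by (simp add: DERIV_def flat_def[of 0] mult.commute)
next
  case False
  define S where "S = (if x > 0 then {0<..} else {..<0::real})"
  have S: "open S" "x \<in> S" "0 \<notin> S"
    using False by (auto simp: S_def)
  have "((\<lambda>y. poly p (1 / y) * (if x > 0 then exp (- (1 / y)) else 0)) has_real_derivative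
      poly ([:0, 0, 1:] * (p - pderiv p)) (1 / x) * flat x) (at x)"
    using False by (auto simp: flat_def field_simps power2_eq_square
        intro!: derivative_eq_intros DERIV_chain2[OF poly_DERIV])
  then show ?thesis
    by (rule has_field_derivative_transform_within_open[OF _ S(1,2)])
      (auto simp: flat_def S_def split: if_splits)
qed

lemma smooth_flat: "smooth flat"
proof -
  have "ck n (\<lambda>x. poly p (1 / x) * flat x)" for n p
  proof (induction n arbitrary: p)
    case (Suc n)
    show ?case
      by (rule ck_SucI[OF _ Suc.IH])
        (rule flat_poly_deriv[unfolded has_real_derivative_iff_has_vector_derivative])
  qed simp
  from this[of _ "[:1:]"] show ?thesis
    by (simp add: smooth_iff_ck)
qed

text \<open>The profile of a single block; the closed support \<open>[1, 2]\<close> makes dyadic blocks disjoint up to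
  endpoints.\<close>

definition bump :: "real \<Rightarrow> real" where
  "bump x = flat (x - 1) * flat (2 - x)"

lemma smooth_bump: "smooth bump"
proof -
  have "ck n (\<lambda>x. flat (1 * x + (-1)) * flat ((-1) * x + 2))" for n
    using smooth_flat by (intro ck_mult ck_affine) (auto simp: smooth_iff_ck)
  then show ?thesis
    by (simp add: smooth_iff_ck bump_def[abs_def])
qed

lemma bump_nonneg: "0 \<le> bump x" and bump_le_1: "bump x \<le> 1"
  by (auto simp: bump_def flat_def intro!: mult_le_one)

lemma bump_eq_0: "x \<le> 1 \<or> 2 \<le> x \<Longrightarrow> bump x = 0"
  by (auto simp: bump_def flat_def)

lemma bump_pos: "1 < x \<Longrightarrow> x < 2 \<Longrightarrow> 0 < bump x"
  by (auto simp: bump_def flat_def)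

lemma vderiv_bump_eq_0:
  assumes "x < 1 \<or> 2 < x"
  shows "(vderiv ^^ k) bump x = 0"
proof -
  have "(vderiv ^^ k) bump x = (vderiv ^^ k) (\<lambda>x. 0) x"
    by (rule vderiv_funpow_cong_open[of "{..<1} \<union> {2<..}"]) (use assms in \<open>auto simp: bump_eq_0\<close>)
  then show ?thesis by (simp add: vderiv_funpow_const0)
qed

lemma vderiv_bump_bounded: "\<exists>B\<ge>0. \<forall>x. \<bar>(vderiv ^^ k) bump x\<bar> \<le> B"
proof -
  have "continuous_on {1..2} ((vderiv ^^ k) bump)"
    using smooth_bump by (auto simp: smooth_def intro!: continuous_at_imp_continuous_on
        differentiable_imp_continuous_within)
  then have "bounded ((vderiv ^^ k) bump ` {1..2})"
    by (intro compact_imp_bounded compact_continuous_image) auto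
  then obtain B where B: "\<And>x. x \<in> {1..2} \<Longrightarrow> \<bar>(vderiv ^^ k) bump x\<bar> \<le> B"
    unfolding bounded_iff by (metis imageI real_norm_def)
  have "\<bar>(vderiv ^^ k) bump x\<bar> \<le> max B 0" for x
    using B[of x] vderiv_bump_eq_0[of x k] by (cases "x \<in> {1..2}") auto
  then show ?thesis by (meson max.cobounded2)
qed


section \<open>Linear ordinary differential equations\<close>

text \<open>The Picard operator is a contraction with factor \<open>1 / 2\<close> on all of \<open>[0, \<infinity>)\<close> at once, if functions
  are measured relative to \<open>exp (2 K x)\<close>. The unknown \<open>v\<close> below is the solution times \<open>exp (- 2 K x)\<close>, and \<open>m\<close> extends
  it to the negative axis by its value at \<open>0\<close>, so that it is a bounded continuous function on
  the whole line.\<close>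

lemma ode_exists:
  fixes F :: "real \<Rightarrow> 'a::banach \<Rightarrow> 'a"
  assumes K: "K > 0"
    and cont: "\<And>v S. continuous_on S v \<Longrightarrow> continuous_on S (\<lambda>s. F s (v s))"
    and lip: "\<And>s y z. norm (F s y - F s z) \<le> K * norm (y - z)"
    and F0: "\<And>s. F s 0 = 0"
  shows "\<exists>y. y 0 = a \<and> (\<forall>x\<ge>0. (y has_vector_derivative F x (y x)) (at x within {0..}))"
proof -
  define m where "m x = max 0 x" for x :: real
  define G where "G v s = F s (exp (2 * K * s) *\<^sub>R v s)" for v :: "real \<Rightarrow> 'a" and s
  define I where "I v x = integral {0..x} (G v)" for v x
  define T where "T v x = exp (- 2 * K * m x) *\<^sub>R (a + I v (m x))" for v x
  have contG: "continuous_on S (G v)" if "continuous_on S v" for S v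
    unfolding G_def by (intro cont continuous_intros that)
  have derI: "(I v has_vector_derivative G v x) (at x within {0..})"
    if "continuous_on UNIV v" "x \<ge> 0" for v x
  proof -
    have "((\<lambda>u. integral {0..u} (G v)) has_vector_derivative G v x) (at x within {0..x + 1})"
      using that by (intro integral_has_vector_derivative contG) (auto intro: continuous_on_subset)
    moreover have "at x within {0..x + 1} = at x within {0..}"
      by (rule at_within_nhd[of _ "{..<x + 1}"]) auto
    ultimately show ?thesis by (simp add: I_def[abs_def])
  qed
  have contI: "continuous_on {0..} (I v)" if "continuous_on UNIV v" for v
    unfolding continuous_on_eq_continuous_within
    using has_vector_derivative_continuous[OF derI[OF that]] by auto
  have contT: "continuous_on UNIV (T v)" if "continuous_on UNIV v" for v
    unfolding T_def
    by (intro continuous_intros continuous_on_compose2[OF contI[OF that]]) (auto simp: m_def intro!: continuous_intros)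
  have Ibound: "norm (I v x - I w x) \<le> d / 2 * (exp (2 * K * x) - 1)"
    if v: "continuous_on UNIV v" "continuous_on UNIV w" and d: "\<And>x. norm (v x - w x) \<le> d" and x: "x \<ge> 0" for v w d x
  proof (cases "x = 0")
    case False
    have 1: "norm ((I v x - I w x) - (I v 0 - I w 0)) \<le> d / 2 * exp (2 * K * x) - d / 2 * exp (2 * K * 0)"
    proof (rule differentiable_bound_general)
      show "continuous_on {0..x} (\<lambda>x. I v x - I w x)"
        using v by (intro continuous_intros continuous_on_subset[OF contI]) auto
      show "((\<lambda>x. I v x - I w x) has_vector_derivative G v y - G w y) (at y)" if "0 < y" "y < x" for y
      proof -
        have "at y within {0..} = at y"
          using that by (intro at_within_interior) auto
        with derI[OF v(1), of y] derI[OF v(2), of y] that show ?thesis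
          by (auto intro: has_vector_derivative_diff)
      qed
      show "((\<lambda>x. d / 2 * exp (2 * K * x)) has_vector_derivative d * K * exp (2 * K * y)) (at y)" for y
        by (auto intro!: derivative_eq_intros simp: has_real_derivative_iff_has_vector_derivative[symmetric])
      show "norm (G v y - G w y) \<le> d * K * exp (2 * K * y)" for y
      proof -
        have "norm (G v y - G w y) \<le> K * norm (exp (2 * K * y) *\<^sub>R v y - exp (2 * K * y) *\<^sub>R w y)"
          unfolding G_def by (rule lip)
        also have "\<dots> = K * (exp (2 * K * y) * norm (v y - w y))"
          by (simp flip: scaleR_diff_right)
        also have "\<dots> \<le> K * (exp (2 * K * y) * d)"
          using K by (intro mult_left_mono d) auto
        finally show ?thesis by (simp add: ac_simps)
      qed
    qed (use x False in \<open>auto intro!: continuous_intros\<close>)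
    then show ?thesis by (simp add: I_def algebra_simps)
  qed (simp add: I_def)
  have Tbound: "norm (T v x - T w x) \<le> 1 / 2 * d"
    if "continuous_on UNIV v" "continuous_on UNIV w" "\<And>x. norm (v x - w x) \<le> d" for v w d x
  proof -
    have "d \<ge> 0" using that(3)[of 0] norm_ge_zero order_trans by blast
    have "T v x - T w x = exp (- 2 * K * m x) *\<^sub>R (I v (m x) - I w (m x))"
      by (simp add: T_def algebra_simps)
    then have "norm (T v x - T w x) = exp (- 2 * K * m x) * norm (I v (m x) - I w (m x))"
      by simp
    also have "\<dots> \<le> exp (- 2 * K * m x) * (d / 2 * (exp (2 * K * m x) - 1))"
      by (intro mult_left_mono Ibound that) (auto simp: m_def)
    also have "\<dots> = d / 2 * (1 - exp (- 2 * K * m x))"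
      by (simp add: algebra_simps flip: exp_add)
    also have "\<dots> \<le> d / 2 * 1"
      using \<open>d \<ge> 0\<close> by (intro mult_left_mono) auto
    finally show ?thesis by simp
  qed
  have T0: "norm (T (\<lambda>x. 0) x) \<le> norm a" for x
  proof -
    have "T (\<lambda>x. 0) x = exp (- 2 * K * m x) *\<^sub>R a"
      by (simp add: T_def I_def G_def[abs_def] F0)
    then show ?thesis
      using K by (auto simp: m_def intro!: mult_left_le_one_le)
  qed
  have Tb: "T (apply_bcontfun v) \<in> bcontfun" for v
  proof (rule bcontfun_normI[OF contT])
    show "continuous_on UNIV (apply_bcontfun v)" by simp
    fix x
    have "norm (T (apply_bcontfun v) x - T (\<lambda>x. 0) x) \<le> 1 / 2 * norm v"
      by (rule Tbound) (auto intro: norm_bounded)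
    then show "norm (T (apply_bcontfun v) x) \<le> 1 / 2 * norm v + norm a"
      using T0[of x] norm_triangle_sub[of "T (apply_bcontfun v) x" "T (\<lambda>x. 0) x"] by linarith
  qed
  have ap: "apply_bcontfun (Bcontfun (T (apply_bcontfun v))) = T (apply_bcontfun v)" for v
    by (rule Bcontfun_inverse[OF Tb])
  have "\<exists>!v. Bcontfun (T (apply_bcontfun v)) = v"
  proof (rule banach_fix_type)
    show "\<forall>v w. dist (Bcontfun (T (apply_bcontfun v))) (Bcontfun (T (apply_bcontfun w))) \<le> 1 / 2 * dist v w"
    proof (intro allI dist_bound)
      fix v w :: "real \<Rightarrow>\<^sub>C 'a" and x
      have "norm (T (apply_bcontfun v) x - T (apply_bcontfun w) x) \<le> 1 / 2 * dist v w"
        by (rule Tbound) (auto intro: dist_bounded simp flip: dist_norm)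
      then show "dist (apply_bcontfun (Bcontfun (T (apply_bcontfun v))) x) (apply_bcontfun (Bcontfun (T (apply_bcontfun w))) x) \<le> 1 / 2 * dist v w"
        by (simp add: ap dist_norm)
    qed
  qed auto
  then obtain v where "Bcontfun (T (apply_bcontfun v)) = v" by blast
  then have fp: "T (apply_bcontfun v) = apply_bcontfun v" using ap[of v] by simp
  define y where "y x = a + I (apply_bcontfun v) x" for x
  have vy: "G (apply_bcontfun v) x = F x (y x)" if "x \<ge> 0" for x
  proof -
    have "apply_bcontfun v x = exp (- 2 * K * x) *\<^sub>R y x"
      using that by (subst fp[symmetric]) (simp add: T_def m_def y_def)
    then show ?thesis
      by (simp add: G_def flip: exp_add)
  qed
  show ?thesis
  proof (intro exI[of _ y] conjI allI impI)
    show "y 0 = a" by (simp add: y_def I_def)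
    fix x :: real assume "x \<ge> 0"
    then have "(I (apply_bcontfun v) has_vector_derivative F x (y x)) (at x within {0..})"
      using derI[of "apply_bcontfun v" x] vy by simp
    then show "(y has_vector_derivative F x (y x)) (at x within {0..})"
      unfolding y_def by (auto intro!: derivative_eq_intros)
  qed
qed

text \<open>The function \<open>(\<bar>D\<bar>\<^sup>2 + \<mu>\<^sup>2) exp (- (2 K + 1) x)\<close> decreases. The case \<open>\<mu> = 0\<close> is uniqueness for a linear
  equation, small \<open>\<mu>\<close> is continuous dependence on parameters.\<close>

lemma gronwall:
  fixes D :: "real \<Rightarrow> 'a::real_inner"
  assumes D: "\<And>x. 0 \<le> x \<Longrightarrow> x \<le> X \<Longrightarrow> (D has_vector_derivative D' x) (at x within {0..X})"
    and D0: "D 0 = 0" and X: "0 \<le> X" and K: "0 \<le> K"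
    and b: "\<And>x. 0 \<le> x \<Longrightarrow> x \<le> X \<Longrightarrow> norm (D' x) \<le> K * norm (D x) + \<mu>"
  shows "(norm (D X))\<^sup>2 \<le> \<mu>\<^sup>2 * (exp ((2 * K + 1) * X) - 1)"
proof -
  define h where "h x = (D x \<bullet> D x + \<mu>\<^sup>2) * exp (- ((2 * K + 1) * x))" for x
  define h' where "h' x = (2 * (D x \<bullet> D' x) - (2 * K + 1) * (D x \<bullet> D x + \<mu>\<^sup>2)) * exp (- ((2 * K + 1) * x))" for x
  have "(h has_real_derivative h' x) (at x within {0..X})" if "0 \<le> x" "x \<le> X" for x
  proof -
    have "((\<lambda>x. D x \<bullet> D x) has_derivative (\<lambda>t. D x \<bullet> (t *\<^sub>R D' x) + (t *\<^sub>R D' x) \<bullet> D x)) (at x within {0..X})"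
      using D[OF that] unfolding has_vector_derivative_def by (intro has_derivative_inner)
    then have "((\<lambda>x. D x \<bullet> D x) has_real_derivative 2 * (D x \<bullet> D' x)) (at x within {0..X})"
      by (simp add: has_field_derivative_def inner_commute algebra_simps mult_commute_abs)
    then show ?thesis
      unfolding h_def h'_def by (auto intro!: derivative_eq_intros simp: algebra_simps)
  qed
  moreover have "h' x \<le> 0" if "0 \<le> x" "x \<le> X" for x
  proof -
    have "D x \<bullet> D' x \<le> norm (D x) * norm (D' x)" by (rule norm_cauchy_schwarz)
    also have "\<dots> \<le> norm (D x) * (K * norm (D x) + \<mu>)" by (intro mult_left_mono b that) auto
    also have "2 * \<dots> \<le> (2 * K + 1) * (norm (D x))\<^sup>2 + \<mu>\<^sup>2"
      using sum_squares_bound[of "norm (D x)" \<mu>] by (simp add: algebra_simps power2_eq_square)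
    finally have "2 * (D x \<bullet> D' x) \<le> (2 * K + 1) * (norm (D x))\<^sup>2 + \<mu>\<^sup>2" by simp
    moreover have "0 \<le> \<mu>\<^sup>2 * K"
      using K by simp
    ultimately have "2 * (D x \<bullet> D' x) - (2 * K + 1) * (D x \<bullet> D x + \<mu>\<^sup>2) \<le> 0"
      by (simp add: algebra_simps power2_norm_eq_inner)
    then show ?thesis unfolding h'_def by (simp add: mult_le_0_iff)
  qed
  ultimately have d: "(h has_real_derivative h' x) (at x within {0..X})" "h' x \<le> 0"
    if "0 \<le> x" "x \<le> X" for x using that by auto
  have "- h 0 \<le> - h X"
  proof (rule DERIV_nonneg_imp_increasing_open[OF X])
    show "\<exists>y. ((\<lambda>x. - h x) has_real_derivative y) (at x) \<and> 0 \<le> y" if "0 < x" "x < X" for x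
      using DERIV_minus[OF d(1)[of x]] d(2)[of x] that
      by (intro exI[of _ "- h' x"]) (simp add: at_within_interior[of _ "{0..X}"])
    show "continuous_on {0..X} (\<lambda>x. - h x)"
      using d(1) by (intro continuous_intros DERIV_continuous_on) auto
  qed
  then have "h X \<le> h 0" by simp
  then have "h X * exp ((2 * K + 1) * X) \<le> h 0 * exp ((2 * K + 1) * X)" by simp
  then show ?thesis
    by (simp add: h_def D0 power2_norm_eq_inner algebra_simps flip: exp_add)
qed


section \<open>Averaging on one block\<close>

lemma vector_derivative_bound:
  fixes f :: "real \<Rightarrow> 'a::real_normed_vector"
  assumes "\<And>x. x \<in> {a..b} \<Longrightarrow> (f has_vector_derivative f' x) (at x within {a..b})"
    and "\<And>x. x \<in> {a..b} \<Longrightarrow> norm (f' x) \<le> B" and "u \<in> {a..b}" "v \<in> {a..b}"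
  shows "norm (f u - f v) \<le> B * \<bar>u - v\<bar>"
proof -
  have "norm (f u - f v) \<le> B * norm (u - v)"
    using assms
    by (intro differentiable_bound[where S = "{a..b}" and f' = "\<lambda>x t. t *\<^sub>R f' x"])
      (auto simp: has_vector_derivative_def onorm_scaleR_left onorm_id intro!: onorm_le simp: mult.commute[of _ B]
        mult_right_mono mult_left_mono)
  then show ?thesis by simp
qed

text \<open>Integration by parts as a change of unknown. If \<open>f\<close> and \<open>h\<close> oscillate, their primitives \<open>F\<close> and \<open>H\<close> are
  bounded, and subtracting \<open>a (F A + H cnj A)\<close> from \<open>A\<close> trades the term \<open>a (f A + h cnj A)\<close>, of
  order \<open>a\<close>, for terms of order \<open>a'\<close> and \<open>a\<^sup>2\<close>. Over a block of length \<open>R\<close> and height \<open>\<epsilon>\<close>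
  these integrate to the order of \<open>\<epsilon> + \<epsilon>\<^sup>2 R\<close>, which is small even when the integral \<open>\<epsilon> R\<close> of \<open>a\<close> is large.\<close>

lemma normal_form_derivative:
  fixes A D f h F H r :: "real \<Rightarrow> complex" and a a' :: "real \<Rightarrow> real"
  assumes A: "(A has_vector_derivative D x) (at x within S)"
    and D: "D x = r x + of_real (a x) * (f x * A x + h x * cnj (A x))"
    and F: "(F has_vector_derivative f x) (at x within S)"
    and H: "(H has_vector_derivative h x) (at x within S)"
    and a: "(a has_vector_derivative a' x) (at x within S)"
  shows "((\<lambda>x. A x - of_real (a x) * (F x * A x + H x * cnj (A x))) has_vector_derivative
      r x - (of_real (a' x) * (F x * A x + H x * cnj (A x)) + of_real (a x) * (F x * D x + H x * cnj (D x))))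
      (at x within S)"
proof -
  have A': "((\<lambda>x. cnj (A x)) has_vector_derivative cnj (D x)) (at x within S)"
    using bounded_linear.has_vector_derivative[OF bounded_linear_cnj A] .
  have a': "((\<lambda>x. complex_of_real (a x)) has_vector_derivative of_real (a' x)) (at x within S)"
    using bounded_linear.has_vector_derivative[OF bounded_linear_of_real a] .
  show ?thesis
    by (rule derivative_eq_intros A A' a' F H refl)+ (simp add: D algebra_simps)
qed

lemma norm_two_terms:
  fixes u v a :: complex
  assumes "norm u \<le> M" "norm v \<le> M" "norm a \<le> s"
  shows "norm (u * a + v * cnj a) \<le> 2 * M * s"
proof -
  have "M \<ge> 0" "s \<ge> 0" using assms norm_ge_zero order_trans by blast+
  have "norm (u * a + v * cnj a) \<le> norm u * norm a + norm v * norm a"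
    by (rule order.trans[OF norm_triangle_ineq]) (simp add: norm_mult)
  also have "\<dots> \<le> M * s + M * s"
    using assms \<open>M \<ge> 0\<close> \<open>s \<ge> 0\<close> by (intro add_mono mult_mono) auto
  finally show ?thesis by simp
qed

text \<open>No mean part is present, so after \<open>normal_form_derivative\<close> the amplitude is almost constant:
  its change is at most half of its maximum over the block.\<close>

lemma nonresonant_block:
  fixes A f h F H :: "real \<Rightarrow> complex" and a a' :: "real \<Rightarrow> real"
  defines "D \<equiv> \<lambda>x. of_real (a x) * (f x * A x + h x * cnj (A x))"
  assumes A: "\<And>x. x \<in> {x0..x1} \<Longrightarrow> (A has_vector_derivative D x) (at x within {x0..x1})"
    and F: "\<And>x. (F has_vector_derivative f x) (at x)"
    and H: "\<And>x. (H has_vector_derivative h x) (at x)"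
    and a: "\<And>x. (a has_vector_derivative a' x) (at x)"
    and M: "\<And>x. norm (f x) \<le> M" "\<And>x. norm (h x) \<le> M" "\<And>x. norm (F x) \<le> M" "\<And>x. norm (H x) \<le> M"
    and eps: "\<And>x. \<bar>a x\<bar> \<le> \<epsilon>" "\<And>x. \<bar>a' x\<bar> \<le> \<eta>" and a0: "a x0 = 0"
    and small: "2 * M * \<epsilon> + (x1 - x0) * (2 * M * \<eta> + 4 * M\<^sup>2 * \<epsilon>\<^sup>2) \<le> 1 / 2"
    and x: "x \<in> {x0..x1}"
  shows "norm (A x) \<le> 2 * norm (A x0)"
proof -
  have "continuous_on {x0..x1} A"
    using has_vector_derivative_continuous[OF A] by (auto simp: continuous_on_eq_continuous_within)
  then have "\<exists>z\<in>{x0..x1}. \<forall>y\<in>{x0..x1}. norm (A y) \<le> norm (A z)"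
    using x by (intro continuous_attains_sup continuous_intros) auto
  then obtain z where z: "z \<in> {x0..x1}" "\<And>y. y \<in> {x0..x1} \<Longrightarrow> norm (A y) \<le> norm (A z)"
    by blast
  define s where "s = norm (A z)"
  have s: "s \<ge> 0" "\<And>y. y \<in> {x0..x1} \<Longrightarrow> norm (A y) \<le> s" using z by (auto simp: s_def)
  have pos: "M \<ge> 0" "\<epsilon> \<ge> 0" "\<eta> \<ge> 0" 
    using order_trans[OF norm_ge_zero M(1)] order_trans[OF abs_ge_zero eps(1)]
      order_trans[OF abs_ge_zero eps(2)] by auto
  define Z where "Z y = F y * A y + H y * cnj (A y)" for y
  define Q where "Q y = A y - of_real (a y) * Z y" for y
  define Q' where "Q' y = - (of_real (a' y) * Z y + of_real (a y) * (F y * D y + H y * cnj (D y)))" for y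
  have Q: "(Q has_vector_derivative Q' y) (at y within {x0..x1})" if "y \<in> {x0..x1}" for y
    using normal_form_derivative[where r = "\<lambda>x. 0" and A = A and D = D and x = y and f = f and h = h and F = F and H = H and a = a and a' = a', OF A[OF that] _ F[THEN has_vector_derivative_at_within]
        H[THEN has_vector_derivative_at_within] a[THEN has_vector_derivative_at_within]]
    by (simp add: Q_def[abs_def] Q'_def Z_def D_def)
  have Zb: "norm (Z y) \<le> 2 * M * s" if "y \<in> {x0..x1}" for y
    unfolding Z_def by (intro norm_two_terms M s that)
  have aZ: "norm (of_real (a y) * Z y) \<le> \<epsilon> * (2 * M * s)" if "y \<in> {x0..x1}" for y
    unfolding norm_mult using pos s by (intro mult_mono Zb that) (auto simp: eps)
  have Db: "norm (D y) \<le> \<epsilon> * (2 * M * s)" if "y \<in> {x0..x1}" for y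
    unfolding D_def norm_mult using pos s by (intro mult_mono norm_two_terms M s(2)[OF that]) (auto simp: eps)
  have Q'b: "norm (Q' y) \<le> (2 * M * \<eta> + 4 * M\<^sup>2 * \<epsilon>\<^sup>2) * s" if "y \<in> {x0..x1}" for y
  proof -
    have "norm (Q' y) \<le> norm (of_real (a' y) * Z y) + norm (of_real (a y) * (F y * D y + H y * cnj (D y)))"
      unfolding Q'_def norm_minus_cancel by (rule norm_triangle_ineq)
    also have "\<dots> \<le> \<eta> * (2 * M * s) + \<epsilon> * (2 * M * (\<epsilon> * (2 * M * s)))"
      unfolding norm_mult using pos s
      by (intro add_mono mult_mono Zb norm_two_terms M Db that) (auto simp: eps)
    finally show ?thesis by (simp add: algebra_simps power2_eq_square)
  qed
  have zx0: "x0 \<in> {x0..x1}" using x by auto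
  have "Q x0 = A x0" by (simp add: Q_def a0)
  have "norm (Q z - Q x0) \<le> (2 * M * \<eta> + 4 * M\<^sup>2 * \<epsilon>\<^sup>2) * s * \<bar>z - x0\<bar>"
    by (rule vector_derivative_bound[OF Q Q'b z(1) zx0])
  also have "\<dots> \<le> (2 * M * \<eta> + 4 * M\<^sup>2 * \<epsilon>\<^sup>2) * s * (x1 - x0)"
    using z pos s by (intro mult_left_mono) auto
  finally have "norm (Q z - Q x0) \<le> (2 * M * \<eta> + 4 * M\<^sup>2 * \<epsilon>\<^sup>2) * s * (x1 - x0)" .
  moreover have "s \<le> norm (Q z - Q x0) + norm (Q x0) + norm (of_real (a z) * Z z)"
    unfolding s_def Q_def[of z] by norm
  moreover note aZ[OF z(1)] \<open>Q x0 = A x0\<close>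
  ultimately have "s \<le> norm (A x0) + s * (2 * M * \<epsilon> + (x1 - x0) * (2 * M * \<eta> + 4 * M\<^sup>2 * \<epsilon>\<^sup>2))"
    by (simp add: algebra_simps)
  also have "\<dots> \<le> norm (A x0) + s * (1 / 2)"
    using s by (intro add_mono mult_left_mono small) auto
  finally have "s \<le> 2 * norm (A x0)" by simp
  then show ?thesis using s(2)[OF x] by linarith
qed

text \<open>The mean part \<open>B' = - a cnj B\<close> shrinks \<open>Re B\<close> and enlarges \<open>Im B\<close>, each by the exponential of
  the integral \<open>\<tau>\<close> of \<open>a\<close> up to \<open>x1\<close>. A decaying solution is unstable in the forward direction but
  stable in the backward one, which is why the condition is imposed at the right end. After
  removing the factor \<open>e\<^sup>\<tau>\<close>, the real part of the normal form \<open>Q\<close> is almost constant; its imaginary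
  part satisfies a linear equation that is damped backwards and starts from zero.\<close>

lemma resonant_block:
  fixes B f h F H :: "real \<Rightarrow> complex" and a a' \<tau> :: "real \<Rightarrow> real"
  defines "D \<equiv> \<lambda>x. of_real (a x) * (- cnj (B x) + f x * B x + h x * cnj (B x))"
  assumes B: "\<And>x. x \<in> {x0..x1} \<Longrightarrow> (B has_vector_derivative D x) (at x within {x0..x1})"
    and F: "\<And>x. (F has_vector_derivative f x) (at x)"
    and H: "\<And>x. (H has_vector_derivative h x) (at x)"
    and a: "\<And>x. (a has_vector_derivative a' x) (at x)"
    and \<tau>: "\<And>x. x \<in> {x0..x1} \<Longrightarrow> (\<tau> has_vector_derivative - a x) (at x within {x0..x1})"
    and M: "\<And>x. norm (f x) \<le> M" "\<And>x. norm (h x) \<le> M" "\<And>x. norm (F x) \<le> M" "\<And>x. norm (H x) \<le> M"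
    and eps: "\<And>x. \<bar>a x\<bar> \<le> \<epsilon>" "\<And>x. \<bar>a' x\<bar> \<le> \<eta>" and a1: "a x1 = 0" and apos: "\<And>x. 0 \<le> a x"
    and \<tau>1: "\<tau> x1 = 0" and Im: "Im (B x1) = 0"
    and small: "2 * M * \<epsilon> + 2 * (x1 - x0) * (2 * M * \<eta> + (8 * M + 4 * M\<^sup>2) * \<epsilon>\<^sup>2) \<le> 1 / 4"
    and x: "x \<in> {x0..x1}"
  shows "norm (B x) \<le> 2 * exp (\<tau> x - \<tau> x0) * norm (B x0)"
proof -
  let ?I = "{x0..x1}"
  define K where "K = 2 * M * \<eta> + (8 * M + 4 * M\<^sup>2) * \<epsilon>\<^sup>2"
  define P where "P y = of_real (exp (- \<tau> y)) * B y" for y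
  define r where "r y = of_real (a y) * (P y - cnj (P y))" for y
  define E where "E y = r y + of_real (a y) * (f y * P y + h y * cnj (P y))" for y
  have P: "(P has_vector_derivative E y) (at y within ?I)" if y: "y \<in> ?I" for y
  proof -
    have "((\<lambda>y. exp (- \<tau> y)) has_vector_derivative a y * exp (- \<tau> y)) (at y within ?I)"
      using \<tau>[OF y] unfolding has_real_derivative_iff_has_vector_derivative[symmetric]
      by (auto intro!: derivative_eq_intros)
    from bounded_linear.has_vector_derivative[OF bounded_linear_of_real this]
    have "((\<lambda>y. complex_of_real (exp (- \<tau> y))) has_vector_derivative of_real (a y * exp (- \<tau> y))) (at y within ?I)" .
    from has_vector_derivative_mult[OF this B[OF y]] show ?thesis
      unfolding P_def[abs_def] by (simp add: E_def r_def P_def D_def algebra_simps)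
  qed
  have "continuous_on ?I P"
    using has_vector_derivative_continuous[OF P] by (auto simp: continuous_on_eq_continuous_within)
  then have "\<exists>z\<in>?I. \<forall>y\<in>?I. norm (P y) \<le> norm (P z)"
    using x by (intro continuous_attains_sup continuous_intros) auto
  then obtain z where z: "z \<in> ?I" "\<And>y. y \<in> ?I \<Longrightarrow> norm (P y) \<le> norm (P z)"
    by blast
  define s where "s = norm (P z)"
  have s: "s \<ge> 0" "\<And>y. y \<in> ?I \<Longrightarrow> norm (P y) \<le> s" using z by (auto simp: s_def)
  have pos: "M \<ge> 0" "\<epsilon> \<ge> 0" "\<eta> \<ge> 0" 
    using order_trans[OF norm_ge_zero M(1)] order_trans[OF abs_ge_zero eps(1)]
      order_trans[OF abs_ge_zero eps(2)] by auto
  then have K0: "K \<ge> 0" by (simp add: K_def)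
  define Z where "Z y = F y * P y + H y * cnj (P y)" for y
  define Q where "Q y = P y - of_real (a y) * Z y" for y
  define N where "N y = - (of_real (a' y) * Z y + of_real (a y) * (F y * E y + H y * cnj (E y)))" for y
  have Q: "(Q has_vector_derivative r y + N y) (at y within ?I)" if "y \<in> ?I" for y
    using normal_form_derivative[where r = r and A = P and D = E and x = y and f = f and h = h and F = F and H = H and a = a and a' = a', OF P[OF that] E_def F[THEN has_vector_derivative_at_within]
        H[THEN has_vector_derivative_at_within] a[THEN has_vector_derivative_at_within]]
    by (simp add: Q_def[abs_def] N_def Z_def algebra_simps)
  have Zb: "norm (Z y) \<le> 2 * M * s" if "y \<in> ?I" for y
    unfolding Z_def by (intro norm_two_terms M s that)
  have aZ: "norm (of_real (a y) * Z y) \<le> \<epsilon> * (2 * M * s)" if "y \<in> ?I" for y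
    unfolding norm_mult using pos s by (intro mult_mono Zb that) (auto simp: eps)
  have Eb: "norm (E y) \<le> \<epsilon> * (2 * s) + \<epsilon> * (2 * M * s)" if y: "y \<in> ?I" for y
  proof -
    have "norm (P y - cnj (P y)) \<le> 2 * s"
      using norm_triangle_ineq4[of "P y" "cnj (P y)"] s(2)[OF y] by simp
    then show ?thesis
      unfolding E_def r_def using pos s
      by (intro order.trans[OF norm_triangle_ineq] add_mono; unfold norm_mult)
        (intro mult_mono norm_two_terms M s(2)[OF y]; auto simp: eps)+
  qed
  have Nb: "norm (N y) \<le> (2 * M * \<eta> + (4 * M + 4 * M\<^sup>2) * \<epsilon>\<^sup>2) * s" if "y \<in> ?I" for y
  proof -
    have "norm (N y) \<le> norm (of_real (a' y) * Z y) + norm (of_real (a y) * (F y * E y + H y * cnj (E y)))"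
      unfolding N_def norm_minus_cancel by (rule norm_triangle_ineq)
    also have "\<dots> \<le> \<eta> * (2 * M * s) + \<epsilon> * (2 * M * (\<epsilon> * (2 * s) + \<epsilon> * (2 * M * s)))"
      unfolding norm_mult using pos s
      by (intro add_mono mult_mono Zb norm_two_terms M Eb that) (auto simp: eps)
    finally show ?thesis by (simp add: algebra_simps power2_eq_square)
  qed
  have x1: "x1 \<in> ?I" and x0: "x0 \<in> ?I" using x by auto
  have Q1: "Q x1 = P x1" by (simp add: Q_def a1)
  have P1: "Im (P x1) = 0" by (simp add: P_def Im \<tau>1)
  have Re: "\<bar>Re (Q y) - Re (Q x1)\<bar> \<le> (x1 - x0) * K * s" if y: "y \<in> ?I" for y
  proof -
    have "norm (Re (Q y) - Re (Q x1)) \<le> (K * s) * \<bar>y - x1\<bar>"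
    proof (rule vector_derivative_bound[OF _ _ y x1])
      fix t assume t: "t \<in> ?I"
      show "((\<lambda>t. Re (Q t)) has_vector_derivative Re (N t)) (at t within ?I)"
        using bounded_linear.has_vector_derivative[OF bounded_linear_Re Q[OF t]] by (simp add: r_def)
      have "\<bar>Re (N t)\<bar> \<le> (2 * M * \<eta> + (4 * M + 4 * M\<^sup>2) * \<epsilon>\<^sup>2) * s"
        using abs_Re_le_cmod[of "N t"] Nb[OF t] by linarith
      also have "\<dots> \<le> K * s"
        unfolding K_def using pos s by (intro mult_right_mono add_mono) auto
      finally show "norm (Re (N t)) \<le> K * s" by simp
    qed
    also have "\<dots> \<le> K * s * (x1 - x0)" using y K0 s by (intro mult_left_mono) auto
    finally show ?thesis by (simp add: ac_simps)
  qed
  \<comment> \<open>The damping is absorbed by the integrating factor \<open>exp (2 \<tau>)\<close>, which is largest at \<open>y\<close> on \<open>[y, x1]\<close>.\<close>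
  have Im: "\<bar>Im (Q y)\<bar> \<le> (x1 - x0) * K * s" if y: "y \<in> ?I" for y
  proof -
    define W where "W t = exp (2 * \<tau> t) * Im (Q t)" for t
    define W' where "W' t = exp (2 * \<tau> t) * (2 * a t * Im (of_real (a t) * Z t) + Im (N t))" for t
    have sub: "{y..x1} \<subseteq> ?I" using y by auto
    have mono: "\<tau> t \<le> \<tau> y" if t: "t \<in> {y..x1}" for t
    proof -
      have "- \<tau> y \<le> - \<tau> t"
      proof (rule DERIV_nonneg_imp_increasing_open[where f = "\<lambda>t. - \<tau> t" and a = y and b = t])
        show "y \<le> t" using t by auto
        show "continuous_on {y..t} (\<lambda>t. - \<tau> t)"
        proof (intro continuous_intros)
          have "continuous_on ?I \<tau>"
            using has_vector_derivative_continuous[OF \<tau>] by (auto simp: continuous_on_eq_continuous_within)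
          then show "continuous_on {y..t} \<tau>" by (rule continuous_on_subset) (use y t in auto)
        qed
        fix u assume u: "y < u" "u < t"
        have "(\<tau> has_real_derivative - a u) (at u)"
          using \<tau>[of u] u y t by (auto simp: at_within_interior[of _ ?I] has_real_derivative_iff_has_vector_derivative)
        from DERIV_minus[OF this] show "\<exists>d. ((\<lambda>t. - \<tau> t) has_real_derivative d) (at u) \<and> 0 \<le> d"
          using apos by auto
      qed
      then show ?thesis by simp
    qed
    have "norm (W y - W x1) \<le> (exp (2 * \<tau> y) * (K * s)) * \<bar>y - x1\<bar>"
    proof (rule vector_derivative_bound[of y x1 W W'])
      fix t assume t: "t \<in> {y..x1}"
      then have tI: "t \<in> ?I" using sub by auto
      have e1: "((\<lambda>t. exp (2 * \<tau> t)) has_real_derivative - 2 * a t * exp (2 * \<tau> t)) (at t within ?I)"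
        using \<tau>[OF tI] unfolding has_real_derivative_iff_has_vector_derivative[symmetric]
        by (auto intro!: derivative_eq_intros)
      have e2: "((\<lambda>t. Im (Q t)) has_real_derivative Im (r t + N t)) (at t within ?I)"
        unfolding has_real_derivative_iff_has_vector_derivative
        by (rule bounded_linear.has_vector_derivative[OF bounded_linear_Im Q[OF tI]])
      have "(W has_vector_derivative W' t) (at t within ?I)"
        unfolding W_def[abs_def] W'_def has_real_derivative_iff_has_vector_derivative[symmetric]
        by (rule DERIV_cong[OF DERIV_mult[OF e1 e2]]) (simp add: Q_def r_def algebra_simps)
      then show "(W has_vector_derivative W' t) (at t within {y..x1})"
        by (rule has_vector_derivative_within_subset[OF _ sub])
      have "\<bar>2 * a t * Im (of_real (a t) * Z t) + Im (N t)\<bar> \<le> 2 * \<bar>a t\<bar> * norm (of_real (a t) * Z t) + norm (N t)"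
        using abs_Im_le_cmod[of "of_real (a t) * Z t"] abs_Im_le_cmod[of "N t"]
        by (intro order.trans[OF abs_triangle_ineq] add_mono) (auto simp: abs_mult intro!: mult_left_mono)
      also have "\<dots> \<le> 2 * \<epsilon> * (\<epsilon> * (2 * M * s)) + (2 * M * \<eta> + (4 * M + 4 * M\<^sup>2) * \<epsilon>\<^sup>2) * s"
        using pos s by (intro add_mono Nb tI mult_mono aZ) (auto simp: eps)
      also have "\<dots> = K * s" by (simp add: K_def algebra_simps power2_eq_square)
      finally show "norm (W' t) \<le> exp (2 * \<tau> y) * (K * s)"
        unfolding W'_def norm_mult using mono[OF t] by (intro mult_mono) auto
    qed (use y in auto)
    then have "exp (2 * \<tau> y) * \<bar>Im (Q y)\<bar> \<le> exp (2 * \<tau> y) * (K * s * \<bar>y - x1\<bar>)"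
      by (simp add: W_def Q1 P1 abs_mult)
    then have "\<bar>Im (Q y)\<bar> \<le> K * s * \<bar>y - x1\<bar>" by simp
    also have "\<dots> \<le> K * s * (x1 - x0)" using y K0 s by (intro mult_left_mono) auto
    finally show ?thesis by (simp add: ac_simps)
  qed
  have diff: "norm (P y - P x1) \<le> s / 4" if y: "y \<in> ?I" for y
  proof -
    have "norm (Q y - Q x1) \<le> \<bar>Re (Q y - Q x1)\<bar> + \<bar>Im (Q y - Q x1)\<bar>" by (rule cmod_le)
    also have "\<dots> \<le> 2 * ((x1 - x0) * K * s)" using Re[OF y] Im[OF y] by (simp add: Q1 P1)
    finally have "norm (P y - P x1) \<le> 2 * ((x1 - x0) * K * s) + norm (of_real (a y) * Z y)"
      using norm_triangle_ineq[of "Q y - Q x1" "of_real (a y) * Z y"]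
      by (simp only: Q1) (simp add: Q_def[of y])
    also have "\<dots> \<le> 2 * ((x1 - x0) * K * s) + \<epsilon> * (2 * M * s)" using aZ[OF y] by simp
    also have "\<dots> = s * (2 * M * \<epsilon> + 2 * (x1 - x0) * K)" by (simp add: algebra_simps)
    also have "\<dots> \<le> s * (1 / 4)" using s small unfolding K_def by (intro mult_left_mono) auto
    finally show ?thesis by simp
  qed
  have "norm (P x) \<le> s" by (rule s(2)[OF x])
  moreover have "s \<le> norm (P x1) + s / 4"
    using diff[OF z(1)] norm_triangle_sub[of "P z" "P x1"] by (simp add: s_def)
  moreover have "norm (P x1) \<le> norm (P x0) + s / 4"
    using diff[OF x0] norm_triangle_sub[of "P x1" "P x0"] by (simp add: norm_minus_commute)
  ultimately have "norm (P x) \<le> 2 * norm (P x0)" by linarith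
  then have "exp (\<tau> x) * (exp (- \<tau> x) * norm (B x)) \<le> exp (\<tau> x) * (2 * (exp (- \<tau> x0) * norm (B x0)))"
    by (intro mult_left_mono) (auto simp: P_def norm_mult)
  then show ?thesis
    by (simp add: exp_diff exp_minus field_simps)
qed


section \<open>The amplitude equation\<close>

text \<open>Variation of parameters: for \<open>u = A exp (i \<kappa> x) + cnj A exp (- i \<kappa> x)\<close> and \<open>u' = i \<kappa> (A exp (i \<kappa> x) - cnj A exp (- i \<kappa> x))\<close>, the
  equation \<open>- u'' + V u = \<kappa>\<^sup>2 u\<close> says that \<open>A'\<close> is this expression at \<open>A\<close>.\<close>

definition amplitude_rhs :: "(real \<Rightarrow> real) \<Rightarrow> real \<Rightarrow> real \<Rightarrow> complex \<Rightarrow> complex" where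
  "amplitude_rhs V \<kappa> x y = of_real (V x) / (2 * \<i> * of_real \<kappa>) * (y + cis (- (2 * \<kappa> * x)) * cnj y)"

text \<open>The initial value corresponds to \<open>u(0) = 1\<close> and \<open>u'(0) = 0\<close>, which allows an even extension.\<close>

definition amplitude :: "(real \<Rightarrow> real) \<Rightarrow> real \<Rightarrow> (real \<Rightarrow> complex) \<Rightarrow> bool" where
  "amplitude V \<kappa> A \<longleftrightarrow> A 0 = 1 / 2 \<and>
     (\<forall>x\<ge>0. (A has_vector_derivative amplitude_rhs V \<kappa> x (A x)) (at x within {0..}))"

lemma norm_amplitude_rhs:
  assumes "\<kappa> > 0"
  shows "norm (amplitude_rhs V \<kappa> x y) \<le> \<bar>V x\<bar> / \<kappa> * norm y"
proof -
  have "norm (y + cis (- (2 * \<kappa> * x)) * cnj y) \<le> 2 * norm y"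
    by (rule order.trans[OF norm_triangle_ineq]) (simp add: norm_mult)
  then have "\<bar>V x\<bar> / (2 * \<kappa>) * norm (y + cis (- (2 * \<kappa> * x)) * cnj y) \<le> \<bar>V x\<bar> / (2 * \<kappa>) * (2 * norm y)"
    using assms by (intro mult_left_mono) auto
  then show ?thesis
    using assms by (simp add: amplitude_rhs_def norm_mult norm_divide)
qed

lemma amplitude_rhs_diff:
  "amplitude_rhs V \<kappa> x y - amplitude_rhs U \<kappa> x z =
     amplitude_rhs V \<kappa> x (y - z) + amplitude_rhs (\<lambda>x. V x - U x) \<kappa> x z"
  by (simp add: amplitude_rhs_def algebra_simps diff_divide_distrib)

lemma amplitude_exists:
  assumes \<kappa>: "\<kappa> > 0" and cont: "continuous_on UNIV V" and bound: "\<And>x. \<bar>V x\<bar> \<le> K"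
  shows "\<exists>A. amplitude V \<kappa> A"
  unfolding amplitude_def
proof (rule ode_exists)
  have K: "K \<ge> 0" using bound[of 0] by linarith
  then show "K / \<kappa> + 1 > 0" using \<kappa> by (simp add: add_nonneg_pos)
  show "continuous_on S (\<lambda>s. amplitude_rhs V \<kappa> s (v s))" if "continuous_on S v" for S v
    unfolding amplitude_rhs_def using \<kappa>
    by (intro continuous_intros continuous_on_subset[OF cont] that) auto
  fix x y z
  have "amplitude_rhs V \<kappa> x y - amplitude_rhs V \<kappa> x z = amplitude_rhs V \<kappa> x (y - z)"
    by (simp add: amplitude_rhs_def algebra_simps)
  then have "norm (amplitude_rhs V \<kappa> x y - amplitude_rhs V \<kappa> x z) \<le> \<bar>V x\<bar> / \<kappa> * norm (y - z)"
    using norm_amplitude_rhs[OF \<kappa>] by metis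
  also have "\<dots> \<le> (K / \<kappa> + 1) * norm (y - z)"
    using bound[of x] \<kappa> by (intro mult_right_mono) (auto simp: divide_right_mono add_increasing2)
  finally show "norm (amplitude_rhs V \<kappa> x y - amplitude_rhs V \<kappa> x z) \<le> (K / \<kappa> + 1) * norm (y - z)" .
qed (simp add: amplitude_rhs_def)

lemma amplitude_within:
  assumes "amplitude V \<kappa> A" "x \<in> {a..b}" "0 \<le> a"
  shows "(A has_vector_derivative amplitude_rhs V \<kappa> x (A x)) (at x within {a..b})"
  using assms by (auto simp: amplitude_def intro: has_vector_derivative_within_subset[of _ _ _ "{0..}"])

lemma amplitude_continuous_on: "amplitude V \<kappa> A \<Longrightarrow> continuous_on {0..} A"
  unfolding continuous_on_eq_continuous_within amplitude_def
  using has_vector_derivative_continuous by blast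

lemma amplitude_perturb:
  assumes \<kappa>: "\<kappa> > 0" and A: "amplitude V \<kappa> A" and B: "amplitude U \<kappa> B" and X: "X \<ge> 0"
    and V: "\<And>x. \<bar>V x\<bar> \<le> K"
    and UV: "\<And>x. 0 \<le> x \<Longrightarrow> x \<le> X \<Longrightarrow> \<bar>V x - U x\<bar> \<le> \<mu>"
    and s: "\<And>x. 0 \<le> x \<Longrightarrow> x \<le> X \<Longrightarrow> norm (B x) \<le> s"
  shows "(norm (A X - B X))\<^sup>2 \<le> (\<mu> * s / \<kappa>)\<^sup>2 * (exp ((2 * (K / \<kappa>) + 1) * X) - 1)"
proof (rule gronwall[of X "\<lambda>x. A x - B x"])
  show "((\<lambda>x. A x - B x) has_vector_derivative amplitude_rhs V \<kappa> x (A x) - amplitude_rhs U \<kappa> x (B x)) (at x within {0..X})"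
    if "0 \<le> x" "x \<le> X" for x
    using that by (intro has_vector_derivative_diff amplitude_within A B) auto
  have "A 0 = 1 / 2" "B 0 = 1 / 2" using A B unfolding amplitude_def by blast+
  then show "A 0 - B 0 = 0" by (simp only: diff_self)
  show "0 \<le> K / \<kappa>" using V[of 0] \<kappa> by simp
  fix x assume x: "0 \<le> x" "x \<le> X"
  have "norm (amplitude_rhs V \<kappa> x (A x - B x)) \<le> \<bar>V x\<bar> / \<kappa> * norm (A x - B x)"
    by (rule norm_amplitude_rhs[OF \<kappa>])
  also have "\<dots> \<le> K / \<kappa> * norm (A x - B x)"
    using V[of x] \<kappa> by (intro mult_right_mono) (auto simp: divide_right_mono)
  finally have 1: "norm (amplitude_rhs V \<kappa> x (A x - B x)) \<le> K / \<kappa> * norm (A x - B x)" .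
  have "norm (amplitude_rhs (\<lambda>x. V x - U x) \<kappa> x (B x)) \<le> \<bar>V x - U x\<bar> / \<kappa> * norm (B x)"
    by (rule norm_amplitude_rhs[OF \<kappa>])
  also have "\<dots> \<le> \<mu> / \<kappa> * s"
    using UV[OF x] s[OF x] \<kappa> by (intro mult_mono) (auto simp: divide_right_mono)
  finally have 2: "norm (amplitude_rhs (\<lambda>x. V x - U x) \<kappa> x (B x)) \<le> \<mu> * s / \<kappa>" by simp
  show "norm (amplitude_rhs V \<kappa> x (A x) - amplitude_rhs U \<kappa> x (B x)) \<le> K / \<kappa> * norm (A x - B x) + \<mu> * s / \<kappa>"
    unfolding amplitude_rhs_diff by (rule order.trans[OF norm_triangle_ineq add_mono[OF 1 2]])
qed (use X in auto)

lemma amplitude_bounded_on: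
  assumes "amplitude V \<kappa> A"
  obtains s where "\<And>x. 0 \<le> x \<Longrightarrow> x \<le> X \<Longrightarrow> norm (A x) \<le> s"
proof -
  have "bounded (A ` {0..X})"
    by (intro compact_imp_bounded compact_continuous_image continuous_on_subset[OF amplitude_continuous_on[OF assms]]) auto
  then obtain s where "\<forall>y\<in>A ` {0..X}. norm y \<le> s" by (auto simp: bounded_iff)
  then show ?thesis by (intro that[of s]) auto
qed

lemma amplitude_unique:
  assumes \<kappa>: "\<kappa> > 0" and A: "amplitude V \<kappa> A" and B: "amplitude U \<kappa> B" and X: "X \<ge> 0"
    and V: "\<And>x. \<bar>V x\<bar> \<le> K" and UV: "\<And>x. 0 \<le> x \<Longrightarrow> x \<le> X \<Longrightarrow> V x = U x"
  shows "A X = B X"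
proof -
  obtain s where "\<And>x. 0 \<le> x \<Longrightarrow> x \<le> X \<Longrightarrow> norm (B x) \<le> s"
    using amplitude_bounded_on[OF B] by blast
  from amplitude_perturb[OF \<kappa> A B X V _ this, of 0] UV show ?thesis by simp
qed

lemma has_vector_derivative_cis:
  "((\<lambda>x. cis (c * x + d)) has_vector_derivative \<i> * of_real c * cis (c * x + d)) (at x)"
  unfolding has_vector_derivative_def
  by (auto intro!: derivative_eq_intros simp: scaleR_conv_of_real algebra_simps)

lemma cis_add_cis_uminus: "cis t + cis (- t) = 2 * of_real (cos t)"
  by (simp add: complex_eq_iff)

section \<open>Resonant and nonresonant blocks\<close>

definition bump_slope :: real where
  "bump_slope = (SOME B. 0 \<le> B \<and> (\<forall>x. \<bar>vderiv bump x\<bar> \<le> B))"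

lemma bump_slope: "0 \<le> bump_slope" "\<bar>vderiv bump x\<bar> \<le> bump_slope"
  using someI_ex[OF vderiv_bump_bounded[of 1, unfolded Bex_def]] unfolding bump_slope_def
  by simp_all

definition bump_mass :: real where
  "bump_mass = integral {1..2} bump"

lemma continuous_on_bump: "continuous_on S bump"
  by (rule smooth_imp_continuous_on[OF smooth_bump])

lemma bump_mass_pos: "bump_mass > 0"
proof -
  have "bump_mass \<ge> 0"
    unfolding bump_mass_def by (rule integral_nonneg) (auto intro: integrable_continuous_real continuous_on_bump bump_nonneg)
  moreover have "bump_mass \<noteq> 0"
    using integral_eq_0_iff[of 1 2 bump] bump_pos[of "3/2"]
    by (auto simp: bump_mass_def continuous_on_bump bump_nonneg)
  ultimately show ?thesis by simp
qed

lemma bump_scaled_deriv: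
  assumes "R > 0"
  shows "((\<lambda>x. \<epsilon> * bump (x / R)) has_vector_derivative \<epsilon> / R * vderiv bump (x / R)) (at x)"
proof -
  have "(bump has_vector_derivative vderiv bump y) (at y)" for y
    using smooth_bump[unfolded smooth_def, rule_format, of 0] by (intro has_vector_derivative_vderiv) simp
  then have "(bump has_real_derivative vderiv bump y) (at y)" for y
    by (simp add: has_real_derivative_iff_has_vector_derivative)
  then show ?thesis
    unfolding has_real_derivative_iff_has_vector_derivative[symmetric]
    using assms
    by (intro DERIV_cong[OF DERIV_cmult[OF DERIV_chain2[where f = bump and g = "\<lambda>x. x / R" and Db = "1 / R"]]])
      (auto intro!: derivative_eq_intros)
qed

text \<open>The products of \<open>cos (\<theta> x + \<psi>)\<close> with \<open>1\<close> and \<open>exp (- 2 i \<kappa> x)\<close> have the frequencies \<open>\<plusminus>\<theta>\<close> and \<open>\<plusminus>\<theta> - 2 \<kappa>\<close>, none of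
  which is zero. The constant depends only on \<open>\<kappa>\<close> and \<open>\<theta>\<close>, in particular not on the phase.\<close>

lemma nonresonant_estimate:
  assumes \<kappa>: "\<kappa> > 0" and \<theta>: "\<theta> > 0" and ne: "\<theta> \<noteq> 2 * \<kappa>"
  shows "\<exists>C>0. \<forall>R \<epsilon> \<psi> A V x.
    R > 0 \<longrightarrow> \<epsilon> \<ge> 0 \<longrightarrow> C * (\<epsilon> + \<epsilon>\<^sup>2 * R) \<le> 1 / 4 \<longrightarrow> amplitude V \<kappa> A \<longrightarrow>
    (\<forall>x\<in>{R..2 * R}. V x = \<epsilon> * bump (x / R) * cos (\<theta> * x + \<psi>)) \<longrightarrow> x \<in> {R..2 * R} \<longrightarrow>
    norm (A x) \<le> 2 * norm (A R)"
proof -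
  define M where "M = 1 / (2 * \<kappa>) + 1 / (2 * \<kappa> * \<theta>) + 1 / (4 * \<kappa>) * (1 / \<bar>\<theta> - 2 * \<kappa>\<bar> + 1 / (\<theta> + 2 * \<kappa>))"
  have parts: "0 \<le> 1 / (2 * \<kappa>)" "0 \<le> 1 / (2 * \<kappa> * \<theta>)"
    "0 \<le> 1 / (4 * \<kappa>) * (1 / \<bar>\<theta> - 2 * \<kappa>\<bar> + 1 / (\<theta> + 2 * \<kappa>))"
    using \<kappa> \<theta> by auto
  have M0: "M > 0" unfolding M_def using parts \<kappa> by (smt (verit) zero_less_divide_1_iff)
  define C where "C = 2 * M + 2 * M * bump_slope + 4 * M\<^sup>2"
  have C0: "C > 0" unfolding C_def using M0 bump_slope(1) by (simp add: add_pos_nonneg)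
  show ?thesis
  proof (intro exI[of _ C] conjI C0 allI impI)
    fix R \<epsilon> \<psi> :: real and A V and x
    assume R: "R > 0" and e: "\<epsilon> \<ge> 0" and small: "C * (\<epsilon> + \<epsilon>\<^sup>2 * R) \<le> 1 / 4" and A: "amplitude V \<kappa> A"
      and V: "\<forall>x\<in>{R..2 * R}. V x = \<epsilon> * bump (x / R) * cos (\<theta> * x + \<psi>)" and x: "x \<in> {R..2 * R}"
    define a where "a x = \<epsilon> * bump (x / R)" for x
    define f where "f x = of_real (cos (\<theta> * x + \<psi>)) / (2 * \<i> * of_real \<kappa>)" for x
    define F where "F x = of_real (sin (\<theta> * x + \<psi>) / \<theta>) / (2 * \<i> * of_real \<kappa>)" for x
    define h where "h x = of_real (cos (\<theta> * x + \<psi>)) / (2 * \<i> * of_real \<kappa>) * cis (- (2 * \<kappa> * x))" for x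
    define H where "H x = 1 / (4 * \<i> * of_real \<kappa>) *
      (cis ((\<theta> - 2 * \<kappa>) * x + \<psi>) / (\<i> * of_real (\<theta> - 2 * \<kappa>)) - cis (- (\<theta> + 2 * \<kappa>) * x - \<psi>) / (\<i> * of_real (\<theta> + 2 * \<kappa>)))" for x
    show "norm (A x) \<le> 2 * norm (A R)"
    proof (rule nonresonant_block[where f = f and F = F and h = h and H = H and a = a and M = M and \<epsilon> = \<epsilon>
          and \<eta> = "\<epsilon> / R * bump_slope" and a' = "\<lambda>x. \<epsilon> / R * vderiv bump (x / R)" and ?x1.0 = "2 * R"])
      show "(A has_vector_derivative of_real (a y) * (f y * A y + h y * cnj (A y))) (at y within {R..2 * R})"
        if y: "y \<in> {R..2 * R}" for y
      proof -
        have "amplitude_rhs V \<kappa> y (A y) = of_real (a y) * (f y * A y + h y * cnj (A y))"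
          using V y by (simp add: amplitude_rhs_def a_def f_def h_def algebra_simps add_divide_distrib)
        with amplitude_within[OF A y] R show ?thesis by simp
      qed
      show "(F has_vector_derivative f y) (at y)" for y
      proof -
        have "((\<lambda>x. sin (\<theta> * x + \<psi>) / \<theta>) has_vector_derivative cos (\<theta> * y + \<psi>)) (at y)"
          unfolding has_real_derivative_iff_has_vector_derivative[symmetric]
          using \<theta> by (auto intro!: derivative_eq_intros)
        from bounded_linear.has_vector_derivative[OF bounded_linear_of_real this]
        show ?thesis unfolding F_def[abs_def] f_def by (rule has_vector_derivative_divide)
      qed
      show "(H has_vector_derivative h y) (at y)" for y
      proof -
        have c: "cis ((\<theta> - 2 * \<kappa>) * y + \<psi>) + cis (- (\<theta> + 2 * \<kappa>) * y - \<psi>)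
            = 2 * of_real (cos (\<theta> * y + \<psi>)) * cis (- (2 * \<kappa> * y))"
        proof -
          have "cis ((\<theta> - 2 * \<kappa>) * y + \<psi>) = cis (\<theta> * y + \<psi>) * cis (- (2 * \<kappa> * y))"
            "cis (- (\<theta> + 2 * \<kappa>) * y - \<psi>) = cis (- (\<theta> * y + \<psi>)) * cis (- (2 * \<kappa> * y))"
            unfolding cis_mult by (rule arg_cong[where f = cis], simp add: algebra_simps)+
          moreover have "cis (\<theta> * y + \<psi>) + cis (- (\<theta> * y + \<psi>)) = 2 * of_real (cos (\<theta> * y + \<psi>))"
            by (rule cis_add_cis_uminus)
          ultimately show ?thesis by (metis distrib_right)
        qed
        have "(H has_vector_derivative 1 / (4 * \<i> * of_real \<kappa>) *
           ((\<i> * of_real (\<theta> - 2 * \<kappa>) * cis ((\<theta> - 2 * \<kappa>) * y + \<psi>)) / (\<i> * of_real (\<theta> - 2 * \<kappa>))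
            - (\<i> * of_real (- (\<theta> + 2 * \<kappa>)) * cis (- (\<theta> + 2 * \<kappa>) * y + (- \<psi>))) / (\<i> * of_real (\<theta> + 2 * \<kappa>)))) (at y)"
          unfolding H_def[abs_def] diff_conv_add_uminus[of _ \<psi>]
          by (intro has_vector_derivative_mult_right has_vector_derivative_diff has_vector_derivative_divide
              has_vector_derivative_cis)
        also have "1 / (4 * \<i> * of_real \<kappa>) *
           ((\<i> * of_real (\<theta> - 2 * \<kappa>) * cis ((\<theta> - 2 * \<kappa>) * y + \<psi>)) / (\<i> * of_real (\<theta> - 2 * \<kappa>))
            - (\<i> * of_real (- (\<theta> + 2 * \<kappa>)) * cis (- (\<theta> + 2 * \<kappa>) * y + (- \<psi>))) / (\<i> * of_real (\<theta> + 2 * \<kappa>)))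
          = 1 / (4 * \<i> * of_real \<kappa>) * (cis ((\<theta> - 2 * \<kappa>) * y + \<psi>) + cis (- (\<theta> + 2 * \<kappa>) * y - \<psi>))"
        proof -
          have "w * ((\<i> * of_real p * u) / (\<i> * of_real p) - (\<i> * of_real (- q) * v) / (\<i> * of_real q)) = w * (u + v)"
            if "p \<noteq> 0" "q \<noteq> 0" for p q and u v w :: complex
            using that by simp
          moreover have "\<theta> - 2 * \<kappa> \<noteq> 0" "\<theta> + 2 * \<kappa> \<noteq> 0" using ne \<theta> \<kappa> by auto
          ultimately show ?thesis by (simp only: diff_conv_add_uminus[of _ \<psi>])
        qed
        also have "\<dots> = h y" unfolding c by (simp add: h_def)
        finally show ?thesis .
      qed
      show "(a has_vector_derivative \<epsilon> / R * vderiv bump (y / R)) (at y)" for y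
        unfolding a_def[abs_def] by (rule bump_scaled_deriv[OF R])
      have k: "norm (2 * \<i> * complex_of_real \<kappa>) = 2 * \<kappa>" "norm (4 * \<i> * complex_of_real \<kappa>) = 4 * \<kappa>"
        using \<kappa> by (simp_all add: norm_mult)
      have "1 / (2 * \<kappa>) \<le> M" unfolding M_def using parts by linarith
      moreover have "\<bar>cos (\<theta> * y + \<psi>)\<bar> / (2 * \<kappa>) \<le> 1 / (2 * \<kappa>)" for y
        using \<kappa> by (intro divide_right_mono) auto
      ultimately show "norm (f y) \<le> M" "norm (h y) \<le> M" for y
        unfolding f_def h_def norm_divide norm_mult[of _ "cis _"] k by (auto intro: order.trans)
      have "norm (F y) \<le> 1 / (2 * \<kappa> * \<theta>)" for y
      proof -
        have "\<bar>sin (\<theta> * y + \<psi>)\<bar> / \<theta> / (2 * \<kappa>) \<le> 1 / \<theta> / (2 * \<kappa>)"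
          using \<kappa> \<theta> by (intro divide_right_mono) auto
        then show ?thesis unfolding F_def norm_divide k norm_of_real using \<theta> by (simp add: ac_simps)
      qed
      then show "norm (F y) \<le> M" for y unfolding M_def using parts by (smt (verit))
      have "norm (H y) \<le> 1 / (4 * \<kappa>) * (1 / \<bar>\<theta> - 2 * \<kappa>\<bar> + 1 / (\<theta> + 2 * \<kappa>))" for y
        unfolding H_def norm_mult[of "_ / _"] norm_divide[of 1] k norm_one using \<kappa>
      proof (intro mult_left_mono order.trans[OF norm_triangle_ineq4])
        show "cmod (cis ((\<theta> - 2 * \<kappa>) * y + \<psi>) / (\<i> * of_real (\<theta> - 2 * \<kappa>)))
          + cmod (cis (- (\<theta> + 2 * \<kappa>) * y - \<psi>) / (\<i> * of_real (\<theta> + 2 * \<kappa>)))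
          \<le> 1 / \<bar>\<theta> - 2 * \<kappa>\<bar> + 1 / (\<theta> + 2 * \<kappa>)"
          unfolding norm_divide norm_mult norm_of_real using \<kappa> \<theta> by simp
      qed simp
      then show "norm (H y) \<le> M" for y unfolding M_def using parts by (smt (verit))
      show "\<bar>a y\<bar> \<le> \<epsilon>" for y
        using e bump_nonneg[of "y / R"] bump_le_1[of "y / R"] by (simp add: a_def abs_mult mult_left_le)
      show "\<bar>\<epsilon> / R * vderiv bump (y / R)\<bar> \<le> \<epsilon> / R * bump_slope" for y
        unfolding abs_mult using e R bump_slope(2)[of "y / R"] by (intro mult_mono) auto
      show "a R = 0" using R by (simp add: a_def bump_eq_0)
      have "2 * M * \<epsilon> + (2 * R - R) * (2 * M * (\<epsilon> / R * bump_slope) + 4 * M\<^sup>2 * \<epsilon>\<^sup>2)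
        = (2 * M + 2 * M * bump_slope) * \<epsilon> + 4 * M\<^sup>2 * (\<epsilon>\<^sup>2 * R)"
        using R by (simp add: field_simps)
      also have "\<dots> \<le> C * \<epsilon> + C * (\<epsilon>\<^sup>2 * R)"
      proof (rule add_mono)
        have nn: "0 \<le> M * bump_slope" using M0 bump_slope(1) by simp
        show "(2 * M + 2 * M * bump_slope) * \<epsilon> \<le> C * \<epsilon>"
          by (rule mult_right_mono) (use e in \<open>auto simp: C_def\<close>)
        show "4 * M\<^sup>2 * (\<epsilon>\<^sup>2 * R) \<le> C * (\<epsilon>\<^sup>2 * R)"
          by (rule mult_right_mono) (use nn M0 R in \<open>auto simp: C_def\<close>)
      qed
      also have "\<dots> \<le> 1 / 2" using small by (simp add: algebra_simps)
      finally show "2 * M * \<epsilon> + (2 * R - R) * (2 * M * (\<epsilon> / R * bump_slope) + 4 * M\<^sup>2 * \<epsilon>\<^sup>2) \<le> 1 / 2" .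
    qed (use x in auto)
  qed
qed

text \<open>The direction in which the mean part of the equation on a resonant block with phase \<open>\<psi>\<close> shrinks:
  the unit number \<open>\<zeta>\<close> with \<open>\<zeta>\<^sup>2 = i exp (i \<psi>)\<close> that turns this mean part into \<open>B' = - a cnj B\<close> for
  \<open>A = \<zeta> B\<close>.\<close>

definition phase_axis :: "real \<Rightarrow> complex" where
  "phase_axis \<psi> = cis (\<psi> / 2 + pi / 4)"

text \<open>Of the four exponentials in \<open>cos (\<theta> x + \<psi>) (1 + exp (- i \<theta> x))\<close> exactly one is constant. In the coordinate
  \<open>B\<close> along \<open>phase_axis\<close> it is the mean part of \<open>resonant_block\<close>, and the other three oscillate.\<close>

lemma resonant_estimate:
  assumes \<kappa>: "\<kappa> > 0" and \<theta>: "\<theta> = 2 * \<kappa>"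
  shows "\<exists>C>0. \<forall>R \<epsilon> \<psi> A V x.
    R > 0 \<longrightarrow> \<epsilon> \<ge> 0 \<longrightarrow> C * (\<epsilon> + \<epsilon>\<^sup>2 * R) \<le> 1 / 4 \<longrightarrow> amplitude V \<kappa> A \<longrightarrow>
    (\<forall>x\<in>{R..2 * R}. V x = \<epsilon> * bump (x / R) * cos (\<theta> * x + \<psi>)) \<longrightarrow>
    Im (cnj (phase_axis \<psi>) * A (2 * R)) = 0 \<longrightarrow> x \<in> {R..2 * R} \<longrightarrow>
    norm (A x) \<le> 2 * norm (A R) \<and>
    norm (A (2 * R)) \<le> 2 * exp (- (\<epsilon> * R * bump_mass / (4 * \<kappa>))) * norm (A R)"
proof -
  define M where "M = 2 + 2 / \<theta>"
  have M0: "M > 0" using \<kappa> \<theta> by (auto simp: M_def intro!: add_pos_pos)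
  define C where "C = (2 * M + 4 * M * bump_slope) / (4 * \<kappa>) + (16 * M + 8 * M\<^sup>2) / (4 * \<kappa>)\<^sup>2"
  have C0: "C > 0" unfolding C_def using M0 bump_slope(1) \<kappa> by (intro add_pos_pos divide_pos_pos add_pos_nonneg) auto
  show ?thesis
  proof (intro exI[of _ C] conjI[OF C0] allI impI)
    fix R \<epsilon> \<psi> :: real and A V and x
    assume R: "R > 0" and e: "\<epsilon> \<ge> 0" and small: "C * (\<epsilon> + \<epsilon>\<^sup>2 * R) \<le> 1 / 4" and A: "amplitude V \<kappa> A"
      and V: "\<forall>x\<in>{R..2 * R}. V x = \<epsilon> * bump (x / R) * cos (\<theta> * x + \<psi>)" 
      and Im: "Im (cnj (phase_axis \<psi>) * A (2 * R)) = 0" and x: "x \<in> {R..2 * R}"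
    define e' where "e' = \<epsilon> / (4 * \<kappa>)"
    have e': "e' \<ge> 0" using e \<kappa> by (simp add: e'_def)
    define a where "a x = e' * bump (x / R)" for x
    define B where "B x = cnj (phase_axis \<psi>) * A x" for x
    define f where "f x = - 2 * \<i> * of_real (cos (\<theta> * x + \<psi>))" for x
    define F where "F x = - 2 * \<i> * of_real (sin (\<theta> * x + \<psi>) / \<theta>)" for x
    define h where "h x = - cis ((- 2 * \<theta>) * x + (- 2 * \<psi>))" for x
    define H where "H x = cis ((- 2 * \<theta>) * x + (- 2 * \<psi>)) / (2 * \<i> * of_real \<theta>)" for x
    define \<tau> where "\<tau> x = e' * R * (bump_mass - integral {1..x / R} bump)" for x
    have nB: "norm (B y) = norm (A y)" for y by (simp add: B_def norm_mult phase_axis_def)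
    have *: "norm (B y) \<le> 2 * exp (\<tau> y - \<tau> R) * norm (B R)" if y: "y \<in> {R..2 * R}" for y
    proof (rule resonant_block[where f = f and F = F and h = h and H = H and a = a and M = M and \<epsilon> = e'
          and \<eta> = "e' / R * bump_slope" and a' = "\<lambda>x. e' / R * vderiv bump (x / R)" and ?x1.0 = "2 * R" and \<tau> = \<tau>])
      show "(B has_vector_derivative of_real (a y) * (- cnj (B y) + f y * B y + h y * cnj (B y))) (at y within {R..2 * R})"
        if y: "y \<in> {R..2 * R}" for y
      proof -
        define \<phi> where "\<phi> = \<theta> * y + \<psi>"
        define \<zeta> where "\<zeta> = phase_axis \<psi>"
        have z1: "\<zeta> * cnj \<zeta> = 1" by (simp add: \<zeta>_def phase_axis_def cis_cnj cis_mult)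
        have z2: "cis (- (2 * \<kappa> * y)) * (cnj \<zeta> * cnj \<zeta>) = - \<i> * cis (- \<phi>)"
        proof -
          have "cis (- (2 * \<kappa> * y)) * (cnj \<zeta> * cnj \<zeta>) = cis (- \<phi>) * cis (- (pi / 2))"
            unfolding \<zeta>_def phase_axis_def cis_cnj cis_mult \<phi>_def \<theta>
            by (rule arg_cong[where f = cis]) (simp add: field_simps)
          also have "cis (- (pi / 2)) = - \<i>" by (simp add: complex_eq_iff)
          finally show ?thesis by simp
        qed
        have AB: "A y = \<zeta> * B y" by (simp add: B_def \<zeta>_def[symmetric] mult.assoc[symmetric] z1)
        have Vy: "of_real (V y) = 2 * of_real \<kappa> * of_real (a y) * (cis \<phi> + cis (- \<phi>))"
          using V y \<kappa> unfolding cis_add_cis_uminus by (simp add: a_def e'_def \<phi>_def)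
        have "cnj \<zeta> * amplitude_rhs V \<kappa> y (A y)
          = of_real (V y) / (2 * \<i> * of_real \<kappa>) * ((\<zeta> * cnj \<zeta>) * B y + (cis (- (2 * \<kappa> * y)) * (cnj \<zeta> * cnj \<zeta>)) * cnj (B y))"
          by (simp add: amplitude_rhs_def AB algebra_simps)
        also have "\<dots> = of_real (a y) * (- \<i> * (cis \<phi> + cis (- \<phi>)) * B y - (cis \<phi> * cis (- \<phi>) + cis (- \<phi>) * cis (- \<phi>)) * cnj (B y))"
          unfolding z1 z2 Vy using \<kappa> by (simp add: field_simps)
        also have "cis \<phi> * cis (- \<phi>) = 1" by (simp add: cis_mult)
        also have "cis (- \<phi>) * cis (- \<phi>) = - h y"
          unfolding cis_mult h_def minus_minus \<phi>_def
          by (rule arg_cong[where f = cis]) (simp add: algebra_simps)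
        also have "- \<i> * (cis \<phi> + cis (- \<phi>)) = f y" unfolding cis_add_cis_uminus by (simp add: f_def \<phi>_def)
        finally have "cnj \<zeta> * amplitude_rhs V \<kappa> y (A y) = of_real (a y) * (- cnj (B y) + f y * B y + h y * cnj (B y))"
          by (simp add: algebra_simps)
        with has_vector_derivative_mult_right[OF amplitude_within[OF A y], of "cnj \<zeta>"] R
        show ?thesis unfolding B_def[abs_def] \<zeta>_def by simp
      qed
      show "(F has_vector_derivative f y) (at y)" for y
      proof -
        have "((\<lambda>x. sin (\<theta> * x + \<psi>) / \<theta>) has_vector_derivative cos (\<theta> * y + \<psi>)) (at y)"
          unfolding has_real_derivative_iff_has_vector_derivative[symmetric]
          using \<theta> \<kappa> by (auto intro!: derivative_eq_intros)
        from bounded_linear.has_vector_derivative[OF bounded_linear_of_real this]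
        show ?thesis unfolding F_def[abs_def] f_def by (rule has_vector_derivative_mult_right)
      qed
      show "(H has_vector_derivative h y) (at y)" for y
      proof -
        have "(H has_vector_derivative (\<i> * of_real (- 2 * \<theta>) * cis ((- 2 * \<theta>) * y + (- 2 * \<psi>))) / (2 * \<i> * of_real \<theta>)) (at y)"
          unfolding H_def[abs_def] by (intro has_vector_derivative_divide has_vector_derivative_cis)
        moreover have "(\<i> * of_real (- 2 * \<theta>) * cis ((- 2 * \<theta>) * y + (- 2 * \<psi>))) / (2 * \<i> * of_real \<theta>) = h y"
          using \<theta> \<kappa> by (simp add: h_def)
        ultimately show ?thesis by simp
      qed
      show "(a has_vector_derivative e' / R * vderiv bump (y / R)) (at y)" for y
        unfolding a_def[abs_def] by (rule bump_scaled_deriv[OF R])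
      show "(\<tau> has_vector_derivative - a y) (at y within {R..2 * R})" if y: "y \<in> {R..2 * R}" for y
      proof -
        have "((\<lambda>t. integral {1..t} bump) has_real_derivative bump (y / R)) (at (y / R) within {1..2})"
          using y R unfolding has_real_derivative_iff_has_vector_derivative
          by (intro integral_has_vector_derivative continuous_on_bump) (auto simp: field_simps)
        then have "((\<lambda>t. integral {1..t} bump) has_real_derivative bump (y / R)) (at (y / R) within (\<lambda>x. x / R) ` {R..2 * R})"
          by (rule DERIV_subset) (use R in \<open>auto simp: field_simps\<close>)
        from DERIV_image_chain[OF this, of "1 / R"]
        have "((\<lambda>x. integral {1..x / R} bump) has_real_derivative bump (y / R) * (1 / R)) (at y within {R..2 * R})"
          using DERIV_cdivide[OF DERIV_ident, of R y "{R..2 * R}"] R by (simp add: o_def)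
        then show ?thesis
          unfolding \<tau>_def[abs_def] has_real_derivative_iff_has_vector_derivative[symmetric]
          using R by (auto intro!: derivative_eq_intros simp: a_def)
      qed
      show "norm (f y) \<le> M" for y
      proof -
        have "2 * \<bar>cos (\<theta> * y + \<psi>)\<bar> \<le> 2 * 1" by (intro mult_left_mono) auto
        also have "\<dots> \<le> M" using \<theta> \<kappa> by (simp add: M_def)
        finally show ?thesis by (simp add: f_def norm_mult)
      qed
      show "norm (h y) \<le> M" for y using \<theta> \<kappa> by (simp add: h_def M_def add_increasing2)
      show "norm (F y) \<le> M" for y
      proof -
        have "2 * (\<bar>sin (\<theta> * y + \<psi>)\<bar> / \<theta>) \<le> 2 * (1 / \<theta>)"
          using \<theta> \<kappa> by (intro mult_left_mono divide_right_mono) auto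
        also have "\<dots> \<le> M" by (simp add: M_def)
        finally show ?thesis using \<theta> \<kappa> by (simp add: F_def norm_mult norm_divide)
      qed
      show "norm (H y) \<le> M" for y
      proof -
        have "norm (H y) = 1 / (2 * \<theta>)" using \<theta> \<kappa> by (simp add: H_def norm_divide norm_mult)
        also have "\<dots> \<le> M" using \<theta> \<kappa> by (simp add: M_def field_simps)
        finally show ?thesis .
      qed
      show "\<bar>a y\<bar> \<le> e'" for y
        using e' bump_nonneg[of "y / R"] bump_le_1[of "y / R"] by (simp add: a_def abs_mult mult_left_le)
      show "\<bar>e' / R * vderiv bump (y / R)\<bar> \<le> e' / R * bump_slope" for y
        unfolding abs_mult using e' R bump_slope(2)[of "y / R"] by (intro mult_mono) auto
      show "a (2 * R) = 0" using R by (simp add: a_def bump_eq_0)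
      show "0 \<le> a y" for y using e' by (simp add: a_def bump_nonneg)
      show "\<tau> (2 * R) = 0" using R by (simp add: \<tau>_def bump_mass_def)
      show "Im (B (2 * R)) = 0" using Im by (simp add: B_def)
      have "2 * M * e' + 2 * (2 * R - R) * (2 * M * (e' / R * bump_slope) + (8 * M + 4 * M\<^sup>2) * e'\<^sup>2)
        = (2 * M + 4 * M * bump_slope) / (4 * \<kappa>) * \<epsilon> + (16 * M + 8 * M\<^sup>2) / (4 * \<kappa>)\<^sup>2 * (\<epsilon>\<^sup>2 * R)"
        unfolding e'_def power_divide using R \<kappa> by (simp add: field_simps)
      also have "\<dots> \<le> C * \<epsilon> + C * (\<epsilon>\<^sup>2 * R)"
      proof (rule add_mono)
        have nn: "0 \<le> (2 * M + 4 * M * bump_slope) / (4 * \<kappa>)" "0 \<le> (16 * M + 8 * M\<^sup>2) / (4 * \<kappa>)\<^sup>2"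
          using M0 bump_slope(1) \<kappa> by simp_all
        show "(2 * M + 4 * M * bump_slope) / (4 * \<kappa>) * \<epsilon> \<le> C * \<epsilon>"
          unfolding C_def using nn(2) e by (intro mult_right_mono) linarith+
        show "(16 * M + 8 * M\<^sup>2) / (4 * \<kappa>)\<^sup>2 * (\<epsilon>\<^sup>2 * R) \<le> C * (\<epsilon>\<^sup>2 * R)"
          unfolding C_def using nn(1) R by (intro mult_right_mono) auto
      qed
      also have "\<dots> \<le> 1 / 4" using small by (simp add: algebra_simps)
      finally show "2 * M * e' + 2 * (2 * R - R) * (2 * M * (e' / R * bump_slope) + (8 * M + 4 * M\<^sup>2) * e'\<^sup>2) \<le> 1 / 4" .
    qed (use y in auto)
    have tR: "\<tau> R = \<epsilon> * R * bump_mass / (4 * \<kappa>)" using R by (simp add: \<tau>_def e'_def)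
    have t2R: "\<tau> (2 * R) = 0" using R by (simp add: \<tau>_def bump_mass_def)
    have "\<tau> x \<le> \<tau> R"
    proof -
      have "0 \<le> integral {1..x / R} bump"
        by (rule integral_nonneg) (auto intro: integrable_continuous_real continuous_on_bump bump_nonneg)
      then have "e' * R * (bump_mass - integral {1..x / R} bump) \<le> e' * R * (bump_mass - 0)"
        using e' R by (intro mult_left_mono) auto
      then show ?thesis using R by (simp add: \<tau>_def)
    qed
    then have "2 * exp (\<tau> x - \<tau> R) * norm (B R) \<le> 2 * 1 * norm (B R)"
      by (intro mult_right_mono mult_left_mono) auto
    with *[OF x] have "norm (A x) \<le> 2 * norm (A R)" by (simp add: nB)
    moreover have "norm (A (2 * R)) \<le> 2 * exp (- (\<epsilon> * R * bump_mass / (4 * \<kappa>))) * norm (A R)"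
      using *[of "2 * R"] R by (simp add: nB tR t2R)
    ultimately show "norm (A x) \<le> 2 * norm (A R) \<and>
      norm (A (2 * R)) \<le> 2 * exp (- (\<epsilon> * R * bump_mass / (4 * \<kappa>))) * norm (A R)" ..
  qed
qed


section \<open>Eigenfunctions from decaying amplitudes\<close>

text \<open>Integration by parts: \<open>\<phi> u\<close> has compact support, so the integral of its derivative vanishes.\<close>

lemma weak_deriv_C1:
  assumes u: "\<And>x. (u has_vector_derivative v x) (at x)" and v: "continuous_on UNIV v"
  shows "weak_deriv u v"
  unfolding weak_deriv_def
proof (intro allI impI)
  fix \<phi> :: "real \<Rightarrow> real" assume "test_function \<phi>"
  then have sm: "smooth \<phi>" and cpt: "compact (closure {x. \<phi> x \<noteq> 0})"
    by (auto simp: test_function_def)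
  have d: "(\<phi> has_vector_derivative vderiv \<phi> x) (at x)" and d2: "vderiv \<phi> differentiable (at x)" for x
    using sm[unfolded smooth_def, rule_format, of 0 x] sm[unfolded smooth_def, rule_format, of 1 x]
    by (auto intro: has_vector_derivative_vderiv)
  have c0: "continuous_on S \<phi>" for S
    using has_vector_derivative_continuous[OF d] by (intro continuous_at_imp_continuous_on) auto
  have c1: "continuous_on S (vderiv \<phi>)" for S
    using d2 by (intro continuous_at_imp_continuous_on ballI differentiable_imp_continuous_within)
  have cu: "continuous_on S u" for S
    using has_vector_derivative_continuous[OF u] by (intro continuous_at_imp_continuous_on) auto
  have cv: "continuous_on S v" for S using v by (rule continuous_on_subset) auto
  obtain R where R: "\<And>x. x \<in> closure {x. \<phi> x \<noteq> 0} \<Longrightarrow> norm x \<le> R"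
    using compact_imp_bounded[OF cpt] by (metis bounded_iff)
  define b where "b = \<bar>R\<bar> + 1"
  have zero: "\<phi> x = 0" if "\<bar>x\<bar> > \<bar>R\<bar>" for x
    using R[of x] closure_subset[of "{x. \<phi> x \<noteq> 0}"] that by (cases "\<phi> x = 0") force+
  have zero': "vderiv \<phi> x = 0" if "\<bar>x\<bar> > \<bar>R\<bar>" for x
  proof -
    have "(vderiv ^^ 1) \<phi> x = (vderiv ^^ 1) (\<lambda>x. 0) x"
      by (rule vderiv_funpow_cong_open[of "{..<- \<bar>R\<bar>} \<union> {\<bar>R\<bar><..}"]) (use that in \<open>auto simp: zero\<close>)
    then show ?thesis unfolding vderiv_funpow_const0 by simp
  qed
  have int: "integrable lborel (\<lambda>x. indicator {-b..b} x *\<^sub>R f x)" if "continuous_on UNIV f" for f :: "real \<Rightarrow> complex"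
    using borel_integrable_atLeastAtMost'[of "-b" b f] that
    by (auto simp: set_integrable_def intro: continuous_on_subset)
  have "(LINT x|lborel. indicator {-b..b} x *\<^sub>R (vderiv \<phi> x *\<^sub>R u x + \<phi> x *\<^sub>R v x)) = \<phi> b *\<^sub>R u b - \<phi> (-b) *\<^sub>R u (-b)"
  proof (rule integral_FTC_Icc)
    show "((\<lambda>x. \<phi> x *\<^sub>R u x) has_vector_derivative vderiv \<phi> x *\<^sub>R u x + \<phi> x *\<^sub>R v x) (at x within {-b..b})" for x
      using has_vector_derivative_scaleR[OF d[unfolded has_real_derivative_iff_has_vector_derivative[symmetric],
          THEN has_field_derivative_at_within] has_vector_derivative_at_within[OF u]]
      by (simp add: add.commute)
  qed (auto simp: b_def intro!: continuous_intros c0 c1 cu cv)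
  also have "\<dots> = 0" using zero[of b] zero[of "-b"] by (simp add: b_def)
  finally have "(LINT x|lborel. indicator {-b..b} x *\<^sub>R (vderiv \<phi> x *\<^sub>R u x)) +
      (LINT x|lborel. indicator {-b..b} x *\<^sub>R (\<phi> x *\<^sub>R v x)) = 0"
    by (subst (asm) scaleR_add_right, subst (asm) Bochner_Integration.integral_add)
      (intro int continuous_intros c0 c1 cu cv | assumption)+
  moreover have ind: "indicator {-b..b} x *\<^sub>R (vderiv \<phi> x *\<^sub>R u x) = vderiv \<phi> x *\<^sub>R u x"
    "indicator {-b..b} x *\<^sub>R (\<phi> x *\<^sub>R v x) = \<phi> x *\<^sub>R v x" for x
  proof -
    have "x \<in> {-b..b}" if "\<not> \<bar>x\<bar> > \<bar>R\<bar>"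
    proof -
      have "\<bar>x\<bar> \<le> b" using that by (simp add: b_def)
      then show ?thesis by (simp add: abs_le_iff)
    qed
    then show "indicator {-b..b} x *\<^sub>R (vderiv \<phi> x *\<^sub>R u x) = vderiv \<phi> x *\<^sub>R u x"
      "indicator {-b..b} x *\<^sub>R (\<phi> x *\<^sub>R v x) = \<phi> x *\<^sub>R v x"
      using zero[of x] zero'[of x] by (cases "\<bar>x\<bar> > \<bar>R\<bar>"; simp)+
  qed
  ultimately show "(LINT x|lborel. vderiv \<phi> x *\<^sub>R u x) = - (LINT x|lborel. \<phi> x *\<^sub>R v x)"
    by (simp only: ind eq_neg_iff_add_eq_0)
qed

lemma integrable_inverse_one_plus_square: "integrable lborel (\<lambda>x::real. inverse (1 + x\<^sup>2))"
  using integrable_inverse_1_plus_square by (simp add: set_integrable_def einterval_eq_UNIV)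

lemma L2_decay:
  assumes "continuous_on UNIV u" and D: "\<And>x. (1 + x\<^sup>2) * (norm (u x))\<^sup>2 \<le> D"
  shows "L2 u"
  unfolding L2_def
proof
  show meas: "u \<in> borel_measurable lborel"
    using borel_measurable_continuous_onI[OF assms(1)] by simp
  show "integrable lborel (\<lambda>x. (cmod (u x))\<^sup>2)"
  proof (rule Bochner_Integration.integrable_bound)
    show "integrable lborel (\<lambda>x::real. D * inverse (1 + x\<^sup>2))"
      by (intro integrable_mult_right integrable_inverse_one_plus_square)
    show "(\<lambda>x. (cmod (u x))\<^sup>2) \<in> borel_measurable lborel"
      using meas by measurable
    have "norm ((cmod (u x))\<^sup>2) \<le> norm (D * inverse (1 + x\<^sup>2))" for x
    proof -
      have p: "1 + x\<^sup>2 > 0" by (simp add: add_pos_nonneg)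
      have "(cmod (u x))\<^sup>2 \<le> D / (1 + x\<^sup>2)"
        using D[of x] p by (simp add: pos_le_divide_eq mult.commute)
      also have "\<dots> \<le> \<bar>D * inverse (1 + x\<^sup>2)\<bar>" by (simp add: divide_inverse)
      finally show ?thesis by simp
    qed
    then show "AE x in lborel. norm ((cmod (u x))\<^sup>2) \<le> norm (D * inverse (1 + x\<^sup>2))" by simp
  qed
qed

lemma even_extension_derivative:
  fixes f f' :: "real \<Rightarrow> real"
  assumes f: "\<And>x. x \<ge> 0 \<Longrightarrow> (f has_real_derivative f' x) (at x within {0..})"
  shows "f' 0 = 0 \<Longrightarrow> ((\<lambda>x. f \<bar>x\<bar>) has_real_derivative sgn x * f' \<bar>x\<bar>) (at x)"
    and "f 0 = 0 \<Longrightarrow> ((\<lambda>x. sgn x * f \<bar>x\<bar>) has_real_derivative f' \<bar>x\<bar>) (at x)"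
proof -
  have pos: "(f has_real_derivative f' x) (at x)" if "x > 0" for x
    using f[of x] that by (simp add: at_within_interior[of _ "{0..}"])
  have neg: "((\<lambda>x. f (- x)) has_real_derivative - f' (- x)) (at x)" if "x < 0" for x
    using DERIV_chain2[OF pos[of "- x"] DERIV_minus[OF DERIV_ident]] that by simp
  have f0: "((\<lambda>x. f (- x)) has_real_derivative - f' 0) (at 0 within {..0})"
  proof -
    have "(f has_real_derivative f' 0) (at (- 0) within uminus ` {..0})"
      using f[of 0] by simp
    from DERIV_image_chain[OF this DERIV_minus[OF DERIV_ident]] show ?thesis
      by (simp add: o_def)
  qed
  have glue: "(h has_real_derivative c) (at 0)"
    if "(h has_real_derivative c) (at 0 within {0..})" "(h has_real_derivative c) (at 0 within {..0})"
    for h :: "real \<Rightarrow> real" and c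
  proof -
    have "at (0::real) = sup (at 0 within {0..}) (at 0 within {..0})"
      by (subst at_within_union[symmetric]) (auto intro!: arg_cong[where f = "\<lambda>S. at 0 within S"])
    then show ?thesis using that unfolding has_field_derivative_iff by (simp add: filterlim_sup)
  qed
  { assume z: "f' 0 = 0"
    consider "x > 0" | "x < 0" | "x = 0" by linarith
    then show "((\<lambda>x. f \<bar>x\<bar>) has_real_derivative sgn x * f' \<bar>x\<bar>) (at x)"
    proof cases
      case 1
      have "((\<lambda>x. f \<bar>x\<bar>) has_real_derivative f' x) (at x)"
        by (rule has_field_derivative_transform_within_open[where f = f and S = "{0<..}", OF pos[OF 1]]) (use 1 in auto)
      with 1 show ?thesis by simp
    next
      case 2
      have "((\<lambda>x. f \<bar>x\<bar>) has_real_derivative - f' (- x)) (at x)"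
        by (rule has_field_derivative_transform_within_open[where f = "\<lambda>x. f (- x)" and S = "{..<0}", OF neg[OF 2]]) (use 2 in auto)
      with 2 show ?thesis by simp
    next
      case 3
      have "((\<lambda>x. f \<bar>x\<bar>) has_real_derivative 0) (at 0)"
      proof (rule glue)
        show "((\<lambda>x. f \<bar>x\<bar>) has_real_derivative 0) (at 0 within {0..})"
          by (rule has_field_derivative_transform_within[where f = f and d = 1]) (use f[of 0] z in auto)
        show "((\<lambda>x. f \<bar>x\<bar>) has_real_derivative 0) (at 0 within {..0})"
          by (rule has_field_derivative_transform_within[where f = "\<lambda>x. f (- x)" and d = 1]) (use f0 z in auto)
      qed
      with 3 show ?thesis by simp
    qed }
  { assume z: "f 0 = 0"
    consider "x > 0" | "x < 0" | "x = 0" by linarith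
    then show "((\<lambda>x. sgn x * f \<bar>x\<bar>) has_real_derivative f' \<bar>x\<bar>) (at x)"
    proof cases
      case 1
      have "((\<lambda>x. sgn x * f \<bar>x\<bar>) has_real_derivative f' x) (at x)"
        by (rule has_field_derivative_transform_within_open[where f = f and S = "{0<..}", OF pos[OF 1]]) (use 1 in auto)
      with 1 show ?thesis by simp
    next
      case 2
      have "((\<lambda>x. sgn x * f \<bar>x\<bar>) has_real_derivative - (- f' (- x))) (at x)"
        by (rule has_field_derivative_transform_within_open[where f = "\<lambda>x. - f (- x)" and S = "{..<0}", OF DERIV_minus[OF neg[OF 2]]]) (use 2 in auto)
      with 2 show ?thesis by simp
    next
      case 3
      have "((\<lambda>x. sgn x * f \<bar>x\<bar>) has_real_derivative f' 0) (at 0)"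
      proof (rule glue)
        show "((\<lambda>x. sgn x * f \<bar>x\<bar>) has_real_derivative f' 0) (at 0 within {0..})"
          by (rule has_field_derivative_transform_within[where f = f and d = 1]) (use f[of 0] z in \<open>auto simp: sgn_if\<close>)
        show "((\<lambda>x. sgn x * f \<bar>x\<bar>) has_real_derivative f' 0) (at 0 within {..0})"
          by (rule has_field_derivative_transform_within[where f = "\<lambda>x. - f (- x)" and d = 1])
            (use DERIV_minus[OF f0] z in \<open>auto simp: sgn_if\<close>)
      qed
      with 3 show ?thesis by simp
    qed }
qed

text \<open>With \<open>g = A exp (i \<kappa> x)\<close>, the functions \<open>p = 2 Re g\<close> and \<open>q = - 2 \<kappa> Im g\<close> are a solution and its derivative
  on the half-line. As \<open>q(0) = 0\<close> and \<open>V\<close> is even, reflection gives a \<open>C\<^sup>2\<close> solution on the line, and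
  \<open>u\<close>, \<open>u'\<close>, \<open>u''\<close> are all bounded by multiples of \<open>\<bar>A\<bar>\<close>.\<close>

lemma decaying_amplitude_eigenvalue:
  assumes \<kappa>: "\<kappa> > 0" and cont: "continuous_on UNIV V" and even: "\<And>x. V (- x) = V x"
    and bound: "\<And>x. \<bar>V x\<bar> \<le> K" and A: "amplitude V \<kappa> A"
    and D: "\<And>x. x \<ge> 0 \<Longrightarrow> (1 + x\<^sup>2) * (norm (A x))\<^sup>2 \<le> D"
  shows "complex_of_real (\<kappa>\<^sup>2) \<in> point_spectrum (schroedinger V)"
proof -
  define g where "g x = A x * cis (\<kappa> * x)" for x
  define p where "p x = 2 * Re (g x)" for x
  define q where "q x = - 2 * \<kappa> * Im (g x)" for x
  have ng: "norm (g x) = norm (A x)" for x by (simp add: g_def norm_mult)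
  have g': "(g has_vector_derivative (- \<i> * of_real (V x * p x / (2 * \<kappa>)) + \<i> * of_real \<kappa> * g x)) (at x within {0..})"
    if x: "x \<ge> 0" for x
  proof -
    have "((\<lambda>x. cis (\<kappa> * x)) has_vector_derivative \<i> * of_real \<kappa> * cis (\<kappa> * x)) (at x within {0..})"
      using has_vector_derivative_cis[of \<kappa> 0 x] by (simp add: has_vector_derivative_at_within)
    with A x have "(g has_vector_derivative (A x * (\<i> * of_real \<kappa> * cis (\<kappa> * x)) + amplitude_rhs V \<kappa> x (A x) * cis (\<kappa> * x))) (at x within {0..})"
      unfolding g_def[abs_def] amplitude_def by (intro has_vector_derivative_mult) auto
    moreover have "amplitude_rhs V \<kappa> x (A x) * cis (\<kappa> * x) = - \<i> * of_real (V x * p x / (2 * \<kappa>))"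
    proof -
      have "cis (- (2 * \<kappa> * x)) * cnj (A x) * cis (\<kappa> * x) = cnj (A x) * (cis (- (2 * \<kappa> * x)) * cis (\<kappa> * x))"
        by (simp add: ac_simps)
      also have "cis (- (2 * \<kappa> * x)) * cis (\<kappa> * x) = cnj (cis (\<kappa> * x))"
        unfolding cis_mult cis_cnj by (rule arg_cong[where f = cis]) simp
      finally have "(A x + cis (- (2 * \<kappa> * x)) * cnj (A x)) * cis (\<kappa> * x) = g x + cnj (g x)"
        by (simp add: g_def algebra_simps)
      also have "\<dots> = of_real (p x)" by (simp add: p_def complex_eq_iff)
      finally have *: "(A x + cis (- (2 * \<kappa> * x)) * cnj (A x)) * cis (\<kappa> * x) = of_real (p x)" .
      have "amplitude_rhs V \<kappa> x (A x) * cis (\<kappa> * x) = of_real (V x) / (2 * \<i> * of_real \<kappa>) * of_real (p x)"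
        unfolding amplitude_rhs_def *[symmetric] by (simp only: mult.assoc)
      also have "\<dots> = - \<i> * of_real (V x * p x / (2 * \<kappa>))"
        using \<kappa> by (simp add: complex_eq_iff Re_divide Im_divide power2_eq_square field_simps)
      finally show ?thesis .
    qed
    ultimately show ?thesis by (simp add: g_def algebra_simps)
  qed
  have p': "(p has_real_derivative q x) (at x within {0..})" if "x \<ge> 0" for x
    using DERIV_cmult[OF bounded_linear.has_vector_derivative[OF bounded_linear_Re g'[OF that],
        folded has_real_derivative_iff_has_vector_derivative], of 2]
    by (simp add: p_def[abs_def] q_def mult.assoc)
  have q': "(q has_real_derivative (V x - \<kappa>\<^sup>2) * p x) (at x within {0..})" if "x \<ge> 0" for x
    using DERIV_cmult[OF bounded_linear.has_vector_derivative[OF bounded_linear_Im g'[OF that],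
        folded has_real_derivative_iff_has_vector_derivative], of "- 2 * \<kappa>"] \<kappa>
    by (simp add: q_def[abs_def] p_def power2_eq_square algebra_simps)
  have A0: "A 0 = 1 / 2" using A unfolding amplitude_def by blast
  have q0: "q 0 = 0" unfolding q_def g_def A0 by simp
  define u where "u x = complex_of_real (p \<bar>x\<bar>)" for x
  define u1 where "u1 x = complex_of_real (sgn x * q \<bar>x\<bar>)" for x
  define u2 where "u2 x = complex_of_real ((V x - \<kappa>\<^sup>2) * p \<bar>x\<bar>)" for x
  have Va: "V \<bar>x\<bar> = V x" for x using even[of x] by (cases "x \<ge> 0") auto
  have du: "(u has_vector_derivative u1 x) (at x)" for x
    using even_extension_derivative(1)[OF p' q0, of x]
    unfolding u_def[abs_def] u1_def has_real_derivative_iff_has_vector_derivative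
    by (rule bounded_linear.has_vector_derivative[OF bounded_linear_of_real])
  have du1: "(u1 has_vector_derivative u2 x) (at x)" for x
    using even_extension_derivative(2)[OF q' q0, of x]
    unfolding u1_def[abs_def] u2_def has_real_derivative_iff_has_vector_derivative Va
    by (rule bounded_linear.has_vector_derivative[OF bounded_linear_of_real])
  have cu: "continuous_on UNIV u" and cu1: "continuous_on UNIV u1"
    using has_vector_derivative_continuous[OF du] has_vector_derivative_continuous[OF du1]
    by (auto intro!: continuous_at_imp_continuous_on)
  have u2u: "u2 x = of_real (V x - \<kappa>\<^sup>2) * u x" for x by (simp add: u2_def u_def)
  have cu2: "continuous_on UNIV u2"
    unfolding u2u by (intro continuous_intros cont cu)
  have decay: "(1 + x\<^sup>2) * (norm (w x))\<^sup>2 \<le> c\<^sup>2 * D" if "norm (w x) \<le> c * norm (A \<bar>x\<bar>)" for w :: "real \<Rightarrow> complex" and c x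
  proof -
    have "(norm (w x))\<^sup>2 \<le> (c * norm (A \<bar>x\<bar>))\<^sup>2" using that by (intro power_mono) auto
    then have "(1 + x\<^sup>2) * (norm (w x))\<^sup>2 \<le> (1 + x\<^sup>2) * (c * norm (A \<bar>x\<bar>))\<^sup>2"
      by (intro mult_left_mono) auto
    also have "\<dots> = c\<^sup>2 * ((1 + \<bar>x\<bar>\<^sup>2) * (norm (A \<bar>x\<bar>))\<^sup>2)" by (simp add: power_mult_distrib)
    also have "\<dots> \<le> c\<^sup>2 * D" by (intro mult_left_mono D) auto
    finally show ?thesis .
  qed
  have nu: "norm (u x) \<le> 2 * norm (A \<bar>x\<bar>)" for x
    using abs_Re_le_cmod[of "g \<bar>x\<bar>"] by (simp add: u_def p_def ng)
  have nu1: "norm (u1 x) \<le> 2 * \<kappa> * norm (A \<bar>x\<bar>)" for x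
  proof -
    have "\<bar>q \<bar>x\<bar>\<bar> \<le> 2 * \<kappa> * norm (A \<bar>x\<bar>)"
      using abs_Im_le_cmod[of "g \<bar>x\<bar>"] \<kappa> by (simp add: q_def ng abs_mult)
    moreover have "norm (u1 x) \<le> \<bar>q \<bar>x\<bar>\<bar>" by (simp add: u1_def abs_mult sgn_if)
    ultimately show ?thesis by linarith
  qed
  have nu2: "norm (u2 x) \<le> (K + \<kappa>\<^sup>2) * 2 * norm (A \<bar>x\<bar>)" for x
  proof -
    have "\<bar>V x - \<kappa>\<^sup>2\<bar> \<le> K + \<kappa>\<^sup>2" using bound[of x] by (simp add: abs_if split: if_splits) (smt (verit) zero_le_power2)+
    then have "norm (u2 x) \<le> (K + \<kappa>\<^sup>2) * (2 * norm (A \<bar>x\<bar>))"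
      unfolding u2u norm_mult norm_of_real using nu[of x] by (intro mult_mono) auto
    then show ?thesis by (simp only: mult.assoc)
  qed
  have nf: "norm (of_real (\<kappa>\<^sup>2) * u x) \<le> \<kappa>\<^sup>2 * 2 * norm (A \<bar>x\<bar>)" for x
    using mult_left_mono[OF nu[of x], of "\<kappa>\<^sup>2"] by (simp add: norm_mult norm_power)
  have "(u, \<lambda>x. of_real (\<kappa>\<^sup>2) * u x) \<in> schroedinger V"
    unfolding schroedinger_def
  proof (rule CollectI, rule case_prodI, intro conjI)
    show "L2 u" by (rule L2_decay[OF cu decay[where w = u, OF nu]])
    show "L2 (\<lambda>x. of_real (\<kappa>\<^sup>2) * u x)"
      by (rule L2_decay[OF _ decay[where w = "\<lambda>x. of_real (\<kappa>\<^sup>2) * u x", OF nf]]) (intro continuous_intros cu)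
    show "\<exists>u1 u2. L2 u1 \<and> L2 u2 \<and> weak_deriv u u1 \<and> weak_deriv u1 u2 \<and>
        (AE x in lborel. of_real (\<kappa>\<^sup>2) * u x = - u2 x + of_real (V x) * u x)"
    proof (rule exI[of _ u1], rule exI[of _ u2], intro conjI)
      show "L2 u1" by (rule L2_decay[OF cu1 decay[where w = u1, OF nu1]])
      show "L2 u2" by (rule L2_decay[OF cu2 decay[where w = u2, OF nu2]])
      show "weak_deriv u u1" by (rule weak_deriv_C1[OF du cu1])
      show "weak_deriv u1 u2" by (rule weak_deriv_C1[OF du1 cu2])
      show "AE x in lborel. of_real (\<kappa>\<^sup>2) * u x = - u2 x + of_real (V x) * u x"
        by (simp add: u2u algebra_simps)
    qed
  qed
  moreover have "\<not> (AE x in lborel. u x = 0)"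
  proof
    assume ae: "AE x in lborel. u x = 0"
    have "p 0 = 1" unfolding p_def g_def A0 by simp
    then have u0: "u 0 = 1" by (simp add: u_def)
    define S where "S = u -` (- {0})"
    have "open S" unfolding S_def using cu by (intro open_vimage) auto
    moreover have "0 \<in> S" by (simp add: S_def u0)
    ultimately obtain e where e: "e > 0" "ball 0 e \<subseteq> S" by (meson openE)
    have "AE x in lborel. x \<notin> S" using ae by (auto simp: S_def)
    then have "AE x in lborel. x \<notin> {-e<..<e}"
      by eventually_elim (use e in \<open>auto simp: ball_def dist_real_def subset_iff\<close>)
    then have "emeasure lborel {-e<..<e} = 0"
      by (subst (asm) AE_iff_measurable[of "{-e<..<e}"]) auto
    then show False using e by simp
  qed
  ultimately show ?thesis unfolding point_spectrum_def by blast
qed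


section \<open>Placing the blocks\<close>

text \<open>The height of block \<open>i\<close>. Its product with the length \<open>2\<^sup>i\<close> tends to infinity, which makes resonant
  blocks strong, while the height times this product tends to zero, which makes the errors of
  averaging small.\<close>

definition block_amp :: "nat \<Rightarrow> real" where
  "block_amp i = real i / 2 ^ i"

lemma block_amp_nonneg: "0 \<le> block_amp i"
  by (simp add: block_amp_def)

lemma block_amp_decay: "\<exists>C>0. \<forall>i. block_amp i * (1 + real i) ^ N \<le> C * (3 / 4) ^ i"
proof -
  have "(\<lambda>i. real i * (1 + real i) ^ N * (2 / 3) ^ i) \<longlonglongrightarrow> 0"
    by real_asymp
  then have "Bseq (\<lambda>i. real i * (1 + real i) ^ N * (2 / 3) ^ i)"
    by (intro convergent_imp_Bseq convergentI)
  then obtain C where C: "C > 0" "\<And>i. norm (real i * (1 + real i) ^ N * (2 / 3) ^ i) \<le> C"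
    by (auto simp: Bseq_def)
  have "block_amp i * (1 + real i) ^ N \<le> C * (3 / 4) ^ i" for i
  proof -
    have e: "(2 / 3 :: real) ^ i * (3 / 4) ^ i = 1 / 2 ^ i"
      by (simp add: power_one_over flip: power_mult_distrib)
    have "block_amp i * (1 + real i) ^ N = real i * (1 + real i) ^ N * (2 / 3) ^ i * (3 / 4) ^ i"
      unfolding mult.assoc e by (simp add: block_amp_def)
    also have "\<dots> \<le> C * (3 / 4) ^ i"
      using C(2)[of i] by (intro mult_right_mono) auto
    finally show ?thesis .
  qed
  with C(1) show ?thesis by blast
qed

lemma summable_block_amp: "summable block_amp"
proof -
  obtain C where C: "\<And>i. block_amp i \<le> C * (3 / 4) ^ i"
    using block_amp_decay[of 0] by auto
  show ?thesis
    by (rule summable_comparison_test[where g = "\<lambda>i. C * (3 / 4) ^ i"])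
      (auto intro!: exI[of _ 0] summable_mult summable_geometric simp: C block_amp_nonneg)
qed

text \<open>In every window of length \<open>P\<close> the doublings contribute at most \<open>2\<^sup>P\<close>, and late enough one hit
  contributes \<open>2\<^sup>-\<^sup>2\<^sup>P\<close>. So a window shrinks \<open>s\<close> by \<open>2\<^sup>-\<^sup>P\<close>, as \<open>1 / 2\<^sup>i\<close> does.\<close>

lemma recurrent_decay:
  fixes s :: "nat \<Rightarrow> real"
  assumes s0: "\<And>i. 0 \<le> s i"
    and grow: "\<And>i. i \<ge> I \<Longrightarrow> s (Suc i) \<le> 2 * s i"
    and hit: "\<And>i. i \<ge> I \<Longrightarrow> hit i \<Longrightarrow> s (Suc i) \<le> 2 * exp (- (real i * c)) * s i"
    and c: "c > 0" and P: "P > 0" and rec: "\<And>i. \<exists>j\<in>{i..<i + P}. hit j"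
  shows "\<exists>C\<ge>0. \<forall>i. s i \<le> C / 2 ^ i"
proof -
  have "(\<lambda>i. exp (- (real i * c))) \<longlonglongrightarrow> 0"
    using c by real_asymp
  then have "eventually (\<lambda>i. exp (- (real i * c)) < 1 / 2 ^ (2 * P)) sequentially"
    by (rule order_tendstoD) simp
  then obtain I0 where I0: "\<And>i. i \<ge> I0 \<Longrightarrow> exp (- (real i * c)) < 1 / 2 ^ (2 * P)"
    by (auto simp: eventually_sequentially)
  define I' where "I' = max I I0"
  have mult: "s (i + k) \<le> 2 ^ k * s i" if "i \<ge> I'" for i k
  proof (induction k)
    case (Suc k)
    have "s (i + Suc k) \<le> 2 * s (i + k)" using grow[of "i + k"] that by (simp add: I'_def)
    also have "\<dots> \<le> 2 * (2 ^ k * s i)" using Suc by simp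
    finally show ?case by simp
  qed simp
  have period: "s (i + P) \<le> s i / 2 ^ P" if i: "i \<ge> I'" for i
  proof -
    obtain j where j: "j \<in> {i..<i + P}" "hit j" using rec by blast
    have "s (Suc j) \<le> 2 * exp (- (real j * c)) * s j"
      using j i by (intro hit) (auto simp: I'_def)
    also have "\<dots> \<le> 2 * (1 / 2 ^ (2 * P)) * s j"
      using j i by (intro mult_right_mono mult_left_mono less_imp_le[OF I0] s0) (auto simp: I'_def)
    finally have 1: "s (Suc j) \<le> 2 * (1 / 2 ^ (2 * P)) * s j" .
    have 2: "s j \<le> 2 ^ (j - i) * s i" using mult[OF i, of "j - i"] j by simp
    have 3: "s (i + P) \<le> 2 ^ (i + P - Suc j) * s (Suc j)"
      using mult[of "Suc j" "i + P - Suc j"] i j by simp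
    note 3
    also have "2 ^ (i + P - Suc j) * s (Suc j) \<le> 2 ^ (i + P - Suc j) * (2 * (1 / 2 ^ (2 * P)) * (2 ^ (j - i) * s i))"
      using 2 by (intro mult_left_mono order.trans[OF 1]) auto
    also have "\<dots> = (2 ^ (i + P - Suc j) * 2 ^ 1 * 2 ^ (j - i)) / 2 ^ (2 * P) * s i"
      by simp
    also have "(2::real) ^ (i + P - Suc j) * 2 ^ 1 * 2 ^ (j - i) = 2 ^ P"
      using j unfolding power_add[symmetric] by (intro arg_cong[where f = "\<lambda>k. 2 ^ k"]) auto
    also have "(2::real) ^ P / 2 ^ (2 * P) * s i = s i / 2 ^ P"
      by (simp add: mult_2 power_add)
    finally show ?thesis .
  qed
  define C where "C = (\<Sum>i<I' + P. s i * 2 ^ i)"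
  have C0: "C \<ge> 0" unfolding C_def by (intro sum_nonneg) (simp add: s0)
  have "s i \<le> C / 2 ^ i" for i
  proof (induction i rule: less_induct)
    case (less i)
    show ?case
    proof (cases "i < I' + P")
      case True
      then have "s i * 2 ^ i \<le> C"
        unfolding C_def by (intro member_le_sum[of i _ "\<lambda>i. s i * 2 ^ i"]) (auto simp: s0)
      then show ?thesis by (simp add: field_simps)
    next
      case False
      then have "s i \<le> s (i - P) / 2 ^ P" using period[of "i - P"] by simp
      also have "\<dots> \<le> C / 2 ^ (i - P) / 2 ^ P"
        using less[of "i - P"] False P by (intro divide_right_mono) auto
      also have "\<dots> = C / 2 ^ i"
        using False by (simp flip: power_add)
      finally show ?thesis .
    qed
  qed
  with C0 show ?thesis by blast
qed

lemma multiplicity_two_recurs: "\<exists>P>0. \<forall>i::nat. \<exists>j\<in>{i..<i + P}. multiplicity 2 j = l"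
proof (intro exI[of _ "2 ^ Suc l"] conjI allI)
  fix i :: nat
  define p :: nat where "p = 2 ^ l"
  \<comment> \<open>Chosen such that \<open>j\<close> is the smallest odd multiple of \<open>p\<close> that is at least \<open>i\<close>.\<close>
  define q where "q = (i + p - 1) div (2 * p)"
  define j where "j = p * (2 * q + 1)"
  have p: "p \<ge> 1" by (simp add: p_def)
  have "i + p - 1 = q * (2 * p) + (i + p - 1) mod (2 * p)"
    unfolding q_def by (rule div_mult_mod_eq[symmetric])
  then have "i + p = q * (2 * p) + (i + p - 1) mod (2 * p) + 1"
    using p by linarith
  moreover have "(i + p - 1) mod (2 * p) < 2 * p" using p by simp
  moreover have "j = q * (2 * p) + p" by (simp add: j_def algebra_simps)
  ultimately have "i \<le> j" "j < i + 2 * p" by linarith+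
  moreover have "multiplicity 2 j = l"
  proof (rule multiplicity_eqI)
    show "2 ^ l dvd j" by (simp add: j_def p_def)
    show "\<not> 2 ^ Suc l dvd j"
      unfolding j_def p_def power_Suc2 nat_mult_dvd_cancel_disj by simp
  qed
  ultimately show "\<exists>j\<in>{i..<i + 2 ^ Suc l}. multiplicity 2 j = l" by (auto simp: p_def)
qed simp

locale block_construction =
  fixes m :: "nat \<Rightarrow> nat"
  assumes m_pos: "n \<ge> 1 \<Longrightarrow> m n > 0"
begin

lemma theta_pos: "n \<ge> 1 \<Longrightarrow> theta m n > 0"
  using m_pos[of n] by (simp add: theta_def)

text \<open>One representative for each frequency; only these carry blocks.\<close>

definition first_index :: "nat \<Rightarrow> bool" where
  "first_index n \<longleftrightarrow> n \<ge> 1 \<and> (\<forall>j. 1 \<le> j \<and> j < n \<longrightarrow> theta m j \<noteq> theta m n)"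

lemma first_index_inject:
  assumes "first_index n" "first_index l" "theta m n = theta m l"
  shows "n = l"
  using assms unfolding first_index_def by (metis linorder_neqE_nat)

lemma first_index_exists:
  assumes "n \<ge> 1"
  obtains l where "first_index l" "theta m l = theta m n" "l \<le> n"
proof -
  define l where "l = (LEAST j. 1 \<le> j \<and> theta m j = theta m n)"
  have l: "1 \<le> l \<and> theta m l = theta m n"
    unfolding l_def by (rule LeastI[of _ n]) (use assms in simp)
  have min: "l \<le> j" if "1 \<le> j \<and> theta m j = theta m n" for j
    unfolding l_def using that by (rule Least_le)
  have "first_index l"
    unfolding first_index_def using l min by fastforce
  with l min assms show ?thesis by (intro that[of l]) auto
qed

text \<open>Block \<open>i\<close>, if it carries the frequency of index \<open>n\<close>, is under control for the eigenvalue of index \<open>l\<close>: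
  the amplitude at most doubles inside and, if both frequencies agree, decays across the block. In the
  latter case the growing component is assumed to vanish at the right end.\<close>

definition good :: "nat \<Rightarrow> nat \<Rightarrow> nat \<Rightarrow> bool" where
  "good l n i \<longleftrightarrow> (\<forall>\<psi> A V. amplitude V (theta m l / 2) A \<longrightarrow>
     (\<forall>x\<in>{2 ^ i..2 * 2 ^ i}. V x = block_amp i * bump (x / 2 ^ i) * cos (theta m n * x + \<psi>)) \<longrightarrow>
     (theta m n = theta m l \<longrightarrow> Im (cnj (phase_axis \<psi>) * A (2 * 2 ^ i)) = 0) \<longrightarrow>
     (\<forall>x\<in>{2 ^ i..2 * 2 ^ i}. norm (A x) \<le> 2 * norm (A (2 ^ i))) \<and>
     (theta m n = theta m l \<longrightarrow>
       norm (A (2 * 2 ^ i)) \<le> 2 * exp (- (real i * (bump_mass / (2 * theta m l)))) * norm (A (2 ^ i))))"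

lemma eventually_good:
  assumes "l \<ge> 1" "n \<ge> 1"
  shows "\<exists>I. \<forall>i\<ge>I. good l n i"
proof -
  have \<kappa>: "theta m l / 2 > 0" using theta_pos[OF assms(1)] by simp
  have small: "\<exists>I. \<forall>i\<ge>I. C * (block_amp i + (block_amp i)\<^sup>2 * 2 ^ i) \<le> 1 / 4" for C
  proof -
    have "(\<lambda>i. C * (real i / 2 ^ i + (real i / 2 ^ i)\<^sup>2 * 2 ^ i)) \<longlonglongrightarrow> 0"
      by real_asymp
    then have "eventually (\<lambda>i. C * (block_amp i + (block_amp i)\<^sup>2 * 2 ^ i) < 1 / 4) sequentially"
      unfolding block_amp_def by (rule order_tendstoD) simp
    then show ?thesis
      unfolding eventually_sequentially by (meson less_imp_le)
  qed
  show ?thesis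
  proof (cases "theta m n = theta m l")
    case True
    then have "theta m n = 2 * (theta m l / 2)" by simp
    from resonant_estimate[OF \<kappa> this] obtain C where
      C: "\<And>R \<epsilon> \<psi> A V x. R > 0 \<Longrightarrow> \<epsilon> \<ge> 0 \<Longrightarrow> C * (\<epsilon> + \<epsilon>\<^sup>2 * R) \<le> 1 / 4 \<Longrightarrow> amplitude V (theta m l / 2) A \<Longrightarrow>
        \<forall>x\<in>{R..2 * R}. V x = \<epsilon> * bump (x / R) * cos (theta m n * x + \<psi>) \<Longrightarrow>
        Im (cnj (phase_axis \<psi>) * A (2 * R)) = 0 \<Longrightarrow> x \<in> {R..2 * R} \<Longrightarrow>
        norm (A x) \<le> 2 * norm (A R) \<and>
        norm (A (2 * R)) \<le> 2 * exp (- (\<epsilon> * R * bump_mass / (4 * (theta m l / 2)))) * norm (A R)"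
      by blast
    obtain I where I: "\<And>i. i \<ge> I \<Longrightarrow> C * (block_amp i + (block_amp i)\<^sup>2 * 2 ^ i) \<le> 1 / 4"
      using small by blast
    have e: "block_amp i * 2 ^ i * bump_mass / (4 * (theta m l / 2)) = real i * (bump_mass / (2 * theta m l))" for i
      by (simp add: block_amp_def)
    have "good l n i" if "i \<ge> I" for i
      unfolding good_def
    proof (intro allI impI)
      fix \<psi> A V
      assume *: "amplitude V (theta m l / 2) A"
        "\<forall>x\<in>{2 ^ i..2 * 2 ^ i}. V x = block_amp i * bump (x / 2 ^ i) * cos (theta m n * x + \<psi>)"
        "theta m n = theta m l \<longrightarrow> Im (cnj (phase_axis \<psi>) * A (2 * 2 ^ i)) = 0"
      then have "Im (cnj (phase_axis \<psi>) * A (2 * 2 ^ i)) = 0" using True by simp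
      from C[OF _ block_amp_nonneg I[OF that] *(1,2) this]
      have r: "norm (A x) \<le> 2 * norm (A (2 ^ i)) \<and>
        norm (A (2 * 2 ^ i)) \<le> 2 * exp (- (real i * (bump_mass / (2 * theta m l)))) * norm (A (2 ^ i))"
        if "x \<in> {2 ^ i..2 * 2 ^ i}" for x using that unfolding e by simp
      from r r[of "2 ^ i"] show "(\<forall>x\<in>{2 ^ i..2 * 2 ^ i}. norm (A x) \<le> 2 * norm (A (2 ^ i))) \<and>
        (theta m n = theta m l \<longrightarrow>
          norm (A (2 * 2 ^ i)) \<le> 2 * exp (- (real i * (bump_mass / (2 * theta m l)))) * norm (A (2 ^ i)))"
        by simp
    qed
    then show ?thesis by blast
  next
    case False
    then have "theta m n \<noteq> 2 * (theta m l / 2)" by simp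
    from nonresonant_estimate[OF \<kappa> theta_pos[OF assms(2)] this] obtain C where
      C: "\<And>R \<epsilon> \<psi> A V x. R > 0 \<Longrightarrow> \<epsilon> \<ge> 0 \<Longrightarrow> C * (\<epsilon> + \<epsilon>\<^sup>2 * R) \<le> 1 / 4 \<Longrightarrow> amplitude V (theta m l / 2) A \<Longrightarrow>
        \<forall>x\<in>{R..2 * R}. V x = \<epsilon> * bump (x / R) * cos (theta m n * x + \<psi>) \<Longrightarrow> x \<in> {R..2 * R} \<Longrightarrow>
        norm (A x) \<le> 2 * norm (A R)"
      by blast
    obtain I where I: "\<And>i. i \<ge> I \<Longrightarrow> C * (block_amp i + (block_amp i)\<^sup>2 * 2 ^ i) \<le> 1 / 4"
      using small by blast
    have "good l n i" if "i \<ge> I" for i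
      unfolding good_def
    proof (intro allI impI conjI ballI)
      fix \<psi> A V and x :: real
      assume "amplitude V (theta m l / 2) A"
        "\<forall>x\<in>{2 ^ i..2 * 2 ^ i}. V x = block_amp i * bump (x / 2 ^ i) * cos (theta m n * x + \<psi>)"
        "x \<in> {2 ^ i..2 * 2 ^ i}"
      from C[OF _ block_amp_nonneg I[OF that] this] show "norm (A x) \<le> 2 * norm (A (2 ^ i))" by simp
    qed (use False in simp)
    then show ?thesis by blast
  qed
qed

definition threshold :: "nat \<Rightarrow> nat \<Rightarrow> nat" where
  "threshold l n = (SOME I. \<forall>i\<ge>I. good l n i)"

lemma threshold: "l \<ge> 1 \<Longrightarrow> n \<ge> 1 \<Longrightarrow> threshold l n \<le> i \<Longrightarrow> good l n i"
  using someI_ex[OF eventually_good] unfolding threshold_def by blast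

definition same_theta :: "nat \<Rightarrow> nat set" where
  "same_theta n = {j. j \<ge> 1 \<and> theta m j = theta m n}"

text \<open>The first block that may carry the frequency of index \<open>n\<close>. The sum of thresholds secures control
  over all eigenvalues of index up to \<open>n\<close>; the other summands make the height \<open>i / 2\<^sup>i\<close> small compared
  with powers of \<open>n\<close>, of the frequency, and of every other index of the same frequency if there are
  finitely many.\<close>

definition start :: "nat \<Rightarrow> nat" where
  "start n = n + nat \<lceil>theta m n\<rceil> + (\<Sum>l\<le>n. threshold l n) + (if finite (same_theta n) then \<Sum>(same_theta n) else 0)"

text \<open>Each value is taken periodically: for \<open>i > 0\<close>, the value \<open>l\<close> is taken at the odd multiples of \<open>2\<^sup>l\<close>.\<close>

definition index :: "nat \<Rightarrow> nat" where
  "index i = multiplicity 2 i"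

definition active :: "nat \<Rightarrow> bool" where
  "active i \<longleftrightarrow> first_index (index i) \<and> start (index i) \<le> i"

abbreviation freq :: "nat \<Rightarrow> real" where
  "freq i \<equiv> theta m (index i)"

text \<open>The second summand is the mirror image of the first in \<open>x = 0\<close>, so that the block is even.\<close>

definition block :: "nat \<Rightarrow> real \<Rightarrow> real \<Rightarrow> real" where
  "block i r x = (if active i then
     block_amp i * (bump (x / 2 ^ i) * cos (freq i * x + r) + bump (- x / 2 ^ i) * cos (freq i * x - r)) else 0)"

lemma freq_pos: "active i \<Longrightarrow> freq i > 0"
  by (auto simp: active_def first_index_def intro: theta_pos)

lemma block_eq_0:
  assumes "\<bar>x\<bar> \<le> 2 ^ i \<or> 2 * 2 ^ i \<le> \<bar>x\<bar>"
  shows "block i r x = 0"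
proof -
  have "bump (x / 2 ^ i) = 0" "bump (- x / 2 ^ i) = 0"
    using assms by (auto intro!: bump_eq_0 simp: abs_if field_simps split: if_splits)
  then show ?thesis by (simp add: block_def)
qed

lemma block_eq:
  assumes "active i" "x \<ge> 0"
  shows "block i r x = block_amp i * bump (x / 2 ^ i) * cos (freq i * x + r)"
proof -
  have "- x / 2 ^ i \<le> 0" using assms(2) by simp
  then have "bump (- x / 2 ^ i) = 0" by (intro bump_eq_0 disjI1) linarith
  with assms(1) show ?thesis by (simp add: block_def)
qed

lemma block_even: "block i r (- x) = block i r x"
proof -
  have "freq i * (- x) + r = - (freq i * x - r)" "freq i * (- x) - r = - (freq i * x + r)"
    by simp_all
  then have "cos (freq i * (- x) + r) = cos (freq i * x - r)" "cos (freq i * (- x) - r) = cos (freq i * x + r)"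
    by (simp_all only: cos_minus)
  then show ?thesis by (simp add: block_def add.commute)
qed

lemma smooth_block: "smooth (block i r)"
proof (cases "active i")
  case True
  have "ck k (\<lambda>x. block_amp i * (bump ((1 / 2 ^ i) * x + 0) * cos (freq i * x + r)
      + bump ((- 1 / 2 ^ i) * x + 0) * cos (freq i * x + (- r))))" for k
    using smooth_bump ck_cos_sin[of k]
    by (intro ck_mult ck_add ck_const ck_affine[of k bump] ck_affine[of k cos]) (auto simp: smooth_iff_ck)
  moreover have "block i r = (\<lambda>x. block_amp i * (bump ((1 / 2 ^ i) * x + 0) * cos (freq i * x + r)
      + bump ((- 1 / 2 ^ i) * x + 0) * cos (freq i * x + (- r))))"
    using True by (intro ext) (simp add: block_def)
  ultimately show ?thesis by (simp add: smooth_iff_ck)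
next
  case False
  then have "block i r = (\<lambda>x. 0)" by (intro ext) (simp add: block_def)
  then show ?thesis by (simp add: smooth_iff_ck ck_const)
qed

lemma continuous_on_block: "continuous_on S (block i r)"
  by (rule smooth_imp_continuous_on[OF smooth_block])

lemma block_bound: "\<bar>block i r x\<bar> \<le> 2 * block_amp i"
proof (cases "active i")
  case True
  have b: "\<bar>bump y * cos z\<bar> \<le> 1" for y z
    using bump_nonneg[of y] bump_le_1[of y] abs_cos_le_one[of z] by (simp add: abs_mult mult_le_one)
  have "\<bar>bump (x / 2 ^ i) * cos (freq i * x + r) + bump (- x / 2 ^ i) * cos (freq i * x - r)\<bar> \<le> 1 + 1"
    by (rule order.trans[OF abs_triangle_ineq add_mono[OF b b]])
  from mult_left_mono[OF this block_amp_nonneg[of i]] show ?thesis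
    using True block_amp_nonneg[of i] by (simp add: block_def abs_mult)
qed (simp add: block_def block_amp_nonneg)

lemma block_lipschitz: "\<bar>block i r x - block i s x\<bar> \<le> 2 * block_amp i * \<bar>r - s\<bar>"
proof (cases "active i")
  case True
  have c: "\<bar>cos y - cos z\<bar> \<le> \<bar>y - z\<bar>" for y z :: real
  proof -
    have "norm (cos y - cos z) \<le> 1 * \<bar>y - z\<bar>"
    proof (rule vector_derivative_bound)
      show "(cos has_vector_derivative - sin t) (at t within {min y z..max y z})" for t :: real
        unfolding has_real_derivative_iff_has_vector_derivative[symmetric]
        by (rule has_field_derivative_at_within[OF DERIV_cos])
    qed auto
    then show ?thesis by simp
  qed
  have b: "\<bar>bump y * (cos z - cos w)\<bar> \<le> \<bar>z - w\<bar>" for y z w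
    using mult_mono[OF bump_le_1[of y] c[of z w]] bump_nonneg[of y] by (simp add: abs_mult)
  have "\<bar>bump (x / 2 ^ i) * (cos (freq i * x + r) - cos (freq i * x + s))
      + bump (- x / 2 ^ i) * (cos (freq i * x - r) - cos (freq i * x - s))\<bar> \<le> \<bar>r - s\<bar> + \<bar>r - s\<bar>"
    using b[of "x / 2 ^ i" "freq i * x + r" "freq i * x + s"] b[of "- x / 2 ^ i" "freq i * x - r" "freq i * x - s"]
    by (intro order.trans[OF abs_triangle_ineq add_mono]) (auto simp: abs_minus_commute)
  from mult_left_mono[OF this block_amp_nonneg[of i]]
  have "\<bar>block_amp i * (bump (x / 2 ^ i) * (cos (freq i * x + r) - cos (freq i * x + s))
      + bump (- x / 2 ^ i) * (cos (freq i * x - r) - cos (freq i * x - s)))\<bar> \<le> 2 * block_amp i * \<bar>r - s\<bar>"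
    using block_amp_nonneg[of i] by (simp add: abs_mult)
  moreover have "block i r x - block i s x = block_amp i * (bump (x / 2 ^ i) * (cos (freq i * x + r) - cos (freq i * x + s))
      + bump (- x / 2 ^ i) * (cos (freq i * x - r) - cos (freq i * x - s)))"
    using True by (simp add: block_def algebra_simps)
  ultimately show ?thesis by simp
qed (simp add: block_def block_amp_nonneg)

definition total_amp :: real where
  "total_amp = 2 * (\<Sum>i. block_amp i)"

lemma sum_block_bound:
  assumes "finite I"
  shows "\<bar>\<Sum>i\<in>I. block i (f i) x\<bar> \<le> total_amp"
proof -
  have "\<bar>\<Sum>i\<in>I. block i (f i) x\<bar> \<le> (\<Sum>i\<in>I. 2 * block_amp i)"
    by (rule order.trans[OF sum_abs sum_mono[OF block_bound]])
  also have "\<dots> = 2 * (\<Sum>i\<in>I. block_amp i)" by (simp add: sum_distrib_left)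
  also have "\<dots> \<le> total_amp"
    unfolding total_amp_def using sum_le_suminf[OF summable_block_amp assms] block_amp_nonneg by simp
  finally show ?thesis .
qed

text \<open>This is the sum over all \<open>i\<close>: every later block vanishes at \<open>x\<close>, since \<open>2\<^sup>i > i \<ge> \<bar>x\<bar>\<close>.\<close>

definition potential :: "(nat \<Rightarrow> real) \<Rightarrow> real \<Rightarrow> real" where
  "potential \<psi> x = (\<Sum>i\<le>nat \<lceil>\<bar>x\<bar>\<rceil>. block i (\<psi> i) x)"

lemma locally_finite_index:
  fixes x :: real
  assumes "2 ^ i < \<bar>x\<bar>"
  shows "i \<le> nat \<lceil>\<bar>x\<bar>\<rceil>"
proof -
  have "real i < 2 ^ i" by (metis of_nat_less_two_power)
  from less_trans[OF this assms] have "real i < \<bar>x\<bar>" .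
  then show ?thesis by linarith
qed

lemma potential_eq_sum:
  assumes "finite I" "\<And>i. 2 ^ i < \<bar>x\<bar> \<Longrightarrow> i \<in> I"
  shows "potential \<psi> x = (\<Sum>i\<in>I. block i (\<psi> i) x)"
proof -
  let ?J = "{i. 2 ^ i < \<bar>x\<bar>}"
  have "potential \<psi> x = (\<Sum>i\<in>?J. block i (\<psi> i) x)"
    unfolding potential_def
    by (rule sum.mono_neutral_right) (auto simp: locally_finite_index not_less intro!: block_eq_0)
  also have "\<dots> = (\<Sum>i\<in>I. block i (\<psi> i) x)"
    by (rule sum.mono_neutral_left) (use assms in \<open>auto simp: not_less intro!: block_eq_0\<close>)
  finally show ?thesis .
qed

lemma potential_bound: "\<bar>potential \<psi> x\<bar> \<le> total_amp"
  unfolding potential_def by (rule sum_block_bound) simp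

lemma potential_even: "potential \<psi> (- x) = potential \<psi> x"
  by (simp add: potential_def block_even)

lemma potential_truncate:
  assumes "\<bar>x\<bar> \<le> 2 ^ N"
  shows "potential \<psi> x = (\<Sum>i<N. block i (\<psi> i) x)"
proof (rule potential_eq_sum)
  fix i assume "2 ^ i < \<bar>x\<bar>"
  with assms have "(2::real) ^ i < 2 ^ N" by linarith
  then show "i \<in> {..<N}" by simp
qed simp

lemma potential_on_block:
  assumes "x \<in> {2 ^ i..2 * 2 ^ i}"
  shows "potential \<psi> x = block i (\<psi> i) x"
proof -
  have "0 < (2::real) ^ i" by simp
  also have "2 ^ i \<le> x" using assms by simp
  finally have "x > 0" .
  have "potential \<psi> x = (\<Sum>j<Suc i. block j (\<psi> j) x)"
    using assms \<open>x > 0\<close> by (intro potential_truncate) auto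
  also have "\<dots> = (\<Sum>j<i. block j (\<psi> j) x) + block i (\<psi> i) x" by simp
  also have "(\<Sum>j<i. block j (\<psi> j) x) = 0"
  proof (intro sum.neutral ballI block_eq_0 disjI2)
    fix j assume "j \<in> {..<i}"
    then have "(2::real) ^ Suc j \<le> 2 ^ i" by (intro power_increasing) auto
    with assms \<open>x > 0\<close> show "2 * 2 ^ j \<le> \<bar>x\<bar>" by auto
  qed
  finally show ?thesis by simp
qed

lemma smooth_potential: "smooth (potential \<psi>)"
proof (rule smooth_local)
  fix x :: real
  define N where "N = nat \<lceil>\<bar>x\<bar>\<rceil>"
  have "\<bar>x\<bar> \<le> real N" by (simp add: N_def)
  also have "real N < 2 ^ N" by (metis of_nat_less_two_power)
  finally have "x \<in> {- (2 ^ N)<..<2 ^ N}" by auto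
  moreover have "\<forall>y\<in>{- (2 ^ N)<..<2 ^ N}. potential \<psi> y = (\<Sum>i<N. block i (\<psi> i) y)"
    by (intro ballI potential_truncate) auto
  ultimately show "\<exists>S g. open S \<and> x \<in> S \<and> (\<forall>y\<in>S. potential \<psi> y = g y) \<and> smooth g"
    by (intro exI[of _ "{- (2 ^ N)<..<2 ^ N}"] exI[of _ "\<lambda>y. \<Sum>i<N. block i (\<psi> i) y"])
      (auto intro: smooth_sum smooth_block)
qed

lemma continuous_on_potential: "continuous_on S (potential \<psi>)"
  by (rule smooth_imp_continuous_on[OF smooth_potential])

section \<open>Tuning the phases\<close>

text \<open>The potential as far as it is known when the phase \<open>r\<close> of block \<open>i\<close> has to be chosen.\<close>

definition truncated :: "(nat \<Rightarrow> real) \<Rightarrow> nat \<Rightarrow> real \<Rightarrow> real \<Rightarrow> real" where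
  "truncated f i r x = (\<Sum>j<i. block j (f j) x) + block i r x"

definition tuned :: "(nat \<Rightarrow> real) \<Rightarrow> nat \<Rightarrow> real \<Rightarrow> bool" where
  "tuned f i r \<longleftrightarrow> (active i \<longrightarrow> (\<forall>A. amplitude (truncated f i r) (freq i / 2) A \<longrightarrow>
     Im (cnj (phase_axis r) * A (2 * 2 ^ i)) = 0))"

lemma continuous_on_truncated: "continuous_on S (truncated f i r)"
  unfolding truncated_def[abs_def] by (intro continuous_intros continuous_on_block)

lemma truncated_bound: "\<bar>truncated f i r x\<bar> \<le> total_amp"
proof -
  have "truncated f i r x = (\<Sum>j<Suc i. block j ((f(i := r)) j) x)"
    by (simp add: truncated_def)
  then show ?thesis using sum_block_bound[of "{..<Suc i}" "f(i := r)" x] by simp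
qed

text \<open>Let \<open>G r\<close> be the growing component at the right end of the block. The potential is \<open>2 \<pi>\<close>-periodic in
  the phase and \<open>phase_axis\<close> is antiperiodic, so \<open>G (2 \<pi>) = - G 0\<close>, and continuous dependence on \<open>r\<close>
  gives a zero in between.\<close>

lemma tuned_exists: "\<exists>r. tuned f i r"
proof (cases "active i")
  case True
  define \<kappa> where "\<kappa> = freq i / 2"
  define X :: real where "X = 2 * 2 ^ i"
  have \<kappa>: "\<kappa> > 0" using freq_pos[OF True] by (simp add: \<kappa>_def)
  have X: "X \<ge> 0" by (simp add: X_def)
  have "\<exists>A. amplitude (truncated f i r) \<kappa> A" for r
    by (rule amplitude_exists[OF \<kappa> continuous_on_truncated truncated_bound])
  then obtain S where S: "\<And>r. amplitude (truncated f i r) \<kappa> (S r)" by metis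
  define G where "G r = Im (cnj (phase_axis r) * S r X)" for r
  have contS: "isCont (\<lambda>r. S r X) s" for s
  proof -
    obtain M where M: "\<And>x. 0 \<le> x \<Longrightarrow> x \<le> X \<Longrightarrow> norm (S s x) \<le> M"
      using amplitude_bounded_on[OF S] by blast
    define c where "c = sqrt (exp ((2 * (total_amp / \<kappa>) + 1) * X) - 1) * (2 * block_amp i * M / \<kappa>)"
    have "norm (S r X - S s X) \<le> \<bar>r - s\<bar> * c" for r
    proof -
      have "(norm (S r X - S s X))\<^sup>2 \<le> (2 * block_amp i * \<bar>r - s\<bar> * M / \<kappa>)\<^sup>2 * (exp ((2 * (total_amp / \<kappa>) + 1) * X) - 1)"
        by (rule amplitude_perturb[OF \<kappa> S S X truncated_bound _ M])
          (use block_lipschitz in \<open>auto simp: truncated_def\<close>)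
      then have "norm (S r X - S s X) \<le> sqrt ((2 * block_amp i * \<bar>r - s\<bar> * M / \<kappa>)\<^sup>2 * (exp ((2 * (total_amp / \<kappa>) + 1) * X) - 1))"
        by (rule real_le_rsqrt)
      also have "\<dots> = \<bar>2 * block_amp i * \<bar>r - s\<bar> * M / \<kappa>\<bar> * sqrt (exp ((2 * (total_amp / \<kappa>) + 1) * X) - 1)"
        by (simp add: real_sqrt_mult)
      also have "\<bar>2 * block_amp i * \<bar>r - s\<bar> * M / \<kappa>\<bar> = 2 * block_amp i * \<bar>r - s\<bar> * M / \<kappa>"
        using \<kappa> block_amp_nonneg[of i] order.trans[OF norm_ge_zero M[of 0]] X by simp
      finally show ?thesis by (simp add: c_def mult_ac)
    qed
    then have "\<forall>\<^sub>F r in at s. norm (S r X - S s X) \<le> \<bar>r - s\<bar> * c" by simp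
    moreover have "((\<lambda>r. \<bar>r - s\<bar> * c) \<longlongrightarrow> 0) (at s)"
      by (rule tendsto_eq_intros refl)+ simp
    ultimately have "((\<lambda>r. S r X - S s X) \<longlongrightarrow> 0) (at s)"
      by (rule Lim_null_comparison)
    then show ?thesis by (simp add: isCont_def LIM_zero_iff)
  qed
  have contG: "continuous_on T G" for T
    unfolding G_def phase_axis_def cis_cnj
    by (intro continuous_intros continuous_at_imp_continuous_on ballI contS continuous_on_cis) auto
  have anti: "G (2 * pi) = - G 0"
  proof -
    have "truncated f i (2 * pi) = truncated f i 0"
      by (rule ext) (simp add: truncated_def block_def cos_diff)
    then have "S (2 * pi) X = S 0 X"
      using S by (intro amplitude_unique[OF \<kappa> S S X truncated_bound]) simp
    moreover have "phase_axis (2 * pi) = cis pi * phase_axis 0"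
      unfolding phase_axis_def cis_mult by (rule arg_cong[where f = cis]) simp
    ultimately show ?thesis by (simp add: G_def)
  qed
  have "\<exists>r. G r = 0"
  proof (cases "G 0 \<le> 0")
    case True
    then show ?thesis using IVT'[of G 0 0 "2 * pi"] anti contG by auto
  next
    case False
    then show ?thesis using IVT2'[of G "2 * pi" 0 0] anti contG by auto
  qed
  then obtain r where r: "G r = 0" by blast
  have "tuned f i r"
    unfolding tuned_def
  proof (intro impI allI)
    fix A assume "amplitude (truncated f i r) (freq i / 2) A"
    then have "A X = S r X"
      unfolding \<kappa>_def[symmetric] using S by (intro amplitude_unique[OF \<kappa> _ S X truncated_bound]) auto
    with r show "Im (cnj (phase_axis r) * A (2 * 2 ^ i)) = 0" by (simp add: G_def X_def)
  qed
  then show ?thesis ..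
qed (auto simp: tuned_def)

lemma tuned_phases: "\<exists>\<psi>. \<forall>i. tuned \<psi> i (\<psi> i)"
proof (rule dependent_wellorder_choice)
  fix r i and f g :: "nat \<Rightarrow> real"
  assume "\<And>j. j < i \<Longrightarrow> f j = g j"
  then have "truncated f i r = truncated g i r" by (intro ext) (simp add: truncated_def)
  then show "tuned f i r = tuned g i r" by (simp add: tuned_def)
qed (rule tuned_exists)

lemma threshold_le_start: "l \<le> n \<Longrightarrow> threshold l n \<le> start n"
  using member_le_sum[of l "{..n}" "\<lambda>l. threshold l n"] by (simp add: start_def)

text \<open>Control of the \<open>l\<close>-th amplitude on a late block of frequency index \<open>n\<close>: for \<open>n > l\<close> it is built into
  \<open>start n\<close>, and for the finitely many \<open>n \<le> l\<close> it holds from some block on.\<close>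

lemma amplitude_block_growth:
  assumes tuned: "\<And>i. tuned \<psi> i (\<psi> i)" and l: "first_index l"
    and A: "amplitude (potential \<psi>) (theta m l / 2) A"
  shows "\<exists>I. \<forall>i\<ge>I. (\<forall>x\<in>{2 ^ i..2 * 2 ^ i}. norm (A x) \<le> 2 * norm (A (2 ^ i))) \<and>
    (index i = l \<longrightarrow> norm (A (2 * 2 ^ i)) \<le> 2 * exp (- (real i * (bump_mass / (2 * theta m l)))) * norm (A (2 ^ i)))"
proof (intro exI[of _ "start l + (\<Sum>n\<le>l. threshold l n)"] allI impI)
  fix i assume i: "i \<ge> start l + (\<Sum>n\<le>l. threshold l n)"
  have l1: "l \<ge> 1" using l by (simp add: first_index_def)
  then have \<kappa>: "theta m l / 2 > 0" using theta_pos by simp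
  show "(\<forall>x\<in>{2 ^ i..2 * 2 ^ i}. norm (A x) \<le> 2 * norm (A (2 ^ i))) \<and>
    (index i = l \<longrightarrow> norm (A (2 * 2 ^ i)) \<le> 2 * exp (- (real i * (bump_mass / (2 * theta m l)))) * norm (A (2 ^ i)))"
  proof (cases "active i")
    case False
    then have "index i \<noteq> l" using l i by (auto simp: active_def)
    moreover have "norm (A x) \<le> 2 * norm (A (2 ^ i))" if x: "x \<in> {2 ^ i..2 * 2 ^ i}" for x
    proof -
      have "norm (A x - A (2 ^ i)) \<le> 0 * \<bar>x - 2 ^ i\<bar>"
      proof (rule vector_derivative_bound[OF amplitude_within[OF A]])
        show "norm (amplitude_rhs (potential \<psi>) (theta m l / 2) y (A y)) \<le> 0" if "y \<in> {2 ^ i..2 * 2 ^ i}" for y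
          using potential_on_block[OF that, of \<psi>] False by (simp add: amplitude_rhs_def block_def)
      qed (use x in auto)
      then have "A x = A (2 ^ i)" by simp
      then show ?thesis by simp
    qed
    ultimately show ?thesis by simp
  next
    case True
    define n where "n = index i"
    have n: "first_index n" "start n \<le> i" using True by (auto simp: active_def n_def)
    then have n1: "n \<ge> 1" by (simp add: first_index_def)
    have "threshold l n \<le> i"
    proof (cases "n \<le> l")
      case True
      then have "threshold l n \<le> (\<Sum>n\<le>l. threshold l n)"
        by (intro member_le_sum[of n "{..l}" "\<lambda>n. threshold l n"]) auto
      then show ?thesis using i by simp
    next
      case False
      then show ?thesis using threshold_le_start[of l n] n by simp
    qed
    then have good: "good l n i" using threshold[OF l1 n1] by simp
    have V: "\<forall>x\<in>{2 ^ i..2 * 2 ^ i}. potential \<psi> x = block_amp i * bump (x / 2 ^ i) * cos (theta m n * x + \<psi> i)"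
    proof
      fix x :: real assume x: "x \<in> {2 ^ i..2 * 2 ^ i}"
      have "0 \<le> (2::real) ^ i" by simp
      also have "2 ^ i \<le> x" using x by simp
      finally have "x \<ge> 0" .
      with x True show "potential \<psi> x = block_amp i * bump (x / 2 ^ i) * cos (theta m n * x + \<psi> i)"
        by (simp add: potential_on_block block_eq n_def)
    qed
    have tn: "theta m n = theta m l \<longrightarrow> Im (cnj (phase_axis (\<psi> i)) * A (2 * 2 ^ i)) = 0"
    proof
      assume eq: "theta m n = theta m l"
      obtain B where B: "amplitude (truncated \<psi> i (\<psi> i)) (theta m l / 2) B"
        using amplitude_exists[OF \<kappa> continuous_on_truncated truncated_bound] by blast
      have "Im (cnj (phase_axis (\<psi> i)) * B (2 * 2 ^ i)) = 0"
        using tuned[of i] True B eq by (auto simp: tuned_def n_def)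
      moreover have "A (2 * 2 ^ i) = B (2 * 2 ^ i)"
      proof (rule amplitude_unique[OF \<kappa> A B _ potential_bound])
        fix x :: real assume "0 \<le> x" "x \<le> 2 * 2 ^ i"
        then show "potential \<psi> x = truncated \<psi> i (\<psi> i) x"
          using potential_truncate[of x "Suc i" \<psi>] by (simp add: truncated_def)
      qed simp
      ultimately show "Im (cnj (phase_axis (\<psi> i)) * A (2 * 2 ^ i)) = 0" by simp
    qed
    from good[unfolded good_def, THEN spec, THEN spec, THEN spec, THEN mp, THEN mp, THEN mp, OF A V tn]
    show ?thesis by (simp add: n_def)
  qed
qed

lemma amplitude_decay:
  assumes tuned: "\<And>i. tuned \<psi> i (\<psi> i)" and l: "first_index l"
    and A: "amplitude (potential \<psi>) (theta m l / 2) A"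
  shows "\<exists>D. \<forall>x\<ge>0. (1 + x\<^sup>2) * (norm (A x))\<^sup>2 \<le> D"
proof -
  from amplitude_block_growth[OF tuned l A] obtain I where "\<forall>i\<ge>I.
    (\<forall>x\<in>{2 ^ i..2 * 2 ^ i}. norm (A x) \<le> 2 * norm (A (2 ^ i))) \<and>
    (index i = l \<longrightarrow> norm (A (2 * 2 ^ i)) \<le> 2 * exp (- (real i * (bump_mass / (2 * theta m l)))) * norm (A (2 ^ i)))" ..
  then have I: "\<And>i x. i \<ge> I \<Longrightarrow> x \<in> {2 ^ i..2 * 2 ^ i} \<Longrightarrow> norm (A x) \<le> 2 * norm (A (2 ^ i))"
    "\<And>i. i \<ge> I \<Longrightarrow> index i = l \<Longrightarrow>
      norm (A (2 * 2 ^ i)) \<le> 2 * exp (- (real i * (bump_mass / (2 * theta m l)))) * norm (A (2 ^ i))"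
    by simp_all
  obtain P where P: "P > 0" "\<And>i. \<exists>j\<in>{i..<i + P}. index j = l"
    using multiplicity_two_recurs[of l] unfolding index_def by blast
  have c: "bump_mass / (2 * theta m l) > 0"
    using bump_mass_pos theta_pos[of l] l by (simp add: first_index_def)
  have "\<exists>C\<ge>0. \<forall>i. norm (A (2 ^ i)) \<le> C / 2 ^ i"
    by (rule recurrent_decay[where I = I and P = P, OF _ _ _ c P]) (use I in auto)
  then obtain C where C: "C \<ge> 0" "\<And>i. norm (A (2 ^ i)) \<le> C / 2 ^ i" by blast
  obtain M where M: "\<And>x. 0 \<le> x \<Longrightarrow> x \<le> 2 ^ I \<Longrightarrow> norm (A x) \<le> M"
    using amplitude_bounded_on[OF A] by blast
  have "(1 + x\<^sup>2) * (norm (A x))\<^sup>2 \<le> max ((1 + (2 ^ I)\<^sup>2) * M\<^sup>2) (32 * C\<^sup>2)" if x: "x \<ge> 0" for x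
  proof (cases "x \<le> 2 ^ I")
    case True
    then have "(1 + x\<^sup>2) * (norm (A x))\<^sup>2 \<le> (1 + (2 ^ I)\<^sup>2) * M\<^sup>2"
      using x by (intro mult_mono add_mono power_mono M) auto
    then show ?thesis by simp
  next
    case False
    have "1 \<le> (2::real) ^ I" by simp
    with False have "x > 1" by linarith
    define i where "i = nat \<lfloor>log 2 x\<rfloor>"
    have fl: "\<lfloor>log 2 x\<rfloor> \<ge> int I"
    proof -
      have "log 2 (2 ^ I) \<le> log 2 x" using False \<open>x > 1\<close> by (subst log_le_cancel_iff) auto
      then show ?thesis by (simp add: le_floor_iff)
    qed
    have i: "i \<ge> I" "real i \<le> log 2 x" "log 2 x < real i + 1"
      using fl by (auto simp: i_def) linarith+
    have lo: "2 ^ i \<le> x" using i(2) \<open>x > 1\<close> by (simp add: le_log_iff powr_realpow)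
    have hi: "x \<le> 2 * 2 ^ i"
      using i(3) \<open>x > 1\<close> by (simp add: log_less_iff powr_add powr_realpow)
    have "norm (A x) \<le> 2 * norm (A (2 ^ i))" using I(1)[OF i(1)] lo hi by simp
    also have "\<dots> \<le> 2 * (C / 2 ^ i)" using C(2)[of i] by simp
    also have "\<dots> \<le> 4 * C / x"
    proof -
      have "C * x \<le> C * (2 * 2 ^ i)" using hi C(1) by (rule mult_left_mono)
      then show ?thesis using \<open>x > 1\<close> by (simp add: field_simps)
    qed
    finally have "(norm (A x))\<^sup>2 \<le> (4 * C / x)\<^sup>2" by (intro power_mono) auto
    then have "(1 + x\<^sup>2) * (norm (A x))\<^sup>2 \<le> (2 * x\<^sup>2) * (4 * C / x)\<^sup>2"
      using \<open>x > 1\<close> by (intro mult_mono) (auto simp: one_le_power)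
    also have "\<dots> = 32 * C\<^sup>2" using \<open>x > 1\<close> by (simp add: power2_eq_square)
    finally show ?thesis by simp
  qed
  then show ?thesis by blast
qed

lemma eigenvalue:
  assumes tuned: "\<And>i. tuned \<psi> i (\<psi> i)" and n: "n \<ge> 1"
  shows "complex_of_real ((real (m n))\<^sup>2 / (4 * (real n)\<^sup>2)) \<in> point_spectrum (schroedinger (potential \<psi>))"
proof -
  obtain l where l: "first_index l" "theta m l = theta m n"
    using first_index_exists[OF n] by blast
  have \<kappa>: "theta m l / 2 > 0" using theta_pos[OF n] l by simp
  obtain A where A: "amplitude (potential \<psi>) (theta m l / 2) A"
    using amplitude_exists[OF \<kappa> continuous_on_potential potential_bound] by blast
  obtain D where "\<And>x. x \<ge> 0 \<Longrightarrow> (1 + x\<^sup>2) * (norm (A x))\<^sup>2 \<le> D"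
    using amplitude_decay[OF tuned l(1) A] by blast
  from decaying_amplitude_eigenvalue[OF \<kappa> continuous_on_potential potential_even potential_bound A this]
  have "complex_of_real ((theta m l / 2)\<^sup>2) \<in> point_spectrum (schroedinger (potential \<psi>))" .
  moreover have "(theta m l / 2)\<^sup>2 = (real (m n))\<^sup>2 / (4 * (real n)\<^sup>2)"
    unfolding l(2) by (simp add: theta_def power_divide power_mult_distrib)
  ultimately show ?thesis by simp
qed

end


section \<open>The amplitudes as symbols\<close>

lemma japanese_ge_1: "1 \<le> japanese x"
  by (simp add: japanese_def)

lemma japanese_le: "japanese x \<le> 1 + \<bar>x\<bar>"
  unfolding japanese_def by (rule real_le_lsqrt) (auto simp: power2_sum)

lemma powr_neg_antimono:
  fixes a b :: real
  assumes "1 \<le> a" "a \<le> b"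
  shows "b powr - real N \<le> a powr - real N"
  using assms by (intro powr_mono2') auto

text \<open>On the support of the rescaled bump, \<open>\<bar>x\<bar>\<close> is at most \<open>2 \<cdot> 2\<^sup>i\<close>, so each factor \<open>2\<^sup>-\<^sup>i\<close> produced by
  differentiation is worth a factor \<open>3 / \<langle>x\<rangle>\<close>.\<close>

lemma scaled_bump_symbol:
  assumes B: "\<And>y. \<bar>(vderiv ^^ k) bump y\<bar> \<le> B" and s: "\<bar>s\<bar> = 1 / 2 ^ i"
  shows "\<bar>s ^ k * (vderiv ^^ k) bump (s * x)\<bar> \<le> B * 3 ^ k * japanese x powr - real k"
proof (cases "(vderiv ^^ k) bump (s * x) = 0")
  case True
  have "0 \<le> B" using B[of 0] by linarith
  with True show ?thesis by simp
next
  case False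
  then have "s * x \<le> 2" "1 \<le> s * x"
    using vderiv_bump_eq_0[of "s * x" k] by force+
  then have "\<bar>s\<bar> * \<bar>x\<bar> \<le> 2" by (simp flip: abs_mult)
  then have "\<bar>x\<bar> \<le> 2 * 2 ^ i" by (simp add: s field_simps)
  moreover have "1 \<le> (2::real) ^ i" by simp
  ultimately have "japanese x \<le> 3 * 2 ^ i" using japanese_le[of x] by linarith
  then have "japanese x ^ k \<le> (3 * 2 ^ i) ^ k"
    using japanese_ge_1[of x] by (intro power_mono) auto
  then have "(1 / 2 ^ i) ^ k \<le> 3 ^ k / japanese x ^ k"
    using japanese_ge_1[of x] by (simp add: power_mult_distrib field_simps)
  also have "\<dots> = 3 ^ k * japanese x powr - real k"
    using japanese_ge_1[of x] by (simp add: powr_minus powr_realpow divide_inverse)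
  finally have "\<bar>s\<bar> ^ k * \<bar>(vderiv ^^ k) bump (s * x)\<bar> \<le> (3 ^ k * japanese x powr - real k) * B"
    using B[of "s * x"] unfolding s by (intro mult_mono) auto
  then show ?thesis by (simp add: abs_mult power_abs mult_ac)
qed

context block_construction
begin

text \<open>The cosine of block \<open>i\<close> is split into its exponentials of frequency \<open>freq i\<close> and \<open>- freq i\<close>; the mirror
  image on the negative axis has the conjugate coefficients.\<close>

definition coefficient :: "(nat \<Rightarrow> real) \<Rightarrow> real \<Rightarrow> nat \<Rightarrow> complex" where
  "coefficient \<psi> \<theta> i = (if active i then
     if \<theta> = freq i then cis (\<psi> i) else if \<theta> = - freq i then cis (- \<psi> i) else 0 else 0)"

definition profile :: "(nat \<Rightarrow> real) \<Rightarrow> real \<Rightarrow> nat \<Rightarrow> real \<Rightarrow> complex" where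
  "profile \<psi> \<theta> i x =
     bump (1 / 2 ^ i * x) *\<^sub>R (of_real (block_amp i / 2) * coefficient \<psi> \<theta> i) +
     bump (- (1 / 2 ^ i) * x) *\<^sub>R (of_real (block_amp i / 2) * cnj (coefficient \<psi> \<theta> i))"

definition symbol :: "(nat \<Rightarrow> real) \<Rightarrow> real \<Rightarrow> real \<Rightarrow> complex" where
  "symbol \<psi> \<theta> x = (\<Sum>i\<le>nat \<lceil>\<bar>x\<bar>\<rceil>. profile \<psi> \<theta> i x)"

lemma norm_coefficient: "norm (coefficient \<psi> \<theta> i) \<le> 1"
  by (simp add: coefficient_def)

lemma profile_eq_0:
  assumes "\<bar>x\<bar> \<le> 2 ^ i"
  shows "profile \<psi> \<theta> i x = 0"
proof -
  have "bump (1 / 2 ^ i * x) = 0" "bump (- (1 / 2 ^ i) * x) = 0"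
    using assms by (auto intro!: bump_eq_0 simp: abs_if field_simps split: if_splits)
  then show ?thesis by (simp add: profile_def)
qed

lemma symbol_truncate:
  assumes "\<bar>x\<bar> \<le> 2 ^ N"
  shows "symbol \<psi> \<theta> x = (\<Sum>i<N. profile \<psi> \<theta> i x)"
proof -
  let ?J = "{i. 2 ^ i < \<bar>x\<bar>}"
  have J: "i < N" if "2 ^ i < \<bar>x\<bar>" for i
  proof -
    have "(2::real) ^ i < 2 ^ N" using that assms by linarith
    then show ?thesis by simp
  qed
  have "symbol \<psi> \<theta> x = (\<Sum>i\<in>?J. profile \<psi> \<theta> i x)"
    unfolding symbol_def
    by (rule sum.mono_neutral_right) (auto simp: locally_finite_index not_less intro!: profile_eq_0)
  also have "\<dots> = (\<Sum>i<N. profile \<psi> \<theta> i x)"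
    by (rule sum.mono_neutral_left) (auto simp: J not_less intro!: profile_eq_0)
  finally show ?thesis .
qed

lemma smooth_profile: "smooth (profile \<psi> \<theta> i)"
  unfolding profile_def[abs_def] smooth_iff_ck
  by (intro allI ck_add smooth_scale[OF smooth_bump, unfolded smooth_iff_ck, rule_format])

lemma symbol_local:
  fixes x :: real
  obtains N where "x \<in> {- (2 ^ N)<..<2 ^ N}"
    "\<And>y. y \<in> {- (2 ^ N)<..<2 ^ N} \<Longrightarrow> symbol \<psi> \<theta> y = (\<Sum>i<N. profile \<psi> \<theta> i y)"
proof
  let ?N = "nat \<lceil>\<bar>x\<bar>\<rceil>"
  have "\<bar>x\<bar> \<le> real ?N" by simp
  also have "real ?N < 2 ^ ?N" by (metis of_nat_less_two_power)
  finally show "x \<in> {- (2 ^ ?N)<..<2 ^ ?N}" by auto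
  show "symbol \<psi> \<theta> y = (\<Sum>i<?N. profile \<psi> \<theta> i y)" if "y \<in> {- (2 ^ ?N)<..<2 ^ ?N}" for y
    using that by (intro symbol_truncate) auto
qed

lemma smooth_symbol: "smooth (symbol \<psi> \<theta>)"
proof (rule smooth_local)
  fix x :: real
  obtain N where N: "x \<in> {- (2 ^ N)<..<2 ^ N}"
    "\<And>y. y \<in> {- (2 ^ N)<..<2 ^ N} \<Longrightarrow> symbol \<psi> \<theta> y = (\<Sum>i<N. profile \<psi> \<theta> i y)"
    using symbol_local by blast
  then show "\<exists>S g. open S \<and> x \<in> S \<and> (\<forall>y\<in>S. symbol \<psi> \<theta> y = g y) \<and> smooth g"
    by (intro exI[of _ "{- (2 ^ N)<..<2 ^ N}"] exI[of _ "\<lambda>y. \<Sum>i<N. profile \<psi> \<theta> i y"])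
      (auto intro: smooth_sum smooth_profile)
qed

lemma norm_vderiv_profile:
  assumes B: "\<And>y. \<bar>(vderiv ^^ k) bump y\<bar> \<le> B"
  shows "norm ((vderiv ^^ k) (profile \<psi> \<theta> i) x)
    \<le> (if coefficient \<psi> \<theta> i = 0 then 0 else block_amp i) * (B * 3 ^ k * japanese x powr - real k)"
proof -
  define c where "c = of_real (block_amp i / 2) * coefficient \<psi> \<theta> i"
  define b where "b = B * 3 ^ k * japanese x powr - real k"
  have c': "of_real (block_amp i / 2) * cnj (coefficient \<psi> \<theta> i) = cnj c" by (simp add: c_def)
  have "(vderiv ^^ k) (profile \<psi> \<theta> i) x =
      ((1 / 2 ^ i) ^ k * (vderiv ^^ k) bump (1 / 2 ^ i * x)) *\<^sub>R c +
      ((- (1 / 2 ^ i)) ^ k * (vderiv ^^ k) bump (- (1 / 2 ^ i) * x)) *\<^sub>R cnj c"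
    unfolding profile_def[abs_def] c' c_def[symmetric]
    by (simp only: vderiv_funpow_add[OF smooth_scale[OF smooth_bump] smooth_scale[OF smooth_bump]]
        vderiv_funpow_scale[OF smooth_bump])
  also have "norm \<dots> \<le> b * norm c + b * norm (cnj c)"
    unfolding b_def
    by (intro order.trans[OF norm_triangle_ineq] add_mono; unfold norm_scaleR)
      (intro mult_right_mono scaled_bump_symbol[where i = i] B; simp)+
  also have "\<dots> = block_amp i * norm (coefficient \<psi> \<theta> i) * b"
    using block_amp_nonneg[of i] by (simp add: c_def norm_mult)
  also have "\<dots> \<le> (if coefficient \<psi> \<theta> i = 0 then 0 else block_amp i) * b"
  proof (rule mult_right_mono)
    show "block_amp i * norm (coefficient \<psi> \<theta> i) \<le> (if coefficient \<psi> \<theta> i = 0 then 0 else block_amp i)"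
      using mult_left_mono[OF norm_coefficient block_amp_nonneg, of i \<psi> \<theta> i] by simp
    have "0 \<le> B" using B[of 0] by linarith
    then show "0 \<le> b" by (simp add: b_def)
  qed
  finally show ?thesis by (simp add: b_def)
qed

text \<open>If all blocks of frequency \<open>\<plusminus>\<theta>\<close> start at \<open>J\<close> or later, their heights \<open>i / 2\<^sup>i\<close> are bounded by
  \<open>(1 + J)\<^sup>-\<^sup>N\<close> times a geometric sequence.\<close>

lemma symbol_bound:
  "\<exists>C>0. \<forall>\<theta> J x. (\<forall>i. coefficient \<psi> \<theta> i \<noteq> 0 \<longrightarrow> J \<le> i) \<longrightarrow>
     norm ((vderiv ^^ k) (symbol \<psi> \<theta>) x) \<le> C * japanese x powr - real k * (1 + real J) powr - real N"
proof -
  obtain B where B: "B \<ge> 0" "\<And>y. \<bar>(vderiv ^^ k) bump y\<bar> \<le> B"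
    using vderiv_bump_bounded by blast
  obtain D where D: "D > 0" "\<And>i. block_amp i * (1 + real i) ^ N \<le> D * (3 / 4) ^ i"
    using block_amp_decay by blast
  define C where "C = 4 * D * ((B + 1) * 3 ^ k)"
  have C0: "C > 0" using B D by (simp add: C_def)
  show ?thesis
  proof (intro exI[of _ C] conjI C0 allI impI)
    fix \<theta> x and J :: nat assume J: "\<forall>i. coefficient \<psi> \<theta> i \<noteq> 0 \<longrightarrow> J \<le> i"
    define b where "b = B * 3 ^ k * japanese x powr - real k"
    have b0: "b \<ge> 0" using B by (simp add: b_def)
    obtain M where M: "x \<in> {- (2 ^ M)<..<2 ^ M}"
      "\<And>y. y \<in> {- (2 ^ M)<..<2 ^ M} \<Longrightarrow> symbol \<psi> \<theta> y = (\<Sum>i<M. profile \<psi> \<theta> i y)"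
      using symbol_local by blast
    have "(vderiv ^^ k) (symbol \<psi> \<theta>) x = (vderiv ^^ k) (\<lambda>y. \<Sum>i<M. profile \<psi> \<theta> i y) x"
      by (rule vderiv_funpow_cong_open[OF _ M(2) M(1)]) auto
    also have "\<dots> = (\<Sum>i<M. (vderiv ^^ k) (profile \<psi> \<theta> i) x)"
      by (subst vderiv_funpow_sum) (auto intro: smooth_profile)
    also have "norm \<dots> \<le> (\<Sum>i<M. (if coefficient \<psi> \<theta> i = 0 then 0 else block_amp i) * b)"
      unfolding b_def by (intro order.trans[OF norm_sum] sum_mono norm_vderiv_profile B)
    also have "\<dots> \<le> (\<Sum>i<M. D * (1 + real J) powr - real N * (3 / 4) ^ i * b)"
    proof (rule sum_mono)
      fix i
      have p: "(1 + real J) powr - real N = 1 / (1 + real J) ^ N"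
        by (simp add: powr_minus powr_realpow inverse_eq_divide)
      have "(if coefficient \<psi> \<theta> i = 0 then 0 else block_amp i) \<le> D * (1 + real J) powr - real N * (3 / 4) ^ i"
      proof (cases "coefficient \<psi> \<theta> i = 0")
        case False
        then have "J \<le> i" using J by blast
        then have "block_amp i * (1 + real J) ^ N \<le> block_amp i * (1 + real i) ^ N"
          by (intro mult_left_mono power_mono block_amp_nonneg) auto
        also note D(2)[of i]
        finally have "block_amp i \<le> D * (3 / 4) ^ i / (1 + real J) ^ N"
          by (subst pos_le_divide_eq) auto
        with False show ?thesis by (simp add: p)
      qed (use D in simp)
      then show "(if coefficient \<psi> \<theta> i = 0 then 0 else block_amp i) * b \<le> D * (1 + real J) powr - real N * (3 / 4) ^ i * b"
        using b0 by (rule mult_right_mono)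
    qed
    also have "\<dots> = D * (1 + real J) powr - real N * b * (\<Sum>i<M. (3 / 4) ^ i)"
      by (simp add: sum_distrib_left mult_ac)
    also have "\<dots> \<le> D * (1 + real J) powr - real N * b * 4"
    proof (rule mult_left_mono)
      have "(\<Sum>i<M. (3 / 4 :: real) ^ i) \<le> (\<Sum>i. (3 / 4) ^ i)"
        by (intro sum_le_suminf summable_geometric) auto
      then show "(\<Sum>i<M. (3 / 4 :: real) ^ i) \<le> 4" by (simp add: suminf_geometric)
    qed (use D b0 in simp)
    also have "\<dots> \<le> C * japanese x powr - real k * (1 + real J) powr - real N"
    proof -
      have "b \<le> (B + 1) * 3 ^ k * japanese x powr - real k"
        unfolding b_def using B by (intro mult_right_mono) auto
      then have "4 * D * (1 + real J) powr - real N * b \<le> 4 * D * (1 + real J) powr - real N * ((B + 1) * 3 ^ k * japanese x powr - real k)"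
        using D by (intro mult_left_mono) auto
      then show ?thesis by (simp add: C_def mult_ac)
    qed
    finally show "norm ((vderiv ^^ k) (symbol \<psi> \<theta>) x) \<le> C * japanese x powr - real k * (1 + real J) powr - real N" .
  qed
qed

lemma coefficient_start:
  assumes l: "first_index l" and \<theta>: "\<bar>\<theta>\<bar> = theta m l" and c: "coefficient \<psi> \<theta> i \<noteq> 0"
  shows "start l \<le> i"
proof -
  have "active i" "\<theta> = freq i \<or> \<theta> = - freq i"
    using c by (auto simp: coefficient_def split: if_splits)
  with \<theta> have "freq i = theta m l" using freq_pos[of i] by auto
  with \<open>active i\<close> l first_index_inject[of "index i" l] show ?thesis
    by (auto simp: active_def)
qed

lemma Theta_cases:
  assumes "\<theta> \<in> Theta m"
  obtains "\<theta> = 0" | l where "first_index l" "\<bar>\<theta>\<bar> = theta m l"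
proof (cases "\<theta> = 0")
  case False
  with assms obtain n where n: "n \<ge> 1" "\<theta> = theta m n \<or> \<theta> = - theta m n"
    by (auto simp: Theta_def Theta_pos_def)
  then have "\<bar>\<theta>\<bar> = theta m n" using theta_pos[of n] by auto
  with first_index_exists[OF n(1)] show ?thesis by (metis that(2))
qed (use that in blast)

lemma symbol_theta_bound:
  "\<exists>C>0. (\<forall>\<theta>\<in>Theta m. \<forall>x. norm ((vderiv ^^ k) (symbol \<psi> \<theta>) x)
        \<le> C * japanese x powr - real k * japanese \<theta> powr - real N) \<and>
     (\<forall>n. decay_index m n \<longrightarrow> (\<forall>x. norm ((vderiv ^^ k) (symbol \<psi> (theta m n)) x)
        \<le> C * japanese x powr - real k * japanese (real n) powr - real N))"
proof -
  obtain C where C: "C > 0" "\<And>\<theta> J x. (\<forall>i. coefficient \<psi> \<theta> i \<noteq> 0 \<longrightarrow> J \<le> i) \<Longrightarrow>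
     norm ((vderiv ^^ k) (symbol \<psi> \<theta>) x) \<le> C * japanese x powr - real k * (1 + real J) powr - real N"
    using symbol_bound[of \<psi> k N] by blast
  have weaken: "norm ((vderiv ^^ k) (symbol \<psi> \<theta>) x) \<le> C * japanese x powr - real k * japanese y powr - real N"
    if J: "\<forall>i. coefficient \<psi> \<theta> i \<noteq> 0 \<longrightarrow> J \<le> i" and y: "\<bar>y\<bar> \<le> real J" for \<theta> x y and J :: nat
  proof -
    have "(1 + real J) powr - real N \<le> japanese y powr - real N"
      using japanese_ge_1[of y] japanese_le[of y] y by (intro powr_neg_antimono) auto
    then have "C * japanese x powr - real k * (1 + real J) powr - real N \<le> C * japanese x powr - real k * japanese y powr - real N"
      using C(1) by (intro mult_left_mono) auto
    with C(2)[OF J, of x] show ?thesis by linarith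
  qed
  show ?thesis
  proof (intro exI[of _ C] conjI C(1) ballI allI impI)
    fix \<theta> x assume "\<theta> \<in> Theta m"
    then show "norm ((vderiv ^^ k) (symbol \<psi> \<theta>) x) \<le> C * japanese x powr - real k * japanese \<theta> powr - real N"
    proof (cases rule: Theta_cases)
      case 1
      show ?thesis by (rule weaken[of _ 0]) (use 1 in auto)
    next
      case (2 l)
      show ?thesis
      proof (rule weaken[of _ "start l"])
        show "\<forall>i. coefficient \<psi> \<theta> i \<noteq> 0 \<longrightarrow> start l \<le> i" using coefficient_start[OF 2] by blast
        have "nat \<lceil>theta m l\<rceil> \<le> start l"
          unfolding start_def by (intro trans_le_add1 le_add2)
        then show "\<bar>\<theta>\<bar> \<le> real (start l)" using 2 by linarith
      qed
    qed
  next
    fix n x assume n: "decay_index m n"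
    then have n1: "n \<ge> 1" by (simp add: decay_index_def)
    obtain l where l: "first_index l" "theta m l = theta m n" using first_index_exists[OF n1] by blast
    have "n \<le> start l"
    proof (cases "finite (same_theta l)")
      case True
      have "n \<in> same_theta l" using n1 l by (simp add: same_theta_def)
      then have "n \<le> \<Sum>(same_theta l)" using True by (intro member_le_sum[where f = "\<lambda>x. x"]) auto
      then show ?thesis using True by (simp add: start_def)
    next
      case False
      then have "first_index n"
        using n l(2) by (auto simp: decay_index_def same_theta_def first_index_def)
      then have "n = l" using first_index_inject l by blast
      then show ?thesis by (simp add: start_def)
    qed
    moreover have "\<bar>theta m n\<bar> = theta m l" using theta_pos[OF n1] l by simp
    ultimately show "norm ((vderiv ^^ k) (symbol \<psi> (theta m n)) x) \<le> C * japanese x powr - real k * japanese (real n) powr - real N"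
      using coefficient_start[OF l(1)] by (intro weaken[of _ "start l"]) auto
  qed
qed

lemma profile_has_sum:
  "((\<lambda>\<theta>. exp (\<i> * complex_of_real (\<theta> * x)) * profile \<psi> \<theta> i x) has_sum complex_of_real (block i (\<psi> i) x)) (Theta m)"
proof (cases "active i")
  case True
  let ?f = "freq i"
  have f: "?f > 0" by (rule freq_pos[OF True])
  have sub: "{?f, - ?f} \<subseteq> Theta m"
    using True by (auto simp: active_def first_index_def Theta_def Theta_pos_def)
  show ?thesis
  proof (rule has_sum_finite_neutralI[OF _ sub])
    show "exp (\<i> * complex_of_real (\<theta> * x)) * profile \<psi> \<theta> i x = 0" if "\<theta> \<in> Theta m - {?f, - ?f}" for \<theta>
      using that by (simp add: profile_def coefficient_def)
    define a where "a = bump (x / 2 ^ i)"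
    define b where "b = bump (- x / 2 ^ i)"
    have e: "exp (\<i> * complex_of_real t) = cis t" for t by (simp add: cis_conv_exp)
    have p1: "profile \<psi> ?f i x = of_real (block_amp i / 2) * (of_real a * cis (\<psi> i) + of_real b * cis (- \<psi> i))"
      using True by (simp add: profile_def coefficient_def a_def b_def scaleR_conv_of_real cis_cnj algebra_simps)
    have p2: "profile \<psi> (- ?f) i x = of_real (block_amp i / 2) * (of_real a * cis (- \<psi> i) + of_real b * cis (\<psi> i))"
      using True f by (simp add: profile_def coefficient_def a_def b_def scaleR_conv_of_real cis_cnj algebra_simps)
    have "(\<Sum>\<theta>\<in>{?f, - ?f}. exp (\<i> * complex_of_real (\<theta> * x)) * profile \<psi> \<theta> i x)
        = cis (?f * x) * profile \<psi> ?f i x + cis (- (?f * x)) * profile \<psi> (- ?f) i x"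
      using f unfolding e by simp
    also have "\<dots> = of_real (block_amp i / 2) *
        (of_real a * (cis (?f * x) * cis (\<psi> i) + cis (- (?f * x)) * cis (- \<psi> i)) +
         of_real b * (cis (?f * x) * cis (- \<psi> i) + cis (- (?f * x)) * cis (\<psi> i)))"
      unfolding p1 p2 by (simp add: algebra_simps)
    also have "cis (?f * x) * cis (\<psi> i) + cis (- (?f * x)) * cis (- \<psi> i) = 2 * of_real (cos (?f * x + \<psi> i))"
      using cis_add_cis_uminus[of "?f * x + \<psi> i"] by (simp add: cis_mult)
    also have "cis (?f * x) * cis (- \<psi> i) + cis (- (?f * x)) * cis (\<psi> i) = 2 * of_real (cos (?f * x - \<psi> i))"
      using cis_add_cis_uminus[of "?f * x - \<psi> i"] by (simp add: cis_mult)
    also have "of_real (block_amp i / 2) * (of_real a * (2 * of_real (cos (?f * x + \<psi> i))) + of_real b * (2 * of_real (cos (?f * x - \<psi> i))))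
        = complex_of_real (block i (\<psi> i) x)"
      using True by (simp add: block_def a_def b_def algebra_simps)
    finally show "complex_of_real (block i (\<psi> i) x) = (\<Sum>\<theta>\<in>{?f, - ?f}. exp (\<i> * complex_of_real (\<theta> * x)) * profile \<psi> \<theta> i x)" ..
  qed simp
next
  case False
  then show ?thesis by (simp add: profile_def coefficient_def block_def)
qed

lemma has_sum_finite_sum:
  fixes f :: "'i \<Rightarrow> 'b \<Rightarrow> 'c::topological_comm_monoid_add"
  shows "(\<And>i. i \<in> I \<Longrightarrow> (f i has_sum g i) A) \<Longrightarrow> ((\<lambda>x. \<Sum>i\<in>I. f i x) has_sum (\<Sum>i\<in>I. g i)) A"
  by (induction I rule: infinite_finite_induct) (auto intro: has_sum_add)

lemma symbol_has_sum:
  "((\<lambda>\<theta>. exp (\<i> * complex_of_real (\<theta> * x)) * symbol \<psi> \<theta> x) has_sum complex_of_real (potential \<psi> x)) (Theta m)"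
  unfolding symbol_def potential_def of_real_sum sum_distrib_left
  by (intro has_sum_finite_sum profile_has_sum)

text \<open>If every positive rational \<open>q\<close> is a frequency, then every \<open>q\<^sup>2 / 4\<close> is an eigenvalue, and such numbers
  approximate \<open>y \<ge> 0\<close> as \<open>q\<close> approaches \<open>2 \<surd>y\<close>.\<close>

lemma dense_eigenvalues:
  assumes tuned: "\<And>i. tuned \<psi> i (\<psi> i)" and rats: "\<rat> \<inter> {0<..} = Theta_pos m"
  shows "dense_pure_point_spectrum (schroedinger (potential \<psi>))"
  unfolding dense_pure_point_spectrum_def
proof (rule image_subsetI)
  fix y :: real assume y: "y \<in> {0..}"
  show "complex_of_real y \<in> closure (point_spectrum (schroedinger (potential \<psi>)))"
  proof (subst closure_approachable, intro allI impI)
    fix e :: real assume e: "e > 0"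
    have "isCont (\<lambda>t. t\<^sup>2 / 4) (2 * sqrt y)" by (intro continuous_intros) auto
    then obtain d where d: "d > 0" "\<And>t. \<bar>t - 2 * sqrt y\<bar> < d \<Longrightarrow> \<bar>t\<^sup>2 / 4 - (2 * sqrt y)\<^sup>2 / 4\<bar> < e"
      using e unfolding continuous_at_eps_delta dist_real_def by blast
    obtain q where q: "q \<in> \<rat>" "2 * sqrt y < q" "q < 2 * sqrt y + d"
      using Rats_dense_in_real[of "2 * sqrt y" "2 * sqrt y + d"] d(1) by auto
    have "0 \<le> 2 * sqrt y" using y by simp
    with q have "q > 0" by linarith
    with q(1) rats have "q \<in> Theta_pos m" by blast
    then obtain n where n: "n \<ge> 1" "q = theta m n" by (auto simp: Theta_pos_def)
    have "(real (m n))\<^sup>2 / (4 * (real n)\<^sup>2) = q\<^sup>2 / 4"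
      by (simp add: n(2) theta_def power_divide)
    with eigenvalue[OF tuned n(1)] have "complex_of_real (q\<^sup>2 / 4) \<in> point_spectrum (schroedinger (potential \<psi>))"
      by (simp only:)
    moreover have "\<bar>q\<^sup>2 / 4 - y\<bar> < e" using d(2)[of q] q y by (simp add: power_mult_distrib)
    then have "dist (complex_of_real (q\<^sup>2 / 4)) (complex_of_real y) < e"
      unfolding dist_norm of_real_diff[symmetric] norm_of_real .
    ultimately show "\<exists>z\<in>point_spectrum (schroedinger (potential \<psi>)). dist z (complex_of_real y) < e" by blast
  qed
qed

end

theorem theoremB2:
  fixes m :: "nat \<Rightarrow> nat"
  assumes "\<And>n. n \<ge> 1 \<Longrightarrow> m n > 0"
  shows "\<exists>(W :: real \<Rightarrow> real) (w :: real \<Rightarrow> real \<Rightarrow> complex).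
    smooth W \<and>
    (\<forall>\<theta>\<in>Theta m. smooth (w \<theta>)) \<and>
    (\<forall>x. ((\<lambda>\<theta>. exp (\<i> * complex_of_real (\<theta> * x)) * w \<theta> x)
            has_sum complex_of_real (W x)) (Theta m)) \<and>
    (\<forall>k N :: nat. \<exists>C > 0.
       (\<forall>\<theta>\<in>Theta m. \<forall>x. norm ((vderiv ^^ k) (w \<theta>) x)
          \<le> C * japanese x powr (- real k) * japanese \<theta> powr (- real N)) \<and>
       (\<forall>n. decay_index m n \<longrightarrow> (\<forall>x. norm ((vderiv ^^ k) (w (theta m n)) x)
          \<le> C * japanese x powr (- real k) * japanese (real n) powr (- real N)))) \<and>
    (\<forall>n\<ge>1. complex_of_real ((real (m n))\<^sup>2 / (4 * (real n)\<^sup>2))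
              \<in> point_spectrum (schroedinger W)) \<and>
    (\<rat> \<inter> {0<..} = Theta_pos m \<longrightarrow> dense_pure_point_spectrum (schroedinger W))"
proof -
  interpret block_construction m
    by unfold_locales (rule assms)
  obtain \<psi> where \<psi>: "\<And>i. tuned \<psi> i (\<psi> i)"
    using tuned_phases by blast
  show ?thesis
    by (rule exI[of _ "potential \<psi>"], rule exI[of _ "symbol \<psi>"], intro conjI)
      (use smooth_potential smooth_symbol symbol_has_sum symbol_theta_bound eigenvalue[OF \<psi>]
        dense_eigenvalues[OF \<psi>] in blast)+
qed

end
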